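(* There exists $f\in\mathscr{C}^1_{\mathbb{W}}$ such that, for all open sets $\Omega\subset\mathbb{H}$ and all smooth one-parameter families of contact diffeomorphisms $\Phi_\epsilon:\mathbb{H}\to\mathbb{H}$ with $\Phi_0=\mathrm{Id}$ and $\{\Phi_\epsilon\neq\mathrm{Id}\}\subset\subset\Omega$, it holds $$\left.\frac{d}{d\epsilon}\right|_{\epsilon=0}\mathscr{A}(\Phi_\epsilon(\Gamma_f)\cap\Omega)=0\quad\text{and}\quad\left.\frac{d^2}{d\epsilon^2}\right|_{\epsilon=0}\mathscr{A}(\Phi_\epsilon(\Gamma_f)\cap\Omega)\ge 0,$$ but $\Gamma_f$ is not an area-minimizing surface.
   Context: The first Heisenberg group $\mathbb{H}$ is $\mathbb{R}^3$ with the product $(a,b,c)*(x,y,z)=(a+x,\,b+y,\,c+z+\frac12(ay-bx))$. Let $X=\partial_x-\frac12 y\,\partial_z$, $Y=\partial_y+\frac12 x\,\partial_z$, and let $H\subset T\mathbb{H}$ be the horizontal subbundle spanned pointwise by $X,Y$, with the scalar product making $(X,Y)$ orthonormal and norm $\|\cdot\|$. A contact diffeomorphism is a diffeomorphism $\Phi:\mathbb{H}\to\mathbb{H}$ with $d\Phi(H)\subset H$. A family $\{\Phi_\epsilon\}$, with $\epsilon$ in an open interval around $0$, is smooth if $(\epsilon,p)\mapsto\Phi_\epsilon(p)$ is smooth. $A\subset\subset\Omega$ means that the closure of $A$ is a compact subset of $\Omega$. Perimeter: for $E\subset\mathbb{H}$ measurable and $\Omega\subset\mathbb{H}$ open, $P(E;\Omega)=\sup\{\int_E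 \mathrm{div}V\,d\mathscr{L}^3: V \text{ smooth section of } H,\ \mathrm{spt}(V)\subset\subset\Omega,\ \|V\|\le1\}$, with $\mathrm{div}$ the usual divergence in $\mathbb{R}^3$ and $\mathscr{L}^3$ Lebesgue measure. A measurable set $E$ has minimal perimeter if $P(E;\Omega)\le P(F;\Omega)$ for every bounded open $\Omega\subset\mathbb{H}$ and every measurable $F\subset\mathbb{H}$ with symmetric difference $E\Delta F\subset\subset\Omega$. Intrinsic graphs: for $f:\mathbb{R}^2\to\mathbb{R}$, $\Gamma_f=\{(0,\eta,\tau)*(f(\eta,\tau),0,0):(\eta,\tau)\in\mathbb{R}^2\}$ and $E_f=\{(0,\eta,\tau)*(\xi,0,0):(\eta,\tau)\in\mathbb{R}^2,\ \xi\le f(\eta,\tau)\}$. $\Gamma_f$ is an area-minimizing surface if $E_f$ has minimal perimeter. The intrinsic area $\mathscr{A}$ is the perimeter of the set bounded by the surface: $\mathscr{A}(\Phi_\epsilon(\Gamma_f)\cap\Omega)=P(\Phi_\epsilon(E_f);\Omega)$. The space $\mathscr{C}^1_{\mathbb{W}}$: the continuous $f:\mathbb{R}^2\to\mathbb{R}$ for which there is $\psi:\mathbb{R}^2\to\mathbb{R}$ (necessarily continuous, denoted $\nabla^f f$) such that, writing $f_0=f(\eta_0,\tau_0)$, the functions $(\eta,\tau)\mapsto\lambda\big(-f_0+f(\eta_0+\frac{\eta}{\lambda},\,\tau_0+f_0\frac{\eta}{\lambda}+\frac{\tau}{\lambda^2})\big)$ converge, as $\lambda\to+\infty$, uniformly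 on compact sets to $(\eta,\tau)\mapsto\psi(\eta_0,\tau_0)\eta$, the convergence being uniform for $(\eta_0,\tau_0)$ in compact sets. (Equivalently, $f$ is continuous and the distribution $\partial_\eta f+\frac12\partial_\tau(f^2)$ is a continuous function, which then equals $\nabla^f f$.)
   Formalization: The variation formulas are asserted for open Ω in which Γ_f has finite area (proved for every bounded Ω), since otherwise the derivatives are undefined, and the sets {Φ_ε≠Id} are required to lie in one bounded set for all ε, which is automatic if Ω is bounded. *)

theory Defs
  imports "HOL-Analysis.Analysis"
begin

section \<open>Smooth maps and compact containment\<close>

text \<open>\<open>Ck_on k S f\<close> is meant for open \<open>S\<close>: it says that \<open>f\<close> is of class \<open>C\<^sup>k\<close> on \<open>S\<close>.\<close>

primrec Ck_on :: "nat \<Rightarrow> 'a set \<Rightarrow> ('a::euclidean_space \<Rightarrow> 'b::euclidean_space) \<Rightarrow> bool" where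
  "Ck_on 0 S f \<longleftrightarrow> continuous_on S f"
| "Ck_on (Suc k) S f \<longleftrightarrow>
     (\<forall>x\<in>S. f differentiable (at x)) \<and> (\<forall>v. Ck_on k S (\<lambda>x. frechet_derivative f (at x) v))"

definition smooth_on :: "'a set \<Rightarrow> ('a::euclidean_space \<Rightarrow> 'b::euclidean_space) \<Rightarrow> bool" where
  "smooth_on S f \<longleftrightarrow> (\<forall>k. Ck_on k S f)"

definition diffeomorphism :: "('a::euclidean_space \<Rightarrow> 'a) \<Rightarrow> bool" where
  "diffeomorphism \<Phi> \<longleftrightarrow> bij \<Phi> \<and> smooth_on UNIV \<Phi> \<and> smooth_on UNIV (inv \<Phi>)"

definition compactly_in :: "'a::topological_space set \<Rightarrow> 'a set \<Rightarrow> bool"  (infix \<open>\<subset>\<subset>\<close> 50) where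
  "A \<subset>\<subset> \<Omega> \<longleftrightarrow> compact (closure A) \<and> closure A \<subseteq> \<Omega>"


section \<open>The Heisenberg group and its horizontal bundle\<close>

type_synonym heis = "real \<times> real \<times> real"

definition hmult :: "heis \<Rightarrow> heis \<Rightarrow> heis"  (infixl \<open>\<star>\<close> 70) where
  "p \<star> q = (case (p, q) of ((a, b, c), (x, y, z)) \<Rightarrow>
              (a + x, b + y, c + z + (a * y - b * x) / 2))"

text \<open>Vector fields are maps \<open>heis \<Rightarrow> heis\<close>: a derivation
  \<open>u \<partial>\<^sub>x + v \<partial>\<^sub>y + w \<partial>\<^sub>z\<close> is identified with its coefficient vector \<open>(u, v, w)\<close>.\<close>

definition X_field :: "heis \<Rightarrow> heis" where
  "X_field = (\<lambda>(x, y, z). (1, 0, - y / 2))"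

definition Y_field :: "heis \<Rightarrow> heis" where
  "Y_field = (\<lambda>(x, y, z). (0, 1, x / 2))"

definition horizontal :: "heis \<Rightarrow> heis set" where
  "horizontal p = span {X_field p, Y_field p}"

text \<open>The first two entries of a horizontal vector are its coordinates in the basis \<open>(X, Y)\<close>.\<close>

definition hnorm :: "heis \<Rightarrow> real" where
  "hnorm v = (case v of (a, b, c) \<Rightarrow> sqrt (a\<^sup>2 + b\<^sup>2))"

lemma hnorm_orthonormal_frame:
  "hnorm (a *\<^sub>R X_field p + b *\<^sub>R Y_field p) = sqrt (a\<^sup>2 + b\<^sup>2)"
  by (cases p) (simp add: hnorm_def X_field_def Y_field_def)

definition contact_diffeomorphism :: "(heis \<Rightarrow> heis) \<Rightarrow> bool" where
  "contact_diffeomorphism \<Phi> \<longleftrightarrow> diffeomorphism \<Phi> \<and>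
     (\<forall>p. frechet_derivative \<Phi> (at p) ` horizontal p \<subseteq> horizontal (\<Phi> p))"


section \<open>Perimeter\<close>

definition divergence :: "('a::euclidean_space \<Rightarrow> 'a) \<Rightarrow> 'a \<Rightarrow> real" where
  "divergence V p = (\<Sum>e\<in>Basis. frechet_derivative V (at p) e \<bullet> e)"

definition test_fields :: "heis set \<Rightarrow> (heis \<Rightarrow> heis) set" where
  "test_fields \<Omega> = {V. smooth_on UNIV V \<and> (\<forall>p. V p \<in> horizontal p) \<and>
      closure {p. V p \<noteq> 0} \<subset>\<subset> \<Omega> \<and> (\<forall>p. hnorm (V p) \<le> 1)}"

definition perimeter :: "heis set \<Rightarrow> heis set \<Rightarrow> ereal" where
  "perimeter E \<Omega> = (SUP V\<in>test_fields \<Omega>. ereal (LINT p:E|lebesgue. divergence V p))"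

definition minimal_perimeter :: "heis set \<Rightarrow> bool" where
  "minimal_perimeter E \<longleftrightarrow> E \<in> sets lebesgue \<and>
     (\<forall>\<Omega> F. open \<Omega> \<and> bounded \<Omega> \<and> F \<in> sets lebesgue \<and> (E - F) \<union> (F - E) \<subset>\<subset> \<Omega>
        \<longrightarrow> perimeter E \<Omega> \<le> perimeter F \<Omega>)"


section \<open>Intrinsic graphs\<close>

definition intrinsic_subgraph :: "(real \<times> real \<Rightarrow> real) \<Rightarrow> heis set" where
  "intrinsic_subgraph f = {(0, \<eta>, \<tau>) \<star> (\<xi>, 0, 0) | \<eta> \<tau> \<xi>. \<xi> \<le> f (\<eta>, \<tau>)}"

lemma intrinsic_subgraph_eq:
  "intrinsic_subgraph f = {p. fst p \<le> f (fst (snd p), snd (snd p) + fst p * fst (snd p) / 2)}"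
  (is "_ = ?R")
proof (rule set_eqI)
  fix p :: heis
  obtain x y z where p: "p = (x, y, z)" by (cases p)
  show "p \<in> intrinsic_subgraph f \<longleftrightarrow> p \<in> ?R"
  proof
    assume "p \<in> intrinsic_subgraph f"
    then show "p \<in> ?R"
      by (auto simp: intrinsic_subgraph_def hmult_def p mult.commute)
  next
    assume "p \<in> ?R"
    then have "p = (0, y, z + x * y / 2) \<star> (x, 0, 0) \<and> x \<le> f (y, z + x * y / 2)"
      by (simp add: hmult_def p)
    then show "p \<in> intrinsic_subgraph f"
      unfolding intrinsic_subgraph_def by blast
  qed
qed

lemma closed_intrinsic_subgraph:
  assumes "continuous_on UNIV f"
  shows "closed (intrinsic_subgraph f)"
  unfolding intrinsic_subgraph_eq
  by (intro closed_Collect_le continuous_intros continuous_on_compose2[OF assms]) auto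

text \<open>The intrinsic area of the part in \<open>\<Omega>\<close> of the image under \<open>\<Phi>\<close> of the intrinsic graph
  \<open>\<Gamma>\<^sub>f = {(0, \<eta>, \<tau>) \<star> (f (\<eta>, \<tau>), 0, 0)}\<close> is the perimeter in \<open>\<Omega>\<close> of the
  image of the set that \<open>\<Gamma>\<^sub>f\<close> bounds. It can be infinite if \<open>\<Omega>\<close> is unbounded, and
  then has no derivative along a family \<open>\<Phi>\<^sub>\<epsilon>\<close>.\<close>

definition image_area :: "(heis \<Rightarrow> heis) \<Rightarrow> (real \<times> real \<Rightarrow> real) \<Rightarrow> heis set \<Rightarrow> ereal" where
  "image_area \<Phi> f \<Omega> = perimeter (\<Phi> ` intrinsic_subgraph f) \<Omega>"

definition area_minimizing_graph :: "(real \<times> real \<Rightarrow> real) \<Rightarrow> bool" where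
  "area_minimizing_graph f \<longleftrightarrow> minimal_perimeter (intrinsic_subgraph f)"

definition C1W :: "(real \<times> real \<Rightarrow> real) set" where
  "C1W = {f. continuous_on UNIV f \<and>
     (\<exists>\<psi>. \<forall>K L. compact K \<and> compact L \<longrightarrow>
        uniform_limit (K \<times> L)
          (\<lambda>s ((\<eta>\<^sub>0, \<tau>\<^sub>0), (\<eta>, \<tau>)).
              s * (- f (\<eta>\<^sub>0, \<tau>\<^sub>0) + f (\<eta>\<^sub>0 + \<eta> / s, \<tau>\<^sub>0 + f (\<eta>\<^sub>0, \<tau>\<^sub>0) * \<eta> / s + \<tau> / s\<^sup>2)))
          (\<lambda>((\<eta>\<^sub>0, \<tau>\<^sub>0), (\<eta>, \<tau>)). \<psi> (\<eta>\<^sub>0, \<tau>\<^sub>0) * \<eta>)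
          (at_top :: real filter))}"


section \<open>Contact variations\<close>

text \<open>Every \<open>{\<Phi>\<^sub>\<epsilon> \<noteq> Id}\<close> is compactly contained in \<open>\<Omega>\<close>. These sets are moreover required to
  stay in one bounded set, which is automatic if \<open>\<Omega>\<close> is bounded. On an unbounded \<open>\<Omega>\<close> of finite
  area, bumps of \<open>\<Phi>\<^sub>\<epsilon>\<close> could otherwise escape to infinity as \<open>\<epsilon> \<rightarrow> 0\<close>
  and make the area discontinuous at \<open>\<epsilon> = 0\<close>.\<close>

definition contact_variation :: "heis set \<Rightarrow> real set \<Rightarrow> (real \<Rightarrow> heis \<Rightarrow> heis) \<Rightarrow> bool" where
  "contact_variation \<Omega> I \<Phi> \<longleftrightarrow>
     open I \<and> is_interval I \<and> 0 \<in> I \<and>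
     smooth_on (I \<times> UNIV) (\<lambda>(\<epsilon>, p). \<Phi> \<epsilon> p) \<and>
     (\<forall>\<epsilon>\<in>I. contact_diffeomorphism (\<Phi> \<epsilon>)) \<and>
     \<Phi> 0 = id \<and>
     (\<forall>\<epsilon>\<in>I. {p. \<Phi> \<epsilon> p \<noteq> p} \<subset>\<subset> \<Omega>) \<and>
     bounded (\<Union>\<epsilon>\<in>I. {p. \<Phi> \<epsilon> p \<noteq> p})"

end

theory Submission
  imports Defs "HOL-Real_Asymp.Real_Asymp"
begin

text \<open>The graph of \<open>f (\<eta>, \<tau>) = \<eta> \<tau> / (1 + \<eta>\<^sup>2 / 2)\<close> is the surface \<open>x = y z\<close>. It is ruled by the horizontal
  lines \<open>t \<mapsto> (c t, t, c)\<close>. By the divergence theorem and a change of variables, the area of its image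
  \<open>\<sigma> (t, c)\<close> under a contact diffeomorphism is the integral of \<open>J \<bar>\<partial>\<^sub>t (\<sigma>\<^sub>1, \<sigma>\<^sub>2)\<bar>\<close>, where \<open>J\<close> is the contact
  form on \<open>\<partial>\<^sub>c \<sigma>\<close>. Replacing the speed by its component in the direction \<open>e (c)\<close> of the unperturbed line
  decreases the integral; since \<open>\<partial>\<^sub>t J\<close> is a Jacobian of \<open>(\<sigma>\<^sub>1, \<sigma>\<^sub>2)\<close>, what remains is a divergence
  plus a term which is non-negative because the slope \<open>c\<close> of the lines increases with \<open>c\<close>. So the surface
  is a local minimum along every contact variation, and the derivatives have the right signs.
  Raising the surface in the direction of \<open>x\<close> by a small multiple of a bump function, which is not a
  contact variation, decreases the area to second order.\<close>

section \<open>Calculus of smooth maps\<close>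

text \<open>The lower bound is a calibration argument: it treats every nearby contact image at once,
  so no second variation formula is computed and minimality at 0 alone gives both derivative
  conditions. Its one condition, that the images of the rulings still advance in the direction
  \<open>e\<close>, holds for small \<epsilon> by compactness. Contact maps matter twice: they keep
  the rulings horizontal, which makes the derivative of \<open>J\<close> a Jacobian, and their
  compact support fixes the far ends of every ruling, which removes boundary terms. Raising x = y z
  by \<phi> is not restricted in this way. Up to a divergence the second-order part of the area is
  the integral of w^3 times (\<phi>_y + y \<phi> / 2)^2 / (2 P) - \<phi>^2 / 4, where P = 1 + y^2 /
  2 and w = 1 / sqrt (1 + z^2). The first square vanishes for the profile exp (- y^2 / 4), and no
  derivative of \<phi> in z occurs, so a cutoff in z is free to second order. The competitor
  replaces the Gaussian by a compactly supported piecewise polynomial, takes the height 1/20, and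
  verifies the gain with rational constants.\<close>

lemma Ck_on_cong:
  assumes "open S" "\<And>x. x \<in> S \<Longrightarrow> f x = g x" "Ck_on k S f"
  shows "Ck_on k S g"
  using assms
proof (induction k arbitrary: f g)
  case 0
  then show ?case by (simp cong: continuous_on_cong)
next
  case (Suc k)
  have D: "(g has_derivative f') (at x) \<longleftrightarrow> (f has_derivative f') (at x)" if "x \<in> S" for x f'
    using has_derivative_transform_within_open[of f f' x UNIV S g]
      has_derivative_transform_within_open[of g f' x UNIV S f] that Suc.prems by auto
  have E: "frechet_derivative f (at x) v = frechet_derivative g (at x) v" if "x \<in> S" for x v
    unfolding frechet_derivative_def D[OF that] ..
  have "Ck_on k S (\<lambda>x. frechet_derivative f (at x) v)" for v
    using Suc.prems(3) by simp
  then have "Ck_on k S (\<lambda>x. frechet_derivative g (at x) v)" for v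
    using E by (intro Suc.IH[of "\<lambda>x. frechet_derivative f (at x) v" "\<lambda>x. frechet_derivative g (at x) v"])
      (use Suc.prems(1) in simp_all)
  moreover have "g differentiable (at x)" if "x \<in> S" for x
    using D[OF that] Suc.prems(3) that unfolding differentiable_def Ck_on.simps by blast
  ultimately show ?case by simp
qed

lemma Ck_on_SucD: "Ck_on (Suc k) S f \<Longrightarrow> Ck_on k S f"
proof (induction k arbitrary: f)
  case 0
  then show ?case
    by (auto intro!: differentiable_imp_continuous_on simp: differentiable_on_def differentiable_at_withinI)
next
  case (Suc k)
  then show ?case by auto
qed

lemma Ck_on_mono: "Ck_on n S f \<Longrightarrow> m \<le> n \<Longrightarrow> Ck_on m S f"
  by (induction n) (auto simp: le_Suc_eq simp del: Ck_on.simps dest: Ck_on_SucD)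

lemma Ck_on_SucI:
  assumes "open S" "\<And>x. x \<in> S \<Longrightarrow> (f has_derivative f' x) (at x)"
    and "\<And>v. Ck_on k S (\<lambda>x. f' x v)"
  shows "Ck_on (Suc k) S f"
proof -
  have "Ck_on k S (\<lambda>x. frechet_derivative f (at x) v)" for v
    by (rule Ck_on_cong[OF assms(1) _ assms(3)]) (simp add: frechet_derivative_at[OF assms(2)])
  then show ?thesis
    using assms(2) unfolding differentiable_def Ck_on.simps by blast
qed

lemma Ck_on_SucD_deriv:
  "Ck_on (Suc k) S f \<Longrightarrow> x \<in> S \<Longrightarrow> (f has_derivative frechet_derivative f (at x)) (at x)"
  by (simp add: frechet_derivative_works)

lemma Ck_on_const: "Ck_on k S (\<lambda>x. c)"
  by (induction k arbitrary: c) auto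

lemma Ck_on_bounded_linear:
  assumes "open S" "bounded_linear h" "Ck_on k S f"
  shows "Ck_on k S (\<lambda>x. h (f x))"
  using assms(3)
proof (induction k arbitrary: f)
  case 0
  then show ?case using assms(2) by (auto intro: bounded_linear.continuous_on)
next
  case (Suc k)
  show ?case
    by (rule Ck_on_SucI[OF assms(1) bounded_linear.has_derivative[OF assms(2) Ck_on_SucD_deriv[OF Suc.prems]]])
      (use Suc in auto)
qed

lemma Ck_on_id: "open S \<Longrightarrow> Ck_on k S (\<lambda>x. x)"
  by (cases k) (auto intro!: Ck_on_SucI[where f'="\<lambda>x v. v"] Ck_on_const simp: continuous_on_id)

lemma Ck_on_add:
  assumes "open S" "Ck_on k S f" "Ck_on k S g"
  shows "Ck_on k S (\<lambda>x. f x + g x)"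
  using assms(2,3)
proof (induction k arbitrary: f g)
  case 0
  then show ?case by (auto intro: continuous_intros)
next
  case (Suc k)
  show ?case
    by (rule Ck_on_SucI[OF assms(1) has_derivative_add[OF Ck_on_SucD_deriv[OF Suc.prems(1)] Ck_on_SucD_deriv[OF Suc.prems(2)]]])
      (use Suc in auto)
qed

lemma Ck_on_sum:
  assumes "open S" "\<And>i. i \<in> I \<Longrightarrow> Ck_on k S (f i)"
  shows "Ck_on k S (\<lambda>x. \<Sum>i\<in>I. f i x)"
  using assms(2) by (induction I rule: infinite_finite_induct) (auto intro: Ck_on_const Ck_on_add[OF assms(1)])

lemma Ck_on_bilinear:
  assumes "open S" "bounded_bilinear h" "Ck_on k S f" "Ck_on k S g"
  shows "Ck_on k S (\<lambda>x. h (f x) (g x))"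
  using assms(3,4)
proof (induction k arbitrary: f g)
  case 0
  then show ?case using assms(2) by (auto intro: bounded_bilinear.continuous_on)
next
  case (Suc k)
  show ?case
  proof (rule Ck_on_SucI[OF assms(1) bounded_bilinear.FDERIV[OF assms(2) Ck_on_SucD_deriv[OF Suc.prems(1)] Ck_on_SucD_deriv[OF Suc.prems(2)]]])
    fix v
    have "Ck_on k S f" "Ck_on k S g"
      using Suc.prems Ck_on_SucD by blast+
    then show "Ck_on k S (\<lambda>x. h (f x) (frechet_derivative g (at x) v) + h (frechet_derivative f (at x) v) (g x))"
      by (intro Ck_on_add[OF assms(1)] Suc.IH) (use Suc.prems in auto)
  qed
qed

lemma Ck_on_compose:
  assumes "open S" "open T" "f ` S \<subseteq> T" "Ck_on k T g" "Ck_on k S f"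
  shows "Ck_on k S (\<lambda>x. g (f x))"
  using assms(3-5)
proof (induction k arbitrary: g)
  case 0
  then show ?case by (auto intro: continuous_on_compose2)
next
  case (Suc k)
  let ?f' = "\<lambda>x. frechet_derivative f (at x)" and ?g' = "\<lambda>x. frechet_derivative g (at x)"
  \<comment> \<open>\<open>Ck_on\<close> speaks of derivatives in fixed directions, whereas here
    \<open>g\<close> is differentiated in the moving direction \<open>?f' x v\<close>. Expanding
    that direction over \<open>Basis\<close> leaves scalar coefficients times derivatives of
    \<open>g\<close> in fixed directions, to which the induction hypothesis applies.\<close>
  have D: "((\<lambda>x. g (f x)) has_derivative (\<lambda>v. \<Sum>b\<in>Basis. (?f' x v \<bullet> b) *\<^sub>R ?g' (f x) b)) (at x)"
    if "x \<in> S" for x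
  proof -
    have "((\<lambda>x. g (f x)) has_derivative (\<lambda>v. ?g' (f x) (?f' x v))) (at x)"
      by (rule has_derivative_compose[OF Ck_on_SucD_deriv[OF Suc.prems(3) that]])
        (use Ck_on_SucD_deriv[OF Suc.prems(2)] Suc.prems(1) that in auto)
    moreover have "linear (?g' (f x))"
      using Ck_on_SucD_deriv[OF Suc.prems(2)] Suc.prems(1) that has_derivative_linear by blast
    then have eq: "?g' (f x) w = (\<Sum>b\<in>Basis. (w \<bullet> b) *\<^sub>R ?g' (f x) b)" for w
      by (subst euclidean_representation[of w, symmetric]) (simp add: linear_sum linear_scale del: euclidean_representation)
    ultimately show ?thesis by (subst eq[symmetric])
  qed
  show ?case
  proof (rule Ck_on_SucI[OF assms(1) D])
    fix v
    show "Ck_on k S (\<lambda>x. \<Sum>b\<in>Basis. (?f' x v \<bullet> b) *\<^sub>R ?g' (f x) b)"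
      by (intro Ck_on_sum Ck_on_bilinear[OF _ bounded_bilinear_scaleR] Suc.IH
          Ck_on_bounded_linear[OF _ bounded_linear_inner_left] assms(1))
        (use Suc.prems Ck_on_SucD[OF Suc.prems(3)] in auto)
  qed
qed

lemma Ck_on_Pair:
  assumes "open S" "Ck_on k S f" "Ck_on k S g"
  shows "Ck_on k S (\<lambda>x. (f x, g x))"
proof -
  have "Ck_on k S (\<lambda>x. (f x, 0) + (0, g x))"
    by (intro Ck_on_add Ck_on_bounded_linear[where h="\<lambda>y. (y, 0)"] Ck_on_bounded_linear[where h="\<lambda>y. (0, y)"]
       assms bounded_linear_Pair bounded_linear_zero bounded_linear_ident)
  then show ?thesis by simp
qed

lemma Ck_on_inverse:
  assumes "open S" "Ck_on k S f" "\<And>x. x \<in> S \<Longrightarrow> f x \<noteq> 0"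
  shows "Ck_on k S (\<lambda>x. inverse (f x :: real))"
proof -
  have "Ck_on k (- {0}) (inverse :: real \<Rightarrow> real)"
  proof (induction k)
    case 0
    show ?case by (auto intro!: continuous_intros)
  next
    case (Suc k)
    show ?case
      by (rule Ck_on_SucI[where f'="\<lambda>x v. - (inverse x * v * inverse x)"])
        (auto intro!: derivative_eq_intros Ck_on_bilinear[OF _ bounded_bilinear_mult]
          Ck_on_bounded_linear[OF _ bounded_linear_minus[OF bounded_linear_ident]] Suc Ck_on_const)
  qed
  then show ?thesis
    by (rule Ck_on_compose[OF assms(1) _ _ _ assms(2), rotated 2]) (use assms(3) in auto)
qed

lemma Ck_on_sqrt:
  assumes "open S" "Ck_on k S f" "\<And>x. x \<in> S \<Longrightarrow> f x > 0"
  shows "Ck_on k S (\<lambda>x. sqrt (f x))"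
proof -
  have "Ck_on k {0<..} sqrt"
  proof (induction k)
    case 0
    show ?case by (auto intro!: continuous_intros)
  next
    case (Suc k)
    have D: "(sqrt has_derivative (\<lambda>v. v * (inverse (sqrt x) * (1/2)))) (at x)" if "x \<in> {0<..}" for x
      using that by (auto intro!: derivative_eq_intros simp: divide_simps)
    show ?case
      by (rule Ck_on_SucI[OF _ D]; (intro Ck_on_bilinear[OF _ bounded_bilinear_mult] Ck_on_inverse Suc Ck_on_const)?) auto
  qed
  then show ?thesis
    by (rule Ck_on_compose[OF assms(1) _ _ _ assms(2), rotated 2]) (use assms(3) in auto)
qed

lemma Ck_on_mult:
  fixes f g :: "'a::euclidean_space \<Rightarrow> real"
  shows "open S \<Longrightarrow> Ck_on k S f \<Longrightarrow> Ck_on k S g \<Longrightarrow> Ck_on k S (\<lambda>x. f x * g x)"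
  using Ck_on_bilinear[OF _ bounded_bilinear_mult] .

lemma Ck_on_divide:
  fixes f g :: "'a::euclidean_space \<Rightarrow> real"
  shows "open S \<Longrightarrow> Ck_on k S f \<Longrightarrow> Ck_on k S g \<Longrightarrow> (\<And>x. x \<in> S \<Longrightarrow> g x \<noteq> 0) \<Longrightarrow> Ck_on k S (\<lambda>x. f x / g x)"
  unfolding divide_inverse by (intro Ck_on_mult Ck_on_inverse)

lemma Ck_on_minus: "open S \<Longrightarrow> Ck_on k S f \<Longrightarrow> Ck_on k S (\<lambda>x. - f x)"
  by (rule Ck_on_bounded_linear[OF _ bounded_linear_minus[OF bounded_linear_ident]])

lemma Ck_on_diff: "open S \<Longrightarrow> Ck_on k S f \<Longrightarrow> Ck_on k S g \<Longrightarrow> Ck_on k S (\<lambda>x. f x - g x)"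
  using Ck_on_add[OF _ _ Ck_on_minus, of S k f g] by simp

lemma Ck_on_power: "open S \<Longrightarrow> Ck_on k S f \<Longrightarrow> Ck_on k S (\<lambda>x. f x ^ n :: real)"
  by (induction n) (auto intro: Ck_on_const Ck_on_mult)

lemma Ck_on_prod:
  assumes "open S" "\<And>i. i \<in> I \<Longrightarrow> Ck_on k S (f i)"
  shows "Ck_on k S (\<lambda>x. \<Prod>i\<in>I. f i x :: real)"
  using assms(2) by (induction I rule: infinite_finite_induct) (auto intro: Ck_on_const Ck_on_mult[OF assms(1)])

lemma Ck_on_fst: "open S \<Longrightarrow> Ck_on k S f \<Longrightarrow> Ck_on k S (\<lambda>x. fst (f x))"
  and Ck_on_snd: "open S \<Longrightarrow> Ck_on k S f \<Longrightarrow> Ck_on k S (\<lambda>x. snd (f x))"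
  by (auto intro: Ck_on_bounded_linear bounded_linear_fst bounded_linear_snd)

lemma Ck_on_scaleR: "open S \<Longrightarrow> Ck_on k S g \<Longrightarrow> Ck_on k S f \<Longrightarrow> Ck_on k S (\<lambda>x. g x *\<^sub>R f x)"
  and Ck_on_inner: "open S \<Longrightarrow> Ck_on k S f \<Longrightarrow> Ck_on k S h \<Longrightarrow> Ck_on k S (\<lambda>x. f x \<bullet> h x)"
  by (auto intro: Ck_on_bilinear[OF _ bounded_bilinear_scaleR] Ck_on_bilinear[OF _ bounded_bilinear_inner])

lemmas Ck_intros = Ck_on_const Ck_on_id Ck_on_add Ck_on_diff Ck_on_minus Ck_on_mult Ck_on_divide
  Ck_on_power Ck_on_Pair Ck_on_fst Ck_on_snd Ck_on_scaleR Ck_on_inner Ck_on_sum Ck_on_prod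

text \<open>The derivatives of \<open>exp (- 1 / x)\<close> are combinations of the functions \<open>exp (- 1 / x) / x ^ n\<close>,
  so all of these are treated simultaneously.\<close>

definition flat_exp :: "nat \<Rightarrow> real \<Rightarrow> real" where
  "flat_exp n x = (if x > 0 then exp (- 1 / x) / x ^ n else 0)"

lemma flat_exp_has_derivative:
  "(flat_exp n has_real_derivative flat_exp (n + 2) x - n * flat_exp (n + 1) x) (at x)"
proof (rule linorder_cases[of x 0])
  assume "x < 0"
  have "((\<lambda>x. 0) has_real_derivative 0) (at x)" by simp
  then have "(flat_exp n has_real_derivative 0) (at x)"
    by (rule has_field_derivative_transform_within_open[of _ _ _ "{..<0}"])
      (use \<open>x < 0\<close> in \<open>auto simp: flat_exp_def\<close>)
  then show ?thesis using \<open>x < 0\<close> by (simp add: flat_exp_def)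
next
  assume "x > 0"
  have "((\<lambda>x. exp (- 1 / x) / x ^ n) has_real_derivative
     exp (- 1 / x) / x ^ (n + 2) - n * (exp (- 1 / x) / x ^ (n + 1))) (at x)"
  proof (cases n)
    case 0
    then show ?thesis
      using \<open>x > 0\<close> by (auto intro!: derivative_eq_intros simp: field_simps power2_eq_square)
  next
    case (Suc m)
    have "((\<lambda>x. exp (- 1 / x) / x ^ n) has_real_derivative
      (exp (- 1 / x) * (1 / x\<^sup>2) * x ^ n - exp (- 1 / x) * (n * x ^ m)) / (x ^ n * x ^ n)) (at x)"
    proof (rule DERIV_divide)
      show "((\<lambda>x. exp (- 1 / x)) has_real_derivative exp (- 1 / x) * (1 / x\<^sup>2)) (at x)"
        using \<open>x > 0\<close> by (auto intro!: derivative_eq_intros simp: power2_eq_square)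
      show "((\<lambda>x. x ^ n) has_real_derivative n * x ^ m) (at x)"
        using DERIV_power[OF DERIV_ident, of n x UNIV] Suc by simp
    qed (use \<open>x > 0\<close> in auto)
    then show ?thesis
      by (rule back_subst) (use \<open>x > 0\<close> Suc in \<open>simp add: field_simps power2_eq_square\<close>)
  qed
  then have "(flat_exp n has_real_derivative (exp (- 1 / x) / x ^ (n + 2) - n * (exp (- 1 / x) / x ^ (n + 1)))) (at x)"
    by (rule has_field_derivative_transform_within_open[of _ _ _ "{0<..}"])
      (use \<open>x > 0\<close> in \<open>auto simp: flat_exp_def\<close>)
  then show ?thesis using \<open>x > 0\<close> by (simp add: flat_exp_def)
next
  assume [simp]: "x = 0"
  have "((\<lambda>h. flat_exp n h / h) \<longlongrightarrow> 0) (at_left 0)"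
    by (rule tendsto_eventually) (auto simp: flat_exp_def eventually_at_filter)
  moreover have "((\<lambda>h. exp (- 1 / h) / h ^ n / h) \<longlongrightarrow> 0) (at_right (0::real))"
    by real_asymp
  then have "((\<lambda>h. flat_exp n h / h) \<longlongrightarrow> 0) (at_right 0)"
    by (rule Lim_transform_eventually) (auto simp: flat_exp_def eventually_at_filter)
  ultimately have "((\<lambda>h. flat_exp n h / h) \<longlongrightarrow> 0) (at 0)"
    by (simp add: filterlim_split_at)
  then show ?thesis
    by (simp add: DERIV_def flat_exp_def)
qed

lemma Ck_on_flat_exp: "Ck_on k UNIV (flat_exp n)"
proof (induction k arbitrary: n)
  case 0
  show ?case
    using flat_exp_has_derivative DERIV_isCont by (force intro: continuous_at_imp_continuous_on)
next
  case (Suc k)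
  show ?case
    by (rule Ck_on_SucI[OF _ flat_exp_has_derivative[unfolded has_field_derivative_def]], simp)
      (rule Ck_on_mult Ck_on_diff Ck_on_const Suc open_UNIV)+
qed

lemma smooth_on_imp_Ck_on: "smooth_on S f \<Longrightarrow> Ck_on k S f"
  by (simp add: smooth_on_def)

lemma smooth_on_has_derivative:
  "smooth_on S f \<Longrightarrow> x \<in> S \<Longrightarrow> (f has_derivative frechet_derivative f (at x)) (at x)"
  using Ck_on_SucD_deriv smooth_on_def by blast

lemma smooth_on_frechet_derivative:
  "smooth_on S f \<Longrightarrow> smooth_on S (\<lambda>x. frechet_derivative f (at x) v)"
  by (metis Ck_on.simps(2) smooth_on_def)

lemma smooth_on_continuous_on: "smooth_on S f \<Longrightarrow> continuous_on S f"
  by (metis Ck_on.simps(1) smooth_on_def)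

lemma smooth_on_cong: "open S \<Longrightarrow> (\<And>x. x \<in> S \<Longrightarrow> f x = g x) \<Longrightarrow> smooth_on S f \<Longrightarrow> smooth_on S g"
  by (auto simp: smooth_on_def intro: Ck_on_cong[of S f g])

lemma smooth_on_compose:
  "open S \<Longrightarrow> open T \<Longrightarrow> f ` S \<subseteq> T \<Longrightarrow> smooth_on T g \<Longrightarrow> smooth_on S f \<Longrightarrow> smooth_on S (\<lambda>x. g (f x))"
  by (auto simp: smooth_on_def intro: Ck_on_compose)

lemma smooth_on_const: "smooth_on S (\<lambda>x. c)"
  and smooth_on_id: "open S \<Longrightarrow> smooth_on S (\<lambda>x. x)"
  and smooth_on_add: "open S \<Longrightarrow> smooth_on S f \<Longrightarrow> smooth_on S g \<Longrightarrow> smooth_on S (\<lambda>x. f x + g x)"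
  and smooth_on_diff: "open S \<Longrightarrow> smooth_on S f \<Longrightarrow> smooth_on S g \<Longrightarrow> smooth_on S (\<lambda>x. f x - g x)"
  and smooth_on_minus: "open S \<Longrightarrow> smooth_on S f \<Longrightarrow> smooth_on S (\<lambda>x. - f x)"
  and smooth_on_Pair: "open S \<Longrightarrow> smooth_on S f \<Longrightarrow> smooth_on S h \<Longrightarrow> smooth_on S (\<lambda>x. (f x, h x))"
  and smooth_on_inner: "open S \<Longrightarrow> smooth_on S f \<Longrightarrow> smooth_on S g \<Longrightarrow> smooth_on S (\<lambda>x. f x \<bullet> g x)"
  and smooth_on_scaleR: "open S \<Longrightarrow> smooth_on S u \<Longrightarrow> smooth_on S f \<Longrightarrow> smooth_on S (\<lambda>x. u x *\<^sub>R f x)"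
  by (auto simp: smooth_on_def intro!: Ck_intros)

lemma smooth_on_fst: "open S \<Longrightarrow> smooth_on S f \<Longrightarrow> smooth_on S (\<lambda>x. fst (f x))"
  and smooth_on_snd: "open S \<Longrightarrow> smooth_on S f \<Longrightarrow> smooth_on S (\<lambda>x. snd (f x))"
  by (auto simp: smooth_on_def intro!: Ck_intros)

lemma
  fixes u v :: "'a::euclidean_space \<Rightarrow> real"
  shows smooth_on_mult: "open S \<Longrightarrow> smooth_on S u \<Longrightarrow> smooth_on S v \<Longrightarrow> smooth_on S (\<lambda>x. u x * v x)"
  and smooth_on_divide: "open S \<Longrightarrow> smooth_on S u \<Longrightarrow> smooth_on S v \<Longrightarrow> (\<And>x. x \<in> S \<Longrightarrow> v x \<noteq> 0) \<Longrightarrow> smooth_on S (\<lambda>x. u x / v x)"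
  and smooth_on_power: "open S \<Longrightarrow> smooth_on S u \<Longrightarrow> smooth_on S (\<lambda>x. u x ^ n)"
  and smooth_on_sqrt: "open S \<Longrightarrow> smooth_on S u \<Longrightarrow> (\<And>x. x \<in> S \<Longrightarrow> u x > 0) \<Longrightarrow> smooth_on S (\<lambda>x. sqrt (u x))"
  by (auto simp: smooth_on_def intro!: Ck_intros Ck_on_sqrt)

lemma smooth_on_prod:
  "open S \<Longrightarrow> (\<And>i. i \<in> I \<Longrightarrow> smooth_on S (f i)) \<Longrightarrow> smooth_on S (\<lambda>x. \<Prod>i\<in>I. f i x :: real)"
  by (auto simp: smooth_on_def intro!: Ck_intros)

lemmas smooth_intros = smooth_on_const smooth_on_id smooth_on_add smooth_on_diff smooth_on_minus
  smooth_on_Pair smooth_on_fst smooth_on_snd smooth_on_inner smooth_on_scaleR smooth_on_mult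
  smooth_on_divide smooth_on_power smooth_on_sqrt smooth_on_prod

section \<open>Smooth bumps and cutoffs\<close>

lemma smooth_ball_bump:
  fixes a :: "'a::euclidean_space"
  obtains b :: "'a \<Rightarrow> real" where "smooth_on UNIV b" "\<And>x. 0 \<le> b x" "\<And>x. b x \<le> 1"
    "{x. b x > 0} = ball a r"
proof (cases "r > 0")
  case True
  have *: "flat_exp 0 (r\<^sup>2 - (x - a) \<bullet> (x - a)) > 0 \<longleftrightarrow> x \<in> ball a r" for x
  proof -
    have "x \<in> ball a r \<longleftrightarrow> norm (x - a) < r"
      by (simp add: dist_norm norm_minus_commute)
    then show ?thesis
      using True by (simp add: flat_exp_def norm_lt_square)
  qed
  have "smooth_on UNIV (\<lambda>x. flat_exp 0 (r\<^sup>2 - (x - a) \<bullet> (x - a)))"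
    by (rule smooth_on_compose[of UNIV UNIV "\<lambda>x. r\<^sup>2 - (x - a) \<bullet> (x - a)"])
      (auto intro!: smooth_intros simp: smooth_on_def[of _ "flat_exp 0"] Ck_on_flat_exp)
  moreover have "{x. flat_exp 0 (r\<^sup>2 - (x - a) \<bullet> (x - a)) > 0} = ball a r"
    using * by blast
  moreover have "0 \<le> flat_exp 0 y" "flat_exp 0 y \<le> 1" for y
    by (auto simp: flat_exp_def)
  ultimately show ?thesis
    by (intro that[of "\<lambda>x. flat_exp 0 (r\<^sup>2 - (x - a) \<bullet> (x - a))"])
next
  \<comment> \<open>The formula of the other case sees only r^2, so for negative \<open>r\<close> it
    would describe a nonempty ball.\<close>
  case False
  then have "ball a r = {}" using ball_eq_empty[of a r] by linarith
  show ?thesis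
    by (rule that[of "\<lambda>x. 0"]) (simp_all only: \<open>ball a r = {}\<close> smooth_on_const, simp_all)
qed

text \<open>Cover \<Omega> by countably many balls whose closures lie in \<Omega>, with bumps b_i,
  and take 1 minus the product of (1 - b_i)^n over i < n. Finitely many factors keep the support
  compact, the growing exponent drives the product to 0 wherever some b_i is positive, and factors
  in [0, 1] make the sequence monotone. Monotonicity later gives integrability of the area density
  from finite perimeter.\<close>

lemma smooth_cutoff_sequence:
  fixes \<Omega> :: "'a::euclidean_space set"
  assumes "open \<Omega>"
  obtains \<rho> :: "nat \<Rightarrow> 'a \<Rightarrow> real" where "\<And>n. smooth_on UNIV (\<rho> n)" "\<And>n x. 0 \<le> \<rho> n x" "\<And>n x. \<rho> n x \<le> 1"
    "\<And>n. closure {x. \<rho> n x \<noteq> 0} \<subset>\<subset> \<Omega>" "\<And>x. x \<in> \<Omega> \<Longrightarrow> (\<lambda>n. \<rho> n x) \<longlonglongrightarrow> 1"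
    "\<And>x. incseq (\<lambda>n. \<rho> n x)"
proof -
  obtain B where B: "B \<subseteq> {ball a r |a r. cball a r \<subseteq> \<Omega>}" "countable B" "\<Union>B = \<Union>{ball a r |a r. cball a r \<subseteq> \<Omega>}"
    using Lindelof[of "{ball a r |a r. cball a r \<subseteq> \<Omega>}"] by blast
  have "\<Union>{ball a r |a r. cball a r \<subseteq> \<Omega>} = \<Omega>"
  proof (intro equalityI subsetI)
    fix x assume "x \<in> \<Omega>"
    then obtain e where "e > 0" "cball x e \<subseteq> \<Omega>" using assms open_contains_cball by blast
    then show "x \<in> \<Union>{ball a r |a r. cball a r \<subseteq> \<Omega>}" by (intro UnionI[of "ball x e"]) auto
  qed (use ball_subset_cball in blast)
  with B have BU: "\<Union>B = \<Omega>" by simp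
  \<comment> \<open>The empty ball is adjoined so that the family can be enumerated even if \<Omega>
    is empty.\<close>
  define C where "C = insert {} B"
  have C: "countable C" "C \<noteq> {}" "\<Union>C = \<Omega>" using B BU by (auto simp: C_def)
  have Cball: "\<exists>a r. U = ball a r \<and> cball a r \<subseteq> \<Omega>" if "U \<in> C" for U
  proof (cases "U = {}")
    case True
    then show ?thesis by (rule_tac exI[of _ 0], rule_tac exI[of _ "-1"]) (simp add: ball_empty cball_empty)
  next
    case False
    then show ?thesis using that B by (auto simp: C_def)
  qed
  define U where "U = from_nat_into C"
  have U: "\<And>i. U i \<in> C" "range U = C"
    using C from_nat_into range_from_nat_into unfolding U_def by metis+
  have "\<exists>a r. U i = ball a r \<and> cball a r \<subseteq> \<Omega> \<and>
     (\<exists>b :: 'a \<Rightarrow> real. smooth_on UNIV b \<and> (\<forall>x. 0 \<le> b x \<and> b x \<le> 1) \<and> {x. b x > 0} = U i)" for i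
  proof -
    obtain a r where ar: "U i = ball a r" "cball a r \<subseteq> \<Omega>" using Cball[OF U(1)[of i]] by blast
    obtain b :: "'a \<Rightarrow> real" where "smooth_on UNIV b" "\<And>x. 0 \<le> b x" "\<And>x. b x \<le> 1" "{x. b x > 0} = ball a r"
      by (rule smooth_ball_bump[of a r]) blast
    with ar show ?thesis by metis
  qed
  then obtain a r and b :: "nat \<Rightarrow> 'a \<Rightarrow> real" where *: "\<And>i. U i = ball (a i) (r i) \<and> cball (a i) (r i) \<subseteq> \<Omega> \<and>
     (smooth_on UNIV (b i) \<and> (\<forall>x. 0 \<le> b i x \<and> b i x \<le> 1) \<and> {x. b i x > 0} = U i)"
    by moura
  note ar = *[THEN conjunct1] *[THEN conjunct2, THEN conjunct1]
  have b: "smooth_on UNIV (b i)" "0 \<le> b i x" "b i x \<le> 1" "{x. b i x > 0} = U i" for i x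
    using *[of i] by blast+
  define \<rho> where "\<rho> n x = 1 - (\<Prod>i<n. (1 - b i x) ^ n)" for n x
  have prod01: "0 \<le> (\<Prod>i<n. (1 - b i x) ^ m)" "(\<Prod>i<n. (1 - b i x) ^ m) \<le> 1" for n m x
    using b by (auto intro!: prod_nonneg prod_le_1 power_le_one zero_le_power)
  show ?thesis
  proof
    show "smooth_on UNIV (\<rho> n)" for n
      unfolding \<rho>_def by (intro smooth_intros b) auto
    show "0 \<le> \<rho> n x" "\<rho> n x \<le> 1" for n x using prod01[of x n n] by (auto simp: \<rho>_def)
    show "closure {x. \<rho> n x \<noteq> 0} \<subset>\<subset> \<Omega>" for n
    proof -
      let ?K = "\<Union>i<n. cball (a i) (r i)"
      have "{x. \<rho> n x \<noteq> 0} \<subseteq> ?K"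
      proof
        fix x assume "x \<in> {x. \<rho> n x \<noteq> 0}"
        then have "(\<Prod>i<n. (1 - b i x) ^ n) \<noteq> 1" by (simp add: \<rho>_def)
        then obtain i where i: "i < n" "(1 - b i x) ^ n \<noteq> 1" using prod.neutral[of "{..<n}" "\<lambda>i. (1 - b i x) ^ n"] by blast
        then have "b i x \<noteq> 0" by auto
        then have "b i x > 0" using b(2)[of i x] by linarith
        then have "x \<in> U i" using b(4) by blast
        then show "x \<in> ?K" using i ar(1) ball_subset_cball by blast
      qed
      moreover have K: "compact ?K" by (intro compact_UN) auto
      ultimately have "closure {x. \<rho> n x \<noteq> 0} \<subseteq> ?K"
        by (intro closure_minimal compact_imp_closed)
      moreover from this have "?K \<inter> closure {x. \<rho> n x \<noteq> 0} = closure {x. \<rho> n x \<noteq> 0}"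
        by blast
      then have "compact (closure {x. \<rho> n x \<noteq> 0})"
        using compact_Int_closed[OF K closed_closure, of "{x. \<rho> n x \<noteq> 0}"] by (simp only:)
      moreover have "?K \<subseteq> \<Omega>" using ar by auto
      ultimately show ?thesis unfolding compactly_in_def closure_closure by blast
    qed
    show "incseq (\<lambda>n. \<rho> n x)" for x
    proof (rule incseq_SucI)
      fix n
      have p: "0 \<le> 1 - b i x" "1 - b i x \<le> 1" for i using b by auto
      have "(\<Prod>i<Suc n. (1 - b i x) ^ Suc n) \<le> (\<Prod>i<n. (1 - b i x) ^ Suc n)"
        unfolding prod.lessThan_Suc by (rule mult_left_le[OF power_le_one[OF p] prod01(1)])
      also have "\<dots> \<le> (\<Prod>i<n. (1 - b i x) ^ n)"
        using p by (intro prod_mono) (auto intro!: mult_left_le_one_le)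
      finally show "\<rho> n x \<le> \<rho> (Suc n) x" by (simp add: \<rho>_def)
    qed
    show "(\<lambda>n. \<rho> n x) \<longlonglongrightarrow> 1" if "x \<in> \<Omega>" for x
    proof -
      have "x \<in> \<Union>(range U)" using that C(3) U(2) by simp
      then obtain i where "x \<in> U i" by blast
      then have bi: "b i x > 0" using b(4) by blast
      have "(\<lambda>n. (1 - b i x) ^ n) \<longlonglongrightarrow> 0"
        using bi b(3)[of i x] by (intro LIMSEQ_power_zero) auto
      moreover have "(\<Prod>j<n. (1 - b j x) ^ n) \<le> (1 - b i x) ^ n" if "n > i" for n
      proof -
        have "(\<Prod>j<n. (1 - b j x) ^ n) = (1 - b i x) ^ n * (\<Prod>j\<in>{..<n}-{i}. (1 - b j x) ^ n)"
          using that by (intro prod.remove) auto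
        also have "\<dots> \<le> (1 - b i x) ^ n * 1"
          using b by (intro mult_left_mono prod_le_1) (auto intro!: power_le_one)
        finally show ?thesis by simp
      qed
      then have E: "\<forall>\<^sub>F n in sequentially. (\<Prod>j<n. (1 - b j x) ^ n) \<le> (1 - b i x) ^ n"
        by (rule eventually_mono[OF eventually_gt_at_top])
      moreover have "\<forall>\<^sub>F n in sequentially. 0 \<le> (\<Prod>j<n. (1 - b j x) ^ n)"
        by (intro always_eventually allI prod01)
      ultimately have "(\<lambda>n. \<Prod>j<n. (1 - b j x) ^ n) \<longlonglongrightarrow> 0"
        using tendsto_sandwich[OF _ E tendsto_const] by blast
      then have "(\<lambda>n. 1 - (\<Prod>j<n. (1 - b j x) ^ n)) \<longlonglongrightarrow> 1 - 0" by (intro tendsto_intros)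
      then show ?thesis by (simp add: \<rho>_def)
    qed
  qed
qed

section \<open>Derivatives along lines and symmetry of second derivatives\<close>

lemma Ck_on_1_line_derivative:
  assumes "open S" "Ck_on 1 S u" "x + r *\<^sub>R v \<in> S"
  shows "((\<lambda>r. u (x + r *\<^sub>R v)) has_vector_derivative frechet_derivative u (at (x + r *\<^sub>R v)) v) (at r)"
proof -
  have "(u has_derivative frechet_derivative u (at (x + r *\<^sub>R v))) (at (x + r *\<^sub>R v))"
    using Ck_on_SucD_deriv assms by (metis One_nat_def)
  moreover have "((\<lambda>r. x + r *\<^sub>R v) has_derivative (\<lambda>t. t *\<^sub>R v)) (at r)"
    by (auto intro!: derivative_eq_intros)
  ultimately have "((\<lambda>r. u (x + r *\<^sub>R v)) has_derivative (\<lambda>t. frechet_derivative u (at (x + r *\<^sub>R v)) (t *\<^sub>R v))) (at r)"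
    by (rule has_derivative_compose[where f="\<lambda>r. x + r *\<^sub>R v" and g=u, rotated])
  moreover have "linear (frechet_derivative u (at (x + r *\<^sub>R v)))"
    using \<open>(u has_derivative _) _\<close> has_derivative_linear by blast
  ultimately show ?thesis
    by (simp add: has_vector_derivative_def linear_scale)
qed

lemma Ck_on_frechet_derivative_continuous:
  "Ck_on 1 S u \<Longrightarrow> continuous_on S (\<lambda>x. frechet_derivative u (at x) v)"
  by simp

text \<open>The second difference of \<open>u\<close> over a parallelogram with sides h v and h w is
  symmetric in v and w. Two applications of the mean value theorem write it as h^2 times either
  mixed derivative at nearby points, and continuity lets h tend to 0.\<close>

lemma second_derivative_symmetric:
  fixes u :: "'a::euclidean_space \<Rightarrow> real"
  assumes "Ck_on 2 UNIV u"
  shows "frechet_derivative (\<lambda>y. frechet_derivative u (at y) v) (at x) w =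
         frechet_derivative (\<lambda>y. frechet_derivative u (at y) w) (at x) v"
proof -
  define D where "D v y = frechet_derivative u (at y) v" for v y
  define DD where "DD v w y = frechet_derivative (D v) (at y) w" for v w y
  have u1: "Ck_on 1 UNIV u" using assms Ck_on_mono by (metis one_le_numeral)
  have D1: "Ck_on 1 UNIV (D v)" for v
    using assms unfolding D_def numeral_2_eq_2 One_nat_def Ck_on.simps(2)[of "Suc 0"] by blast
  have cDD: "isCont (DD v w) y" for v w y
    using Ck_on_frechet_derivative_continuous[OF D1] unfolding DD_def
    by (simp add: continuous_on_eq_continuous_at)
  have step: "\<exists>s r. 0 \<le> s \<and> s \<le> h \<and> 0 \<le> r \<and> r \<le> h \<and>
      u (x + h *\<^sub>R v + h *\<^sub>R w) - u (x + h *\<^sub>R v) - u (x + h *\<^sub>R w) + u x = h * h * DD v w (x + s *\<^sub>R v + r *\<^sub>R w)"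
    if "h > 0" for h v w
  proof -
    have "((\<lambda>s. u (x + h *\<^sub>R w + s *\<^sub>R v) - u (x + s *\<^sub>R v)) has_real_derivative
       D v (x + h *\<^sub>R w + s *\<^sub>R v) - D v (x + s *\<^sub>R v)) (at s)" for s
      using Ck_on_1_line_derivative[OF open_UNIV u1, of "x + h *\<^sub>R w" s v] Ck_on_1_line_derivative[OF open_UNIV u1, of x s v]
      unfolding D_def has_real_derivative_iff_has_vector_derivative by (auto intro!: derivative_intros)
    from MVT2[OF \<open>h > 0\<close>, OF this] obtain s where s: "0 < s" "s < h"
      "u (x + h *\<^sub>R w + h *\<^sub>R v) - u (x + h *\<^sub>R v) - (u (x + h *\<^sub>R w) - u x) =
        h * (D v (x + h *\<^sub>R w + s *\<^sub>R v) - D v (x + s *\<^sub>R v))"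
      by auto
    have "((\<lambda>r. D v (x + s *\<^sub>R v + r *\<^sub>R w)) has_real_derivative DD v w (x + s *\<^sub>R v + r *\<^sub>R w)) (at r)" for r
      using Ck_on_1_line_derivative[OF open_UNIV D1, of "x + s *\<^sub>R v" r w v]
      unfolding DD_def has_real_derivative_iff_has_vector_derivative by simp
    from MVT2[OF \<open>h > 0\<close>, OF this] obtain r where r: "0 < r" "r < h"
      "D v (x + s *\<^sub>R v + h *\<^sub>R w) - D v (x + s *\<^sub>R v) = h * DD v w (x + s *\<^sub>R v + r *\<^sub>R w)"
      by auto
    have "u (x + h *\<^sub>R v + h *\<^sub>R w) - u (x + h *\<^sub>R v) - u (x + h *\<^sub>R w) + u x =
       h * (h * DD v w (x + s *\<^sub>R v + r *\<^sub>R w))"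
      using s(3) unfolding r(3)[symmetric] by (simp add: add_ac)
    then show ?thesis using s r by (intro exI[of _ s] exI[of _ r]) auto
  qed
  define h where "h n = 1 / real (Suc n)" for n
  have h: "h n > 0" for n by (simp add: h_def)
  have h0: "h \<longlonglongrightarrow> 0" unfolding h_def by (rule LIMSEQ_Suc[OF lim_1_over_n])
  have "\<forall>n. \<exists>s r s' r'. 0 \<le> s \<and> s \<le> h n \<and> 0 \<le> r \<and> r \<le> h n \<and> 0 \<le> s' \<and> s' \<le> h n \<and> 0 \<le> r' \<and> r' \<le> h n \<and>
     DD v w (x + s *\<^sub>R v + r *\<^sub>R w) = DD w v (x + s' *\<^sub>R w + r' *\<^sub>R v)"
  proof
    fix n
    obtain s r where 1: "0 \<le> s" "s \<le> h n" "0 \<le> r" "r \<le> h n"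
      "u (x + h n *\<^sub>R v + h n *\<^sub>R w) - u (x + h n *\<^sub>R v) - u (x + h n *\<^sub>R w) + u x = h n * h n * DD v w (x + s *\<^sub>R v + r *\<^sub>R w)"
      using step[OF h[of n], of v w] by blast
    obtain s' r' where 2: "0 \<le> s'" "s' \<le> h n" "0 \<le> r'" "r' \<le> h n"
      "u (x + h n *\<^sub>R w + h n *\<^sub>R v) - u (x + h n *\<^sub>R w) - u (x + h n *\<^sub>R v) + u x = h n * h n * DD w v (x + s' *\<^sub>R w + r' *\<^sub>R v)"
      using step[OF h[of n], of w v] by blast
    have "x + h n *\<^sub>R w + h n *\<^sub>R v = x + h n *\<^sub>R v + h n *\<^sub>R w" by (simp add: add_ac)
    then have "h n * h n * DD v w (x + s *\<^sub>R v + r *\<^sub>R w) = h n * h n * DD w v (x + s' *\<^sub>R w + r' *\<^sub>R v)"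
      using 1(5) 2(5) unfolding \<open>x + h n *\<^sub>R w + h n *\<^sub>R v = _\<close> by linarith
    then have "DD v w (x + s *\<^sub>R v + r *\<^sub>R w) = DD w v (x + s' *\<^sub>R w + r' *\<^sub>R v)"
      using h[of n] by simp
    then show "\<exists>s r s' r'. 0 \<le> s \<and> s \<le> h n \<and> 0 \<le> r \<and> r \<le> h n \<and> 0 \<le> s' \<and> s' \<le> h n \<and> 0 \<le> r' \<and> r' \<le> h n \<and>
     DD v w (x + s *\<^sub>R v + r *\<^sub>R w) = DD w v (x + s' *\<^sub>R w + r' *\<^sub>R v)" using 1 2 by blast
  qed
  then obtain s r s' r' where *: "\<And>n. 0 \<le> s n \<and> s n \<le> h n \<and> 0 \<le> r n \<and> r n \<le> h n \<and> 0 \<le> s' n \<and> s' n \<le> h n \<and> 0 \<le> r' n \<and> r' n \<le> h n \<and>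
     DD v w (x + s n *\<^sub>R v + r n *\<^sub>R w) = DD w v (x + s' n *\<^sub>R w + r' n *\<^sub>R v)"
    by moura
  have lim: "z \<longlonglongrightarrow> 0" if "\<And>n. 0 \<le> z n \<and> z n \<le> h n" for z :: "nat \<Rightarrow> real"
    by (rule tendsto_sandwich[OF _ _ tendsto_const h0]) (use that in auto)
  have L: "(\<lambda>n. x + s n *\<^sub>R v + r n *\<^sub>R w) \<longlonglongrightarrow> x + 0 *\<^sub>R v + 0 *\<^sub>R w"
    "(\<lambda>n. x + s' n *\<^sub>R w + r' n *\<^sub>R v) \<longlonglongrightarrow> x + 0 *\<^sub>R w + 0 *\<^sub>R v"
    by (intro tendsto_intros lim; use * in blast)+
  have "(\<lambda>n. DD v w (x + s n *\<^sub>R v + r n *\<^sub>R w)) \<longlonglongrightarrow> DD v w x"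
    "(\<lambda>n. DD w v (x + s' n *\<^sub>R w + r' n *\<^sub>R v)) \<longlonglongrightarrow> DD w v x"
    using isCont_tendsto_compose[OF cDD L(1)] isCont_tendsto_compose[OF cDD L(2)] by simp_all
  then have "DD v w x = DD w v x"
    using * by (simp add: LIMSEQ_unique)
  then show ?thesis by (simp add: DD_def D_def[abs_def])
qed

lemma frechet_derivative_eqI:
  "(f has_derivative f') (at x) \<Longrightarrow> frechet_derivative f (at x) = f'"
  by (rule frechet_derivative_at[symmetric])

lemma frechet_derivative_zero_off_compact:
  fixes f :: "'a::euclidean_space \<Rightarrow> 'b::euclidean_space"
  assumes "compact K" "\<And>x. x \<notin> K \<Longrightarrow> f x = 0" "x \<notin> K"
  shows "frechet_derivative f (at x) = (\<lambda>v. 0)"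
proof -
  have "((\<lambda>x. 0) has_derivative (\<lambda>v. 0)) (at x)" by simp
  then have "(f has_derivative (\<lambda>v. 0)) (at x)"
  proof (rule has_derivative_transform_within_open)
    show "open (- K)" using assms(1) by (simp add: compact_imp_closed open_Compl)
    show "0 = f y" if "y \<in> - K" for y using assms(2)[of y] that by simp
  qed (use assms(3) in simp)
  then show ?thesis by (rule frechet_derivative_eqI)
qed

section \<open>Integration by parts\<close>

lemma continuous_compact_support_integrable:
  fixes f :: "'a::euclidean_space \<Rightarrow> real"
  assumes "continuous_on UNIV f" "compact K" "\<And>x. x \<notin> K \<Longrightarrow> f x = 0"
  shows "integrable lborel f"
proof -
  have "integrable lborel (\<lambda>x. indicator K x *\<^sub>R f x)"
    by (rule borel_integrable_compact) (use assms(2) continuous_on_subset[OF assms(1)] in auto)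
  also have "(\<lambda>x. indicator K x *\<^sub>R f x) = f"
  proof (rule ext)
    show "indicator K x *\<^sub>R f x = f x" for x by (cases "x \<in> K") (simp_all add: assms(3))
  qed
  finally show ?thesis .
qed

lemma lborel_integral_translate:
  fixes f :: "'a::euclidean_space \<Rightarrow> real"
  assumes "f \<in> borel_measurable borel"
  shows "(LINT x|lborel. f (c + x)) = (LINT x|lborel. f x)"
proof -
  have "(LINT x|lborel. f x) = (LINT x|distr lborel borel ((+) c). f x)"
    by (simp add: lborel_distr_plus)
  also have "\<dots> = (LINT x|lborel. f (c + x))"
    by (rule integral_distr) (use assms in auto)
  finally show ?thesis ..
qed

text \<open>The difference quotients of \<open>h\<close> in the direction \<open>v\<close> have
  integral 0 by translation invariance. The mean value theorem bounds them by the maximum of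
  \<bar>h'\<bar>, on a fixed ball since the steps are at most 1, so dominated convergence passes to
  the derivative.\<close>

lemma integral_directional_derivative_eq_0:
  fixes h :: "'a::euclidean_space \<Rightarrow> real"
  assumes "continuous_on UNIV h" "continuous_on UNIV h'"
    and D: "\<And>x. ((\<lambda>r. h (x + r *\<^sub>R v)) has_real_derivative h' x) (at 0)"
    and "compact K" and h0: "\<And>x. x \<notin> K \<Longrightarrow> h x = 0"
  shows "(LINT x|lborel. h' x) = 0"
proof -
  have D': "((\<lambda>r. h (x + r *\<^sub>R v)) has_real_derivative h' (x + r *\<^sub>R v)) (at r)" for x r
  proof -
    have "((\<lambda>t. h (x + (r + t) *\<^sub>R v)) has_real_derivative h' (x + r *\<^sub>R v)) (at 0)"
      using D[of "x + r *\<^sub>R v"] by (simp add: scaleR_add_left add.assoc)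
    then show ?thesis
      using DERIV_shift[of "\<lambda>r. h (x + r *\<^sub>R v)" "h' (x + r *\<^sub>R v)" 0 r] by (simp add: add.commute)
  qed
  have h'0: "h' x = 0" if "x \<notin> K" for x
  proof -
    have "open ((\<lambda>r. x + r *\<^sub>R v) -` (- K))"
      using \<open>compact K\<close> by (intro open_vimage continuous_intros) (auto intro: compact_imp_closed)
    then have "\<forall>\<^sub>F r in nhds 0. r \<in> (\<lambda>r. x + r *\<^sub>R v) -` (- K)"
      using that by (intro eventually_nhds_in_open) auto
    then have "\<forall>\<^sub>F r in nhds 0. x + r *\<^sub>R v \<in> - K" by simp
    then have "((\<lambda>r. h (x + r *\<^sub>R v)) has_real_derivative 0) (at 0)"
      by (subst DERIV_cong_ev[of 0 0 _ "\<lambda>_. 0" 0 0]) (auto elim!: eventually_mono simp: h0)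
    then show ?thesis using D[of x] DERIV_unique by blast
  qed
  obtain M where M: "\<And>x. \<bar>h' x\<bar> \<le> M"
  proof -
    have "compact (h' ` K)" using assms by (auto intro: compact_continuous_image continuous_on_subset)
    then obtain M where "\<And>x. x \<in> K \<Longrightarrow> \<bar>h' x\<bar> \<le> M"
      using compact_imp_bounded bounded_iff by (metis image_eqI real_norm_def)
    then show ?thesis using h'0 by (intro that[of "max M 0"]) (smt (verit))
  qed
  obtain R where R: "\<And>x. x \<in> K \<Longrightarrow> norm x \<le> R"
    using \<open>compact K\<close> compact_imp_bounded bounded_iff by metis
  define t where "t n = 1 / real (Suc n)" for n
  have t: "0 < t n" "t n \<le> 1" for n by (auto simp: t_def)
  have t0: "t \<longlonglongrightarrow> 0" unfolding t_def by (rule LIMSEQ_Suc[OF lim_1_over_n])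
  define q where "q n x = (h (t n *\<^sub>R v + x) - h x) / t n" for n x
  have [measurable]: "h \<in> borel_measurable borel" "h' \<in> borel_measurable borel"
    using assms by (auto intro: borel_measurable_continuous_onI)
  have int: "integrable lborel h"
    by (rule continuous_compact_support_integrable[OF assms(1,4)]) (rule h0)
  have "integrable lborel (\<lambda>x. h (c + x))" for c
  proof -
    have "integrable (distr lborel borel ((+) c)) h" using int by (simp add: lborel_distr_plus)
    then show ?thesis by (subst (asm) integrable_distr_eq) auto
  qed
  then have q0: "(LINT x|lborel. q n x) = 0" for n
    using int unfolding q_def by (simp add: lborel_integral_translate)
  have "(\<lambda>n. LINT x|lborel. q n x) \<longlonglongrightarrow> (LINT x|lborel. h' x)"
  proof (rule integral_dominated_convergence)
    show "integrable lborel (\<lambda>x. M * indicator (cball 0 (R + norm v)) x :: real)"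
      by (intro integrable_mult_right integrable_real_indicator) (simp_all add: emeasure_bounded_finite[unfolded infinity_ennreal_def])
    show "AE x in lborel. (\<lambda>n. q n x) \<longlonglongrightarrow> h' x"
    proof (rule AE_I2)
      fix x
      have "((\<lambda>r. (h (x + r *\<^sub>R v) - h x) / r) \<longlongrightarrow> h' x) (at 0)"
        using D[of x] by (simp add: DERIV_def)
      moreover have "filterlim t (at 0) sequentially"
        using t0 t(1) by (auto simp: filterlim_at less_imp_neq[symmetric] intro!: always_eventually)
      ultimately show "(\<lambda>n. q n x) \<longlonglongrightarrow> h' x"
        unfolding q_def by (auto dest: filterlim_compose simp: add.commute)
    qed
    show "AE x in lborel. norm (q n x) \<le> M * indicator (cball 0 (R + norm v)) x" for n
    proof (rule AE_I2)
      fix x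
      obtain z where z: "0 < z" "z < t n" "h (x + t n *\<^sub>R v) - h (x + 0 *\<^sub>R v) = (t n - 0) * h' (x + z *\<^sub>R v)"
        using MVT2[OF t(1)[of n], of "\<lambda>r. h (x + r *\<^sub>R v)" "\<lambda>r. h' (x + r *\<^sub>R v)"] D' by blast
      then have q: "q n x = h' (x + z *\<^sub>R v)"
        using t(1)[of n] by (simp add: q_def add.commute)
      show "norm (q n x) \<le> M * indicator (cball 0 (R + norm v)) x"
      proof (cases "x \<in> cball 0 (R + norm v)")
        case True
        then show ?thesis using M by (simp add: q)
      next
        case False
        have "x + z *\<^sub>R v \<notin> K"
        proof
          assume "x + z *\<^sub>R v \<in> K"
          then have "norm (x + z *\<^sub>R v) \<le> R" by (rule R)
          moreover have "norm (z *\<^sub>R v) \<le> norm v"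
            using z t(2)[of n] by (simp add: mult_left_le_one_le)
          moreover have "norm x \<le> norm (x + z *\<^sub>R v) + norm (z *\<^sub>R v)"
            using norm_triangle_ineq4[of "x + z *\<^sub>R v" "z *\<^sub>R v"] by simp
          ultimately show False using False by simp
        qed
        then show ?thesis using False by (simp add: q h'0)
      qed
    qed
  qed (auto simp: q_def)
  then show ?thesis using q0 LIMSEQ_unique[OF _ tendsto_const] by (simp add: LIMSEQ_const_iff)
qed

text \<open>By Fubini it suffices to look at slices with \<open>q\<close> fixed, and there the shear
  is the translation by \<open>g q\<close>.\<close>

lemma distr_lborel_shear:
  fixes g :: "'q::euclidean_space \<Rightarrow> real"
  assumes [measurable]: "g \<in> borel_measurable borel"
  shows "distr lborel lborel (\<lambda>(s, q). (g q + s, q)) = (lborel :: (real \<times> 'q) measure)"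
proof (rule measure_eqI)
  fix A :: "(real \<times> 'q) set"
  assume "A \<in> sets (distr lborel lborel (\<lambda>(s, q). (g q + s, q)))"
  then have [measurable]: "A \<in> sets borel" by simp
  then have A: "A \<in> sets (lborel \<Otimes>\<^sub>M lborel)" unfolding lborel_prod by simp
  let ?T = "\<lambda>(s, q). (g q + s, q)"
  have T[measurable]: "?T \<in> borel \<rightarrow>\<^sub>M borel" 
    by (subst (1 2) borel_prod[symmetric]) measurable
  have B: "?T -` A \<in> sets borel" using measurable_sets[OF T, of A] by simp
  have "emeasure (distr lborel lborel ?T) A = emeasure lborel (?T -` A)"
    by (subst emeasure_distr) auto
  also have "\<dots> = emeasure (lborel \<Otimes>\<^sub>M lborel) (?T -` A)" by (simp add: lborel_prod)
  also have "\<dots> = (\<integral>\<^sup>+q. emeasure lborel ((\<lambda>s. (s, q)) -` (?T -` A)) \<partial>lborel)"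
    by (rule lborel_pair.emeasure_pair_measure_alt2) (use B in \<open>simp only: lborel_prod sets_lborel\<close>)
  also have "\<dots> = (\<integral>\<^sup>+q. emeasure lborel ((\<lambda>s. (s, q)) -` A) \<partial>lborel)"
  proof (rule nn_integral_cong)
    fix q
    have m: "(\<lambda>s. (s, q)) -` A \<in> sets borel"
    proof -
      have "(\<lambda>s. (s, q)) \<in> borel \<rightarrow>\<^sub>M borel"
        by (intro borel_measurable_continuous_onI continuous_intros)
      from measurable_sets[OF this, of A] show ?thesis by simp
    qed
    have "emeasure lborel ((\<lambda>s. (s, q)) -` A) = emeasure (distr lborel borel ((+) (g q))) ((\<lambda>s. (s, q)) -` A)"
      by (simp add: lborel_distr_plus)
    also have "\<dots> = emeasure lborel ((\<lambda>s. (s, q)) -` (?T -` A))"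
      by (subst emeasure_distr) (use m in \<open>auto simp: vimage_def\<close>)
    finally show "emeasure lborel ((\<lambda>s. (s, q)) -` (?T -` A)) = emeasure lborel ((\<lambda>s. (s, q)) -` A)" ..
  qed
  also have "\<dots> = emeasure (lborel \<Otimes>\<^sub>M lborel) A"
    by (rule lborel_pair.emeasure_pair_measure_alt2[symmetric]) (rule A)
  finally show "emeasure (distr lborel lborel ?T) A = emeasure lborel A" by (simp add: lborel_prod)
qed simp

lemma integral_shear:
  fixes g :: "'q::euclidean_space \<Rightarrow> real" and F :: "real \<times> 'q \<Rightarrow> real"
  assumes [measurable]: "g \<in> borel_measurable borel" "F \<in> borel_measurable borel"
  shows "(LINT p|lborel. F p) = (LINT p|lborel. F (g (snd p) + fst p, snd p))"
proof -
  have T: "(\<lambda>(s, q). (g q + s, q)) \<in> (lborel :: (real \<times> 'q) measure) \<rightarrow>\<^sub>M lborel"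
    unfolding measurable_lborel1 measurable_lborel2 by (subst (1 2) borel_prod[symmetric]) measurable
  have "(LINT p|lborel. F p) = (LINT p|distr lborel lborel (\<lambda>(s, q). (g q + s, q)). F p)"
    by (simp add: distr_lborel_shear)
  also have "\<dots> = (LINT p|lborel. F ((\<lambda>(s, q). (g q + s, q)) p))"
    by (rule integral_distr[OF T]) simp
  finally show ?thesis by (simp add: case_prod_unfold)
qed

text \<open>The shear \<open>T\<close> flattens the graph onto the hyperplane where the first
  coordinate is 0. The direction (a, v) is then split into a part tangent to the graph, whose
  integral over each parallel slice vanishes, and a multiple of (1, 0), which the fundamental
  theorem of calculus integrates to the boundary value. Only first derivatives of \<open>g\<close>
  enter, so the result also serves the competitor, whose bumps are merely of class C^1.\<close>

lemma graph_divergence_theorem: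
  fixes u :: "real \<times> 'q::euclidean_space \<Rightarrow> real" and g :: "'q \<Rightarrow> real"
  assumes u: "Ck_on 1 UNIV u" and g: "Ck_on 1 UNIV g" and K: "compact K" "\<And>p. p \<notin> K \<Longrightarrow> u p = 0"
  shows "(LINT p|lborel. indicator {p. fst p \<le> g (snd p)} p * frechet_derivative u (at p) (a, v)) =
    (LINT q|lborel. (a - frechet_derivative g (at q) v) * u (g q, q))"
proof -
  define u' where "u' p = frechet_derivative u (at p)" for p
  define g' where "g' q = frechet_derivative g (at q) v" for q
  define T where "T = (\<lambda>p::real \<times> 'q. (g (snd p) + fst p, snd p))"
  have du: "(u has_derivative u' p) (at p)" for p
    using Ck_on_SucD_deriv[of 0 UNIV u] u unfolding u'_def by simp
  then have lin: "linear (u' p)" for p by (rule has_derivative_linear)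
  have gc: "continuous_on UNIV g" "continuous_on UNIV g'" 
    using Ck_on_mono[OF g, of 0] g unfolding g'_def by simp_all
  have uc: "continuous_on UNIV u" "continuous_on UNIV (\<lambda>p. u' p w)" for w
    using Ck_on_mono[OF u, of 0] Ck_on_frechet_derivative_continuous[OF u] unfolding u'_def by simp_all
  have Tc: "continuous_on UNIV T"
    unfolding T_def by (intro continuous_intros continuous_on_compose2[OF gc(1)]) auto
  have [measurable]: "g \<in> borel_measurable borel"
    using gc(1) by (rule borel_measurable_continuous_onI)
  have dg: "((\<lambda>r. g (q + r *\<^sub>R v)) has_real_derivative g' q) (at 0)" for q
    using Ck_on_1_line_derivative[OF open_UNIV g, of q 0 v]
    unfolding g'_def has_real_derivative_iff_has_vector_derivative by simp
  define H where "H = (\<lambda>p. (fst p - g (snd p), snd p)) ` K"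
  have H: "compact H"
    unfolding H_def by (intro compact_continuous_image continuous_intros continuous_on_compose2[OF gc(1)] K) auto
  have TH: "T p \<notin> K" if "p \<notin> H" for p
  proof
    assume "T p \<in> K"
    moreover have "p = (fst (T p) - g (snd (T p)), snd (T p))" by (simp add: T_def)
    ultimately show False using that unfolding H_def by blast
  qed
  have u'0: "u' p w = 0" if "p \<notin> K" for p w
    using frechet_derivative_zero_off_compact[OF K(1), of u p] K(2) that by (simp add: u'_def)
  define w1 where "w1 p = u' (T p) (1, 0)" for p
  define w2 where "w2 p = u' (T p) (g' (snd p), v)" for p
  have w12: "continuous_on UNIV w1" "continuous_on UNIV w2"
  proof -
    show "continuous_on UNIV w1"
      unfolding w1_def by (rule continuous_on_compose2[OF uc(2) Tc]) auto
    have eq: "u' p (a, v) = a * u' p (1, 0) + u' p (0, v)" for p a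
      using linear_add[OF lin, of p "(a, 0)" "(0, v)"] linear_scale[OF lin, of p a "(1, 0)"] by simp
    show "continuous_on UNIV w2"
      unfolding w2_def eq[of _ "g' (snd _)"]
      by (intro continuous_intros continuous_on_compose2[OF gc(2)] continuous_on_compose2[OF uc(2) Tc]) auto
  qed
  have w0: "w1 p = 0" "w2 p = 0" if "p \<notin> H" for p
    using TH[OF that] u'0 by (simp_all add: w1_def w2_def)
  \<comment> \<open>\<open>w2\<close> is the derivative of the sheared function along a slice,
    \<open>w1\<close> the one across the slices.\<close>
  have split: "u' (T p) (a, v) = (a - g' (snd p)) * w1 p + w2 p" for p
    using linear_add[OF lin, of "T p" "(a - g' (snd p), 0)" "(g' (snd p), v)"]
      linear_scale[OF lin, of "T p" "a - g' (snd p)" "(1, 0)"]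
    by (simp add: w1_def w2_def)
  let ?I = "\<lambda>p::real \<times> 'q. indicator {..0} (fst p) :: real"
  have [measurable]: "{p::real \<times> 'q. fst p \<le> g (snd p)} \<in> sets borel"
    by (intro borel_closed closed_Collect_le continuous_intros continuous_on_compose2[OF gc(1)]) auto
  have [measurable]: "(\<lambda>p. u' p w) \<in> borel_measurable borel" for w
    by (intro borel_measurable_continuous_onI uc)
  have I: "integrable lborel (\<lambda>p. ?I p * F p)" if "continuous_on UNIV F" "\<And>p. p \<notin> H \<Longrightarrow> F p = 0" for F
  proof (rule Bochner_Integration.integrable_bound[OF continuous_compact_support_integrable[OF that(1) H that(2)]])
    show "(\<lambda>p. ?I p * F p) \<in> borel_measurable lborel"
      using borel_measurable_continuous_onI[OF that(1)]
        measurable_compose[OF borel_measurable_continuous_onI[OF continuous_on_fst[OF continuous_on_id]], of "indicator {..0::real}" borel]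
      by (intro borel_measurable_times) auto
  qed (auto simp: indicator_def)
  have int2: "integrable lborel (\<lambda>p. ?I p * w2 p)" by (intro I w12 w0)
  have int1: "integrable lborel (\<lambda>p. ?I p * ((a - g' (snd p)) * w1 p))"
    by (intro I continuous_intros continuous_on_compose2[OF gc(2)] w12) (auto simp: w0)
  have m: "(\<lambda>p. indicator {p. fst p \<le> g (snd p)} p * u' p (a, v)) \<in> borel_measurable borel"
    by measurable
  have "(LINT p|lborel. indicator {p. fst p \<le> g (snd p)} p * u' p (a, v)) =
    (LINT p|lborel. ?I p * u' (T p) (a, v))"
    by (subst integral_shear[OF _ m, of g]) (auto simp: T_def indicator_def intro!: Bochner_Integration.integral_cong)
  also have "\<dots> = (LINT p|lborel. ?I p * ((a - g' (snd p)) * w1 p) + ?I p * w2 p)"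
    unfolding split by (simp add: distrib_left)
  also have "\<dots> = (LINT p|lborel. ?I p * ((a - g' (snd p)) * w1 p)) + (LINT p|lborel. ?I p * w2 p)"
    by (rule Bochner_Integration.integral_add[OF int1 int2])
  also have "(LINT p|lborel. ?I p * w2 p) = (LINT s|lborel. LINT q|lborel. ?I (s, q) * w2 (s, q))"
    by (rule lborel_pair.integral_fst'[of "\<lambda>p. ?I p * w2 p", unfolded lborel_prod, OF int2, symmetric])
  also have "\<dots> = 0"
  proof -
    have "(LINT q|lborel. w2 (s, q)) = 0" for s
    proof (rule integral_directional_derivative_eq_0[where v=v and h="\<lambda>q. u (g q + s, q)"])
      show "continuous_on UNIV (\<lambda>q. u (g q + s, q))"
        by (intro continuous_on_compose2[OF uc(1)] continuous_intros gc) auto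
      show "continuous_on UNIV (\<lambda>q. w2 (s, q))"
        by (intro continuous_on_compose2[OF w12(2)] continuous_intros) auto
      show "compact (snd ` K)"
        by (intro compact_continuous_image continuous_intros K)
      show "u (g q + s, q) = 0" if "q \<notin> snd ` K" for q
        using that by (intro K) force
      show "((\<lambda>r. u (g (q + r *\<^sub>R v) + s, q + r *\<^sub>R v)) has_real_derivative w2 (s, q)) (at 0)" for q
      proof -
        have "((\<lambda>r. (g (q + r *\<^sub>R v) + s, q + r *\<^sub>R v)) has_derivative (\<lambda>t. (g' q * t, t *\<^sub>R v))) (at 0)"
          using dg[of q, unfolded has_field_derivative_def]
          by (auto intro!: derivative_eq_intros)
        then have "((\<lambda>r. u (g (q + r *\<^sub>R v) + s, q + r *\<^sub>R v)) has_derivative (\<lambda>t. u' (T (s, q)) (g' q * t, t *\<^sub>R v))) (at 0)"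
          by (rule has_derivative_compose[where g=u]) (use du[of "(g q + s, q)"] in \<open>simp add: T_def\<close>)
        moreover have "u' (T (s, q)) (g' q * t, t *\<^sub>R v) = w2 (s, q) * t" for t
          using linear_scale[OF lin, of "T (s, q)" t "(g' q, v)"] by (simp add: w2_def mult.commute)
        ultimately show ?thesis by (simp add: has_field_derivative_def)
      qed
    qed
    then show ?thesis by simp
  qed
  also have "(LINT p|lborel. ?I p * ((a - g' (snd p)) * w1 p)) =
      (LINT q|lborel. LINT s|lborel. ?I (s, q) * ((a - g' q) * w1 (s, q)))"
    using lborel_pair.integral_snd[of "\<lambda>s q. ?I (s, q) * ((a - g' q) * w1 (s, q))"] int1
    unfolding lborel_prod case_prod_unfold fst_conv snd_conv prod.collapse by simp
  also have "\<dots> = (LINT q|lborel. (a - g' q) * u (g q, q))"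
  proof (rule Bochner_Integration.integral_cong[OF refl])
    fix q
    obtain R where R: "\<And>s. (s, q) \<in> H \<Longrightarrow> \<bar>s\<bar> \<le> R"
      using compact_imp_bounded[OF H] unfolding bounded_iff
      by (metis norm_fst_le order_trans real_norm_def)
    define R' where "R' = max R 0 + 1"
    have "(LINT s|lborel. indicator {- R'..0} s *\<^sub>R w1 (s, q)) = u (g q + 0, q) - u (g q + - R', q)"
    proof (rule integral_FTC_atLeastAtMost)
      show "continuous_on {- R'..0} (\<lambda>s. w1 (s, q))"
        by (intro continuous_on_compose2[OF w12(1)] continuous_intros) auto
      show "((\<lambda>s. u (g q + s, q)) has_vector_derivative w1 (s, q)) (at s within {- R'..0})" for s
        using Ck_on_1_line_derivative[OF open_UNIV u, of "(g q, q)" s "(1, 0)"]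
        by (auto simp: w1_def T_def u'_def intro: has_vector_derivative_at_within)
    qed (simp add: R'_def)
    also have "u (g q + - R', q) = 0"
    proof -
      have "(- R', q) \<notin> H" using R[of "- R'"] by (auto simp: R'_def)
      from TH[OF this] show ?thesis by (intro K(2)) (simp add: T_def)
    qed
    also have "(\<lambda>s. indicator {- R'..0} s *\<^sub>R w1 (s, q)) = (\<lambda>s. ?I (s, q) * w1 (s, q))"
    proof
      fix s
      show "indicator {- R'..0} s *\<^sub>R w1 (s, q) = ?I (s, q) * w1 (s, q)"
      proof (cases "- R' \<le> s")
        case False
        then have "(s, q) \<notin> H" using R[of s] by (auto simp: R'_def)
        then show ?thesis by (simp add: w0)
      qed (simp add: indicator_def)
    qed
    finally show "(LINT s|lborel. ?I (s, q) * ((a - g' q) * w1 (s, q))) = (a - g' q) * u (g q, q)"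
      by (simp add: mult.left_commute)
  qed
  finally show ?thesis by (simp add: u'_def g'_def)
qed

lemma Ck_on_1_has_derivative:
  "Ck_on 1 UNIV f \<Longrightarrow> (f has_derivative frechet_derivative f (at x)) (at x)"
  using Ck_on_SucD_deriv[of 0 UNIV f] by simp

lemma Ck_on_2_frechet_derivative:
  "Ck_on 2 S f \<Longrightarrow> Ck_on 1 S (\<lambda>x. frechet_derivative f (at x) v)"
  unfolding numeral_2_eq_2 One_nat_def Ck_on.simps(2)[of "Suc 0"] by blast

lemma second_derivative_symmetric_vector:
  fixes u :: "'a::euclidean_space \<Rightarrow> 'b::euclidean_space"
  assumes "Ck_on 2 UNIV u"
  shows "frechet_derivative (\<lambda>y. frechet_derivative u (at y) v) (at x) w =
         frechet_derivative (\<lambda>y. frechet_derivative u (at y) w) (at x) v"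
proof (rule euclidean_eqI)
  fix b :: 'b
  assume "b \<in> Basis"
  have u1: "Ck_on 1 UNIV u" using assms by (rule Ck_on_mono) simp
  have "frechet_derivative (\<lambda>z. u z \<bullet> b) (at y) v = frechet_derivative u (at y) v \<bullet> b" for y v
    by (subst frechet_derivative_eqI[OF bounded_linear.has_derivative[OF bounded_linear_inner_left Ck_on_1_has_derivative[OF u1]]]) simp
  moreover have "frechet_derivative (\<lambda>y. frechet_derivative u (at y) v \<bullet> b) (at x) w =
      frechet_derivative (\<lambda>y. frechet_derivative u (at y) v) (at x) w \<bullet> b" for v w
    by (subst frechet_derivative_eqI[OF bounded_linear.has_derivative[OF bounded_linear_inner_left
      Ck_on_1_has_derivative[OF Ck_on_2_frechet_derivative[OF assms]]]]) simp
  moreover have "Ck_on 2 UNIV (\<lambda>z. u z \<bullet> b)" by (intro Ck_intros assms) auto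
  note second_derivative_symmetric[OF this, of v x w]
  ultimately show "frechet_derivative (\<lambda>y. frechet_derivative u (at y) v) (at x) w \<bullet> b =
      frechet_derivative (\<lambda>y. frechet_derivative u (at y) w) (at x) v \<bullet> b" by simp
qed

section \<open>Flux through the image of a graph\<close>

definition det3 :: "heis \<Rightarrow> heis \<Rightarrow> heis \<Rightarrow> real" where
  "det3 a b c =
     fst a * (fst (snd b) * snd (snd c) - snd (snd b) * fst (snd c))
   - fst b * (fst (snd a) * snd (snd c) - snd (snd a) * fst (snd c))
   + fst c * (fst (snd a) * snd (snd b) - snd (snd a) * fst (snd b))"

definition jac :: "(heis \<Rightarrow> heis) \<Rightarrow> heis \<Rightarrow> real" where
  "jac \<Phi> p = det3 (frechet_derivative \<Phi> (at p) (1, 0, 0)) (frechet_derivative \<Phi> (at p) (0, 1, 0))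
     (frechet_derivative \<Phi> (at p) (0, 0, 1))"

lemma Ck_on_det3:
  "open S \<Longrightarrow> Ck_on k S a \<Longrightarrow> Ck_on k S b \<Longrightarrow> Ck_on k S c \<Longrightarrow> Ck_on k S (\<lambda>p. det3 (a p) (b p) (c p))"
  unfolding det3_def by (intro Ck_intros)

lemma has_derivative_det3:
  assumes "(a has_derivative a') (at x)" "(b has_derivative b') (at x)" "(c has_derivative c') (at x)"
  shows "((\<lambda>p. det3 (a p) (b p) (c p)) has_derivative
    (\<lambda>v. det3 (a' v) (b x) (c x) + det3 (a x) (b' v) (c x) + det3 (a x) (b x) (c' v))) (at x)"
  unfolding det3_def
  by (rule derivative_eq_intros assms refl)+ (simp add: fun_eq_iff algebra_simps)

lemma linear_expand_heis:
  assumes "linear L"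
  shows "L (a, b, c) = a *\<^sub>R L (1, 0, 0) + b *\<^sub>R L (0, 1, 0) + c *\<^sub>R L (0, 0, 1 :: real)"
proof -
  have "L (a, b, c) = L (a *\<^sub>R (1, 0, 0) + b *\<^sub>R (0, 1, 0) + c *\<^sub>R (0, 0, 1 :: real))" by simp
  then show ?thesis by (simp only: linear_add[OF assms] linear_scale[OF assms])
qed

lemma Basis_heis: "(Basis :: heis set) = {(1, 0, 0), (0, 1, 0), (0, 0, 1)}"
  by (auto simp: Basis_prod_def zero_prod_def)

lemma divergence_heis:
  "divergence V p = fst (frechet_derivative V (at p) (1, 0, 0)) +
     fst (snd (frechet_derivative V (at p) (0, 1, 0))) + snd (snd (frechet_derivative V (at p) (0, 0, 1)))"
proof -
  show ?thesis
    unfolding divergence_def Basis_heis by (simp add: inner_prod_def)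
qed

text \<open>The infinitesimal form of multiplicativity of the determinant: a linear flow with
  generator \<open>A\<close> expands volume at the rate trace \<open>A\<close>.\<close>

lemma det3_trace:
  fixes A :: "heis \<Rightarrow> heis"
  assumes "linear A"
  shows "det3 (A a) b c + det3 a (A b) c + det3 a b (A c) =
    (fst (A (1, 0, 0)) + fst (snd (A (0, 1, 0))) + snd (snd (A (0, 0, 1)))) * det3 a b c"
proof -
  obtain a1 a2 a3 b1 b2 b3 c1 c2 c3 where [simp]: "a = (a1, a2, a3)" "b = (b1, b2, b3)" "c = (c1, c2, c3)"
    by (metis prod.exhaust)
  show ?thesis
    unfolding det3_def \<open>a = _\<close> \<open>b = _\<close> \<open>c = _\<close> linear_expand_heis[OF assms, of a1] linear_expand_heis[OF assms, of b1]
      linear_expand_heis[OF assms, of c1]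
    by (simp add: algebra_simps)
qed

text \<open>The pulled-back field has the cofactors of the derivative of \<Phi> as coefficients.
  When it is differentiated, the second derivatives of \<Phi> cancel in pairs, since they are
  symmetric and the determinant is alternating. The terms in which \<open>V\<close> is
  differentiated add up to \<open>det3_trace\<close>.\<close>

lemma piola_identity:
  fixes \<Phi> V :: "heis \<Rightarrow> heis"
  assumes \<Phi>: "Ck_on 2 UNIV \<Phi>" and V: "Ck_on 1 UNIV V"
  defines "P \<equiv> \<lambda>v p. frechet_derivative \<Phi> (at p) v"
  shows "frechet_derivative (\<lambda>p. det3 (V (\<Phi> p)) (P (0, 1, 0) p) (P (0, 0, 1) p)) (at p) (1, 0, 0)
    + frechet_derivative (\<lambda>p. det3 (P (1, 0, 0) p) (V (\<Phi> p)) (P (0, 0, 1) p)) (at p) (0, 1, 0)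
    + frechet_derivative (\<lambda>p. det3 (P (1, 0, 0) p) (P (0, 1, 0) p) (V (\<Phi> p))) (at p) (0, 0, 1)
    = jac \<Phi> p * divergence V (\<Phi> p)"
proof -
  define A where "A = frechet_derivative V (at (\<Phi> p))"
  define Q where "Q v w = frechet_derivative (P v) (at p) w" for v w
  have \<Phi>1: "Ck_on 1 UNIV \<Phi>" using \<Phi> by (rule Ck_on_mono) simp
  have dP: "(P v has_derivative Q v) (at p)" for v
    unfolding Q_def P_def by (rule Ck_on_1_has_derivative[OF Ck_on_2_frechet_derivative[OF \<Phi>]])
  have dV: "((\<lambda>p. V (\<Phi> p)) has_derivative (\<lambda>w. A (P w p))) (at p)"
    unfolding A_def P_def
    by (rule has_derivative_compose[OF Ck_on_1_has_derivative[OF \<Phi>1] Ck_on_1_has_derivative[OF V]])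
  have sym: "Q v w = Q w v" for v w
    unfolding Q_def P_def by (rule second_derivative_symmetric_vector[OF \<Phi>])
  have linA: "linear A"
    using Ck_on_1_has_derivative[OF V] has_derivative_linear unfolding A_def by blast
  note [simp] = frechet_derivative_eqI[OF has_derivative_det3[OF dV dP dP]]
    frechet_derivative_eqI[OF has_derivative_det3[OF dP dV dP]]
    frechet_derivative_eqI[OF has_derivative_det3[OF dP dP dV]]
  have "det3 (V (\<Phi> p)) (Q (0, 1, 0) (1, 0, 0)) (P (0, 0, 1) p) = - det3 (Q (1, 0, 0) (0, 1, 0)) (V (\<Phi> p)) (P (0, 0, 1) p)"
    "det3 (V (\<Phi> p)) (P (0, 1, 0) p) (Q (0, 0, 1) (1, 0, 0)) = - det3 (Q (1, 0, 0) (0, 0, 1)) (P (0, 1, 0) p) (V (\<Phi> p))"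
    "det3 (P (1, 0, 0) p) (V (\<Phi> p)) (Q (0, 0, 1) (0, 1, 0)) = - det3 (P (1, 0, 0) p) (Q (0, 1, 0) (0, 0, 1)) (V (\<Phi> p))"
    unfolding sym[of "(0, 1, 0)" "(1, 0, 0)"] sym[of "(0, 0, 1)" "(1, 0, 0)"] sym[of "(0, 0, 1)" "(0, 1, 0)"]
    by (simp_all add: det3_def algebra_simps)
  moreover have "jac \<Phi> p * divergence V (\<Phi> p) = det3 (A (P (1, 0, 0) p)) (P (0, 1, 0) p) (P (0, 0, 1) p) +
    det3 (P (1, 0, 0) p) (A (P (0, 1, 0) p)) (P (0, 0, 1) p) + det3 (P (1, 0, 0) p) (P (0, 1, 0) p) (A (P (0, 0, 1) p))"
    unfolding det3_trace[OF linA] by (simp add: jac_def divergence_heis A_def P_def)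
  ultimately show ?thesis by simp
qed

section \<open>Change of variables, carried over from \<open>real ^ 3\<close>\<close>

definition vec_of_heis :: "heis \<Rightarrow> real ^ 3" where
  "vec_of_heis p = vector [fst p, fst (snd p), snd (snd p)]"

definition heis_of_vec :: "real ^ 3 \<Rightarrow> heis" where
  "heis_of_vec v = (v $ 1, v $ 2, v $ 3)"

lemma heis_of_vec_inverse [simp]: "vec_of_heis (heis_of_vec v) = v" "heis_of_vec (vec_of_heis p) = p"
  by (auto simp: vec_of_heis_def heis_of_vec_def vec_eq_iff forall_3)

lemma bounded_linear_heis_of_vec: "bounded_linear heis_of_vec"
  unfolding heis_of_vec_def by (intro bounded_linear_Pair bounded_linear_vec_nth)

lemma bounded_linear_vec_of_heis: "bounded_linear vec_of_heis"
  by (rule linear_conv_bounded_linear[THEN iffD1], rule linearI)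
    (auto simp: vec_of_heis_def vec_eq_iff forall_3)

lemma heis_of_vec_measurable [measurable]: "heis_of_vec \<in> borel \<rightarrow>\<^sub>M borel"
  by (intro borel_measurable_continuous_onI linear_continuous_on bounded_linear_heis_of_vec)

lemma distr_lborel_heis_of_vec: "distr lborel lborel heis_of_vec = lborel"
proof (rule lborel_eqI[symmetric])
  fix l u :: heis
  assume lu: "\<And>b. b \<in> Basis \<Longrightarrow> l \<bullet> b \<le> u \<bullet> b"
  note B = Basis_heis
  have lu': "fst l \<le> fst u" "fst (snd l) \<le> fst (snd u)" "snd (snd l) \<le> snd (snd u)"
    using lu[of "(1, 0, 0)"] lu[of "(0, 1, 0)"] lu[of "(0, 0, 1)"] by (simp_all add: B inner_prod_def)
  have "heis_of_vec -` box l u = box (vec_of_heis l) (vec_of_heis u)"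
    unfolding set_eq_iff vimage_eq mem_box_cart forall_3
    by (auto simp: mem_box B heis_of_vec_def vec_of_heis_def inner_prod_def)
  then have "emeasure (distr lborel lborel heis_of_vec) (box l u) = emeasure lborel (box (vec_of_heis l) (vec_of_heis u))"
    by (subst emeasure_distr) auto
  also have "\<dots> = (\<Prod>b\<in>Basis. (vec_of_heis u - vec_of_heis l) \<bullet> b)"
  proof (rule emeasure_lborel_box)
    show "vec_of_heis l \<bullet> b \<le> vec_of_heis u \<bullet> b" if "b \<in> Basis" for b
    proof -
      have "b \<in> (\<Union>i. \<Union>u\<in>Basis. {axis i u})" using that unfolding Basis_vec_def .
      then obtain i where "b = axis i 1" by auto
      then show ?thesis using lu' exhaust_3[of i]
        by (auto simp: inner_axis vec_of_heis_def)
    qed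
  qed
  also have "(\<Prod>b\<in>Basis. (vec_of_heis u - vec_of_heis l) \<bullet> b) = (\<Prod>i\<in>(UNIV :: 3 set). (vec_of_heis u - vec_of_heis l) $ i)"
  proof -
    have B3: "(Basis :: (real^3) set) = (\<lambda>i. axis i 1) ` UNIV" by (auto simp: Basis_vec_def)
    show ?thesis
      unfolding B3 by (subst prod.reindex) (auto simp: inj_on_def axis_eq_axis inner_axis)
  qed
  also have "\<dots> = (\<Prod>b\<in>Basis. (u - l) \<bullet> b)"
    unfolding B UNIV_3 by (simp add: vec_of_heis_def inner_prod_def)
  finally show "emeasure (distr lborel lborel heis_of_vec) (box l u) = (\<Prod>b\<in>Basis. (u - l) \<bullet> b)" .
qed simp

lemma integrable_heis_of_vec:
  fixes f :: "heis \<Rightarrow> real"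
  assumes "f \<in> borel_measurable borel"
  shows "integrable lborel (\<lambda>x. f (heis_of_vec x)) \<longleftrightarrow> integrable lborel f"
    "(LINT x|lborel. f (heis_of_vec x)) = (LINT p|lborel. f p)"
  using assms integrable_distr_eq[of heis_of_vec lborel lborel f] integral_distr[of heis_of_vec lborel lborel f]
  by (simp_all add: distr_lborel_heis_of_vec)

lemma borel_absolutely_integrable_iff:
  fixes h :: "'a::euclidean_space \<Rightarrow> real"
  assumes [measurable]: "S \<in> sets borel" "h \<in> borel_measurable borel"
  shows "h absolutely_integrable_on S \<longleftrightarrow> integrable lborel (\<lambda>x. indicator S x * h x)"
    "h absolutely_integrable_on S \<Longrightarrow> integral S h = (LINT x|lborel. indicator S x * h x)"
proof -
  have m: "(\<lambda>x. indicator S x * h x) \<in> borel_measurable lborel" by simp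
  show "h absolutely_integrable_on S \<longleftrightarrow> integrable lborel (\<lambda>x. indicator S x * h x)"
    using integrable_completion[OF m] by (simp add: set_integrable_def)
  show "integral S h = (LINT x|lborel. indicator S x * h x)" if "h absolutely_integrable_on S"
    using set_lebesgue_integral_eq_integral(2)[OF that] integral_completion[OF m]
    by (simp add: set_lebesgue_integral_def)
qed

lemma integral_change_of_variables_heis:
  fixes \<Phi> :: "heis \<Rightarrow> heis" and f :: "heis \<Rightarrow> real"
  assumes \<Phi>: "Ck_on 1 UNIV \<Phi>" and "inj \<Phi>" and [measurable]: "E \<in> sets borel" "\<Phi> ` E \<in> sets borel" "f \<in> borel_measurable borel"
    and int: "integrable lborel (\<lambda>p. indicator (\<Phi> ` E) p * f p)"
  shows "(LINT p|lborel. indicator (\<Phi> ` E) p * f p) = (LINT p|lborel. indicator E p * (\<bar>jac \<Phi> p\<bar> * f (\<Phi> p)))"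
proof -
  define S where "S = heis_of_vec -` E"
  define G where "G = (\<lambda>x. vec_of_heis (\<Phi> (heis_of_vec x)))"
  define G' where "G' x = (\<lambda>v. vec_of_heis (frechet_derivative \<Phi> (at (heis_of_vec x)) (heis_of_vec v)))" for x
  \<comment> \<open>The function is packed into \<open>real ^ 1\<close>, because
    \<open>has_absolute_integral_change_of_variables\<close> is stated for vector values.\<close>
  define F where "F x = (vec (f (heis_of_vec x)) :: real ^ 1)" for x
  have GS: "G ` S = heis_of_vec -` (\<Phi> ` E)"
  proof (intro set_eqI iffI)
    fix x assume "x \<in> heis_of_vec -` (\<Phi> ` E)"
    then obtain p where p: "p \<in> E" "heis_of_vec x = \<Phi> p" by auto
    then have "vec_of_heis p \<in> S" by (simp add: S_def)
    moreover have "x = G (vec_of_heis p)"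
      by (simp add: G_def p(2)[symmetric])
    ultimately show "x \<in> G ` S" by blast
  qed (auto simp: G_def S_def)
  have [measurable]: "S \<in> sets borel" "G ` S \<in> sets borel"
    unfolding GS unfolding S_def using measurable_sets[OF heis_of_vec_measurable] assms(3,4) by auto
  have [measurable]: "\<Phi> \<in> borel \<rightarrow>\<^sub>M borel"
    using Ck_on_mono[OF \<Phi>, of 0] by (auto intro: borel_measurable_continuous_onI)
  have "Ck_on 0 UNIV (jac \<Phi>)" 
    unfolding jac_def using Ck_on_frechet_derivative_continuous[OF \<Phi>] by (intro Ck_on_det3) auto
  then have [measurable]: "jac \<Phi> \<in> borel_measurable borel"
    by (auto intro: borel_measurable_continuous_onI)
  have dG: "(G has_derivative G' x) (at x within S)" for x
  proof -
    have "((\<lambda>x. \<Phi> (heis_of_vec x)) has_derivative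
      (\<lambda>v. frechet_derivative \<Phi> (at (heis_of_vec x)) (heis_of_vec v))) (at x)"
      by (rule has_derivative_compose[where f=heis_of_vec and g=\<Phi>,
        OF bounded_linear_imp_has_derivative[OF bounded_linear_heis_of_vec] Ck_on_1_has_derivative[OF \<Phi>]])
    from has_derivative_at_withinI[OF bounded_linear.has_derivative[OF bounded_linear_vec_of_heis this]]
    show ?thesis unfolding G_def G'_def .
  qed
  have ax: "heis_of_vec (axis 1 1) = (1, 0, 0)" "heis_of_vec (axis 2 1) = (0, 1, 0)" "heis_of_vec (axis 3 1) = (0, 0, 1)"
    by (simp_all add: heis_of_vec_def axis_def)
  have "matrix (G' x) $ i $ j = vec_of_heis (frechet_derivative \<Phi> (at (heis_of_vec x)) (heis_of_vec (axis j 1))) $ i" for x i j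
    by (simp add: matrix_def G'_def)
  then have det: "det (matrix (G' x)) = jac \<Phi> (heis_of_vec x)" for x
    by (simp add: det_3 ax vec_of_heis_def jac_def det3_def algebra_simps)
  have "inj_on G S"
  proof (rule inj_onI)
    fix x y assume "G x = G y"
    then have "heis_of_vec (G x) = heis_of_vec (G y)" by simp
    then have "heis_of_vec x = heis_of_vec y"
      using injD[OF \<open>inj \<Phi>\<close>] by (simp add: G_def)
    then have "vec_of_heis (heis_of_vec x) = vec_of_heis (heis_of_vec y)" by simp
    then show "x = y" by simp
  qed
  from has_absolute_integral_change_of_variables[OF _ dG this, of F "integral (G ` S) F"]
  have cov: "F absolutely_integrable_on G ` S \<Longrightarrow>
     (\<lambda>x. \<bar>jac \<Phi> (heis_of_vec x)\<bar> *\<^sub>R F (G x)) absolutely_integrable_on S \<and>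
     integral S (\<lambda>x. \<bar>jac \<Phi> (heis_of_vec x)\<bar> *\<^sub>R F (G x)) = integral (G ` S) F"
    by (simp add: det)
  let ?f = "\<lambda>x. f (heis_of_vec x)" and ?j = "\<lambda>x. \<bar>jac \<Phi> (heis_of_vec x)\<bar> * f (\<Phi> (heis_of_vec x))"
  have Fx: "F x $ 1 = f (heis_of_vec x)" for x by (simp add: F_def)
  then have F1: "(\<lambda>x. F x $ 1) = ?f" "(\<lambda>x. (\<bar>jac \<Phi> (heis_of_vec x)\<bar> *\<^sub>R F (G x)) $ 1) = ?j"
    by (auto simp: G_def)
  have i: "integrable lborel (\<lambda>x. indicator (G ` S) x * ?f x)"
    "(LINT x|lborel. indicator (G ` S) x * ?f x) = (LINT p|lborel. indicator (\<Phi> ` E) p * f p)"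
    using int integrable_heis_of_vec[of "\<lambda>p. indicator (\<Phi> ` E) p * f p"] unfolding GS
    by (simp_all add: indicator_vimage)
  then have a: "?f absolutely_integrable_on G ` S"
    by (subst borel_absolutely_integrable_iff) auto
  then have "F absolutely_integrable_on G ` S"
    by (simp add: absolutely_integrable_on_1_iff F1)
  with cov have c: "(\<lambda>x. \<bar>jac \<Phi> (heis_of_vec x)\<bar> *\<^sub>R F (G x)) absolutely_integrable_on S"
     "integral S (\<lambda>x. \<bar>jac \<Phi> (heis_of_vec x)\<bar> *\<^sub>R F (G x)) $ 1 = integral (G ` S) F $ 1" by auto
  have a': "?j absolutely_integrable_on S"
    using c(1) unfolding absolutely_integrable_on_1_iff F1 .
  have "integral S ?j = integral (G ` S) ?f"
    using c(2) \<open>F absolutely_integrable_on G ` S\<close> c(1)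
    by (subst (asm) (1 2) integral_component_eq_cart[symmetric])
      (auto simp: Fx G_def absolutely_integrable_on_def)
  then have "(LINT x|lborel. indicator (G ` S) x * ?f x) = (LINT x|lborel. indicator S x * ?j x)"
    using a a' by (simp add: borel_absolutely_integrable_iff(2))
  also have "\<dots> = (LINT p|lborel. indicator E p * (\<bar>jac \<Phi> p\<bar> * f (\<Phi> p)))"
    using integrable_heis_of_vec(2)[of "\<lambda>p. indicator E p * (\<bar>jac \<Phi> p\<bar> * f (\<Phi> p))"]
    by (simp add: S_def indicator_vimage)
  finally show ?thesis using i by simp
qed

section \<open>The divergence theorem on the diffeomorphic image of a graph\<close>

lemma diffeomorphism_preimage_compact:
  assumes "diffeomorphism \<Phi>" "compact K"
  shows "compact (inv \<Phi> ` K)" "\<And>p. \<Phi> p \<in> K \<longleftrightarrow> p \<in> inv \<Phi> ` K"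
proof -
  have c: "continuous_on K (inv \<Phi>)"
    using assms(1) smooth_on_continuous_on continuous_on_subset unfolding diffeomorphism_def by blast
  then show "compact (inv \<Phi> ` K)" using assms(2) by (rule compact_continuous_image)
  have "bij \<Phi>" using assms(1) by (simp add: diffeomorphism_def)
  then show "\<Phi> p \<in> K \<longleftrightarrow> p \<in> inv \<Phi> ` K" for p
    by (auto simp: image_iff bij_is_inj bij_is_surj surj_f_inv_f intro: bexI[of _ "\<Phi> p"])
qed

lemma closed_diffeomorphism_image:
  assumes "diffeomorphism \<Phi>" "closed E"
  shows "closed (\<Phi> ` E)"
proof -
  have "bij \<Phi>" "continuous_on UNIV (inv \<Phi>)"
    using assms(1) by (auto simp: diffeomorphism_def smooth_on_continuous_on)
  then have "inv \<Phi> -` E = \<Phi> ` E"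
    using bij_vimage_eq_inv_image[OF bij_imp_bij_inv, of \<Phi> E] by (simp add: inv_inv_eq)
  moreover have "closed (inv \<Phi> -` E)"
    by (rule closed_vimage[OF assms(2) \<open>continuous_on UNIV (inv \<Phi>)\<close>])
  ultimately show ?thesis by simp
qed

text \<open>The integral is pulled back to the undeformed set, where positivity of
  \<open>jac\<close> removes the absolute value and \<open>piola_identity\<close> turns the
  integrand into a divergence. \<open>graph_divergence_theorem\<close> is applied to each of the
  three components. By multilinearity the three boundary terms recombine into one determinant with
  the images of the two tangent vectors of the graph.\<close>

lemma diffeo_graph_flux:
  fixes \<Phi> V :: "heis \<Rightarrow> heis" and g :: "real \<times> real \<Rightarrow> real"
  assumes diff: "diffeomorphism \<Phi>" and jac: "\<And>p. jac \<Phi> p > 0"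
    and g: "Ck_on 1 UNIV g" and V: "Ck_on 1 UNIV V" and K: "compact K" "\<And>p. p \<notin> K \<Longrightarrow> V p = 0"
  shows "(LINT p|lborel. indicator (\<Phi> ` {p. fst p \<le> g (snd p)}) p * divergence V p) =
   (LINT q|lborel. det3 (V (\<Phi> (g q, q)))
      (frechet_derivative \<Phi> (at (g q, q)) (frechet_derivative g (at q) (1, 0), 1, 0))
      (frechet_derivative \<Phi> (at (g q, q)) (frechet_derivative g (at q) (0, 1), 0, 1)))"
proof -
  let ?E = "{p. fst p \<le> g (snd p)}"
  have bij: "bij \<Phi>" and \<Phi>s: "smooth_on UNIV \<Phi>" using diff by (auto simp: diffeomorphism_def)
  have gc: "continuous_on UNIV g" using Ck_on_mono[OF g, of 0] by simp
  have E: "closed ?E"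
    by (intro closed_Collect_le continuous_intros continuous_on_compose2[OF gc]) auto
  have dc: "continuous_on UNIV (divergence V)"
    unfolding divergence_heis using Ck_on_frechet_derivative_continuous[OF V] by (intro continuous_intros) auto
  have d0: "divergence V p = 0" if "p \<notin> K" for p
    using frechet_derivative_zero_off_compact[OF K(1), of V p] K(2) that by (simp add: divergence_def)
  define P where "P v p = frechet_derivative \<Phi> (at p) v" for v p
  define W1 where "W1 p = det3 (V (\<Phi> p)) (P (0, 1, 0) p) (P (0, 0, 1) p)" for p
  define W2 where "W2 p = det3 (P (1, 0, 0) p) (V (\<Phi> p)) (P (0, 0, 1) p)" for p
  define W3 where "W3 p = det3 (P (1, 0, 0) p) (P (0, 1, 0) p) (V (\<Phi> p))" for p
  define K' where "K' = inv \<Phi> ` K"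
  have K': "compact K'" "\<Phi> p \<in> K \<longleftrightarrow> p \<in> K'" for p
    using diffeomorphism_preimage_compact[OF diff K(1)] by (auto simp: K'_def)
  have C: "Ck_on 1 UNIV (P v)" "Ck_on 1 UNIV (\<lambda>p. V (\<Phi> p))" for v
  proof -
    show "Ck_on 1 UNIV (P v)"
      unfolding P_def by (rule smooth_on_imp_Ck_on[OF smooth_on_frechet_derivative[OF \<Phi>s]])
    show "Ck_on 1 UNIV (\<lambda>p. V (\<Phi> p))"
      by (rule Ck_on_compose[OF open_UNIV open_UNIV _ V smooth_on_imp_Ck_on[OF \<Phi>s]]) simp
  qed
  have W: "Ck_on 1 UNIV W1" "Ck_on 1 UNIV W2" "Ck_on 1 UNIV W3"
    unfolding W1_def W2_def W3_def by (intro Ck_on_det3 C open_UNIV)+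
  have W0: "W1 p = 0" "W2 p = 0" "W3 p = 0" if "p \<notin> K'" for p
    using K(2)[of "\<Phi> p"] K' that by (auto simp: W1_def W2_def W3_def det3_def)
  have Wd: "continuous_on UNIV (\<lambda>p. frechet_derivative w (at p) v)" "integrable lborel (\<lambda>p. indicator ?E p * frechet_derivative w (at p) v)"
    if "Ck_on 1 UNIV w" "\<And>p. p \<notin> K' \<Longrightarrow> w p = 0" for w :: "heis \<Rightarrow> real" and v
  proof -
    show c: "continuous_on UNIV (\<lambda>p. frechet_derivative w (at p) v)"
      using that(1) by (rule Ck_on_frechet_derivative_continuous)
    have "frechet_derivative w (at p) v = 0" if "p \<notin> K'" for p
      using frechet_derivative_zero_off_compact[OF K'(1), of w p] \<open>\<And>p. p \<notin> K' \<Longrightarrow> w p = 0\<close> that by simp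
    then have "integrable lborel (\<lambda>p. frechet_derivative w (at p) v)"
      by (rule continuous_compact_support_integrable[OF c K'(1)])
    then show "integrable lborel (\<lambda>p. indicator ?E p * frechet_derivative w (at p) v)"
      using E integrable_mult_indicator[of ?E lborel "\<lambda>p. frechet_derivative w (at p) v"]
      unfolding real_scaleR_def by (metis borel_closed sets_lborel)
  qed
  have "(LINT p|lborel. indicator (\<Phi> ` ?E) p * divergence V p) =
    (LINT p|lborel. indicator ?E p * (\<bar>jac \<Phi> p\<bar> * divergence V (\<Phi> p)))"
  proof (rule integral_change_of_variables_heis)
    have "closed (\<Phi> ` ?E)" using closed_diffeomorphism_image[OF diff E] .
    then show m: "\<Phi> ` ?E \<in> sets borel" by simp
    show "integrable lborel (\<lambda>p. indicator (\<Phi> ` ?E) p * divergence V p)"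
      by (rule integrable_mult_indicator[of "\<Phi> ` ?E" lborel, OF _ continuous_compact_support_integrable[OF dc K(1) d0], unfolded real_scaleR_def])
        (use m in simp)
    show "Ck_on 1 UNIV \<Phi>" by (rule smooth_on_imp_Ck_on[OF \<Phi>s])
    show "divergence V \<in> borel_measurable borel" by (rule borel_measurable_continuous_onI[OF dc])
  qed (use E bij bij_is_inj in auto)
  also have "\<dots> = (LINT p|lborel. indicator ?E p * frechet_derivative W1 (at p) (1, 0, 0)
      + indicator ?E p * frechet_derivative W2 (at p) (0, 1, 0) + indicator ?E p * frechet_derivative W3 (at p) (0, 0, 1))"
  proof (rule Bochner_Integration.integral_cong[OF refl])
    fix p
    have "jac \<Phi> p * divergence V (\<Phi> p) =
      frechet_derivative W1 (at p) (1, 0, 0) + frechet_derivative W2 (at p) (0, 1, 0) + frechet_derivative W3 (at p) (0, 0, 1)"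
      unfolding W1_def[abs_def] W2_def[abs_def] W3_def[abs_def] P_def
      by (rule piola_identity[symmetric, OF smooth_on_imp_Ck_on[OF \<Phi>s] V])
    then show "indicator ?E p * (\<bar>jac \<Phi> p\<bar> * divergence V (\<Phi> p)) =
      indicator ?E p * frechet_derivative W1 (at p) (1, 0, 0)
      + indicator ?E p * frechet_derivative W2 (at p) (0, 1, 0) + indicator ?E p * frechet_derivative W3 (at p) (0, 0, 1)"
      using jac[of p] by (simp add: distrib_left[symmetric])
  qed
  also have "\<dots> = (LINT p|lborel. indicator ?E p * frechet_derivative W1 (at p) (1, 0, 0))
      + (LINT p|lborel. indicator ?E p * frechet_derivative W2 (at p) (0, 1, 0))
      + (LINT p|lborel. indicator ?E p * frechet_derivative W3 (at p) (0, 0, 1))"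
    using Wd(2)[OF W(1) W0(1)] Wd(2)[OF W(2) W0(2)] Wd(2)[OF W(3) W0(3)] by simp
  also have "\<dots> = (LINT q|lborel. (1 - frechet_derivative g (at q) (0, 0)) * W1 (g q, q))
      + (LINT q|lborel. (0 - frechet_derivative g (at q) (1, 0)) * W2 (g q, q))
      + (LINT q|lborel. (0 - frechet_derivative g (at q) (0, 1)) * W3 (g q, q))"
    by (intro arg_cong2[where f="(+)"] graph_divergence_theorem[OF W(1) g K'(1) W0(1)]
      graph_divergence_theorem[OF W(2) g K'(1) W0(2)] graph_divergence_theorem[OF W(3) g K'(1) W0(3)])
  also have "\<dots> = (LINT q|lborel. (1 - frechet_derivative g (at q) (0, 0)) * W1 (g q, q)
      + (0 - frechet_derivative g (at q) (1, 0)) * W2 (g q, q) + (0 - frechet_derivative g (at q) (0, 1)) * W3 (g q, q))"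
  proof -
    have "integrable lborel (\<lambda>q. (c - frechet_derivative g (at q) v) * w (g q, q))"
      if "Ck_on 1 UNIV w" "\<And>p. p \<notin> K' \<Longrightarrow> w p = 0" for w c v
    proof (rule continuous_compact_support_integrable)
      have "continuous_on UNIV w" using Ck_on_mono[OF that(1), of 0] by simp
      then have "continuous_on UNIV (\<lambda>q. w (g q, q))"
        by (rule continuous_on_compose2) (auto intro!: continuous_intros gc)
      then show "continuous_on UNIV (\<lambda>q. (c - frechet_derivative g (at q) v) * w (g q, q))"
        by (intro continuous_intros Ck_on_frechet_derivative_continuous[OF g])
      show "compact (snd ` K')" by (intro compact_continuous_image continuous_intros K')
      show "(c - frechet_derivative g (at q) v) * w (g q, q) = 0" if "q \<notin> snd ` K'" for q
        using \<open>\<And>p. p \<notin> K' \<Longrightarrow> w p = 0\<close>[of "(g q, q)"] that by force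
    qed
    note int = this
    have i: "integrable lborel (\<lambda>q. (1 - frechet_derivative g (at q) (0, 0)) * W1 (g q, q))"
      "integrable lborel (\<lambda>q. (0 - frechet_derivative g (at q) (1, 0)) * W2 (g q, q))"
      "integrable lborel (\<lambda>q. (0 - frechet_derivative g (at q) (0, 1)) * W3 (g q, q))"
      by (rule int, rule W, rule W0, assumption)+
    show ?thesis
      unfolding Bochner_Integration.integral_add[OF Bochner_Integration.integrable_add[OF i(1,2)] i(3)]
        Bochner_Integration.integral_add[OF i(1,2)] ..
  qed
  also have "\<dots> = (LINT q|lborel. det3 (V (\<Phi> (g q, q)))
      (frechet_derivative \<Phi> (at (g q, q)) (frechet_derivative g (at q) (1, 0), 1, 0))
      (frechet_derivative \<Phi> (at (g q, q)) (frechet_derivative g (at q) (0, 1), 0, 1)))"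
  proof (rule Bochner_Integration.integral_cong[OF refl])
    fix q
    have g0: "frechet_derivative g (at q) (0, 0) = 0"
      using linear_0[OF has_derivative_linear[OF Ck_on_1_has_derivative[OF g]]] by (simp add: zero_prod_def)
    have L: "frechet_derivative \<Phi> (at (g q, q)) (a, b, c) = a *\<^sub>R P (1, 0, 0) (g q, q) + b *\<^sub>R P (0, 1, 0) (g q, q) + c *\<^sub>R P (0, 0, 1) (g q, q)" for a b c
      unfolding P_def using smooth_on_has_derivative[OF \<Phi>s, of "(g q, q)"]
      by (intro linear_expand_heis has_derivative_linear) auto
    show "(1 - frechet_derivative g (at q) (0, 0)) * W1 (g q, q)
      + (0 - frechet_derivative g (at q) (1, 0)) * W2 (g q, q) + (0 - frechet_derivative g (at q) (0, 1)) * W3 (g q, q) =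
      det3 (V (\<Phi> (g q, q)))
      (frechet_derivative \<Phi> (at (g q, q)) (frechet_derivative g (at q) (1, 0), 1, 0))
      (frechet_derivative \<Phi> (at (g q, q)) (frechet_derivative g (at q) (0, 1), 0, 1))"
      unfolding L W1_def W2_def W3_def g0 by (simp add: det3_def algebra_simps)
  qed
  finally show ?thesis .
qed

section \<open>Contact geometry\<close>

text \<open>The 1-form dz - (x dy - y dx) / 2 at \<open>p\<close>.\<close>

definition contact_form :: "heis \<Rightarrow> heis \<Rightarrow> real" where
  "contact_form p v = snd (snd v) - (fst p * fst (snd v) - fst (snd p) * fst v) / 2"

lemma horizontal_iff: "v \<in> horizontal p \<longleftrightarrow> contact_form p v = 0"
proof -
  obtain x y z where p: "p = (x, y, z)" by (metis prod.exhaust)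
  obtain a b c where v: "v = (a, b, c)" by (metis prod.exhaust)
  have "v \<in> horizontal p \<longleftrightarrow> (\<exists>k l. v = k *\<^sub>R X_field p + l *\<^sub>R Y_field p)"
    unfolding horizontal_def span_breakdown_eq span_singleton
    by (auto simp: image_iff diff_eq_eq add.commute)
  also have "\<dots> \<longleftrightarrow> c = - a * y / 2 + b * x / 2"
    by (auto simp: v p X_field_def Y_field_def)
  finally show ?thesis by (auto simp: contact_form_def v p field_simps)
qed

text \<open>In the frame X, Y, \<partial>_z, which has determinant 1, the third coordinate of a
  vector is its contact form. It vanishes for \<open>v\<close> and \<open>a\<close>, so the matrix
  is block triangular.\<close>

lemma det3_horizontal:
  assumes "contact_form p v = 0" "contact_form p a = 0"
  shows "det3 v a b = (fst v * fst (snd a) - fst (snd v) * fst a) * contact_form p b"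
proof -
  obtain x y z where p: "p = (x, y, z)" by (metis prod.exhaust)
  obtain v1 v2 v3 where v: "v = (v1, v2, v3)" by (metis prod.exhaust)
  obtain a1 a2 a3 where a: "a = (a1, a2, a3)" by (metis prod.exhaust)
  have v3: "v3 = (x * v2 - y * v1) / 2" and a3: "a3 = (x * a2 - y * a1) / 2"
    using assms by (simp_all add: contact_form_def p v a)
  show ?thesis unfolding p v a det3_def contact_form_def fst_conv snd_conv v3 a3 by (simp add: field_simps)
qed

lemma set_lebesgue_integral_divergence:
  fixes V :: "heis \<Rightarrow> heis"
  assumes "smooth_on UNIV V" "closed E"
  shows "(LINT p:E|lebesgue. divergence V p) = (LINT p|lborel. indicator E p * divergence V p)"
proof -
  have "continuous_on UNIV (divergence V)"
    unfolding divergence_heis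
    by (intro continuous_intros smooth_on_continuous_on[OF smooth_on_frechet_derivative[OF assms(1)]])
  then have [measurable]: "divergence V \<in> borel_measurable borel" by (rule borel_measurable_continuous_onI)
  have [measurable]: "E \<in> sets borel" using assms(2) by (rule borel_closed)
  have "(\<lambda>p. indicator E p * divergence V p) \<in> borel_measurable lborel" by simp
  from integral_completion[OF this] show ?thesis by (simp add: set_lebesgue_integral_def)
qed

lemma det3_linear_image:
  assumes "linear A"
  shows "det3 (A a) (A b) (A c) = det3 (A (1, 0, 0)) (A (0, 1, 0)) (A (0, 0, 1)) * det3 a b c"
proof -
  obtain a1 a2 a3 b1 b2 b3 c1 c2 c3 where abc: "a = (a1, a2, a3)" "b = (b1, b2, b3)" "c = (c1, c2, c3)"
    by (metis prod.exhaust)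
  obtain p1 p2 p3 q1 q2 q3 r1 r2 r3 where A: "A (1, 0, 0) = (p1, p2, p3)" "A (0, 1, 0) = (q1, q2, q3)" "A (0, 0, 1) = (r1, r2, r3)"
    by (metis prod.exhaust)
  show ?thesis
    unfolding abc linear_expand_heis[OF assms, of a1] linear_expand_heis[OF assms, of b1]
      linear_expand_heis[OF assms, of c1] A by (simp add: det3_def algebra_simps)
qed

lemma diffeomorphism_inverse_derivative:
  assumes "diffeomorphism \<Phi>"
  shows "frechet_derivative (inv \<Phi>) (at (\<Phi> p)) (frechet_derivative \<Phi> (at p) v) = v"
proof -
  have s: "smooth_on UNIV \<Phi>" "smooth_on UNIV (inv \<Phi>)" and "bij \<Phi>"
    using assms by (auto simp: diffeomorphism_def)
  have "((\<lambda>p. inv \<Phi> (\<Phi> p)) has_derivative (\<lambda>v. frechet_derivative (inv \<Phi>) (at (\<Phi> p)) (frechet_derivative \<Phi> (at p) v))) (at p)"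
    by (rule has_derivative_compose[where f=\<Phi> and g="inv \<Phi>"]) (use s smooth_on_has_derivative in auto)
  moreover have "(\<lambda>p. inv \<Phi> (\<Phi> p)) = (\<lambda>p. p)" using \<open>bij \<Phi>\<close> by (simp add: bij_is_inj)
  ultimately have "(\<lambda>v. frechet_derivative (inv \<Phi>) (at (\<Phi> p)) (frechet_derivative \<Phi> (at p) v)) = (\<lambda>v. v)"
    using has_derivative_unique[OF _ has_derivative_ident] by simp
  then show ?thesis by metis
qed

lemma diffeomorphism_linear:
  "diffeomorphism \<Phi> \<Longrightarrow> linear (frechet_derivative \<Phi> (at p))"
  using smooth_on_has_derivative has_derivative_linear unfolding diffeomorphism_def by blast

lemma jac_nonzero:
  assumes "diffeomorphism \<Phi>"
  shows "jac \<Phi> p \<noteq> 0"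
proof -
  have "linear (frechet_derivative (inv \<Phi>) (at (\<Phi> p)))"
    using assms smooth_on_has_derivative has_derivative_linear unfolding diffeomorphism_def by blast
  note det3_linear_image[OF this, of "frechet_derivative \<Phi> (at p) (1, 0, 0)" "frechet_derivative \<Phi> (at p) (0, 1, 0)"
    "frechet_derivative \<Phi> (at p) (0, 0, 1)", unfolded diffeomorphism_inverse_derivative[OF assms]]
  then show ?thesis by (auto simp: jac_def det3_def)
qed

lemma continuous_nonzero_positive:
  fixes h :: "'a::euclidean_space \<Rightarrow> real"
  assumes "continuous_on UNIV h" "\<And>x. h x \<noteq> 0" "h x0 > 0"
  shows "h x > 0"
proof (rule ccontr)
  assume "\<not> h x > 0"
  then have "h x \<le> 0" by simp
  moreover have "connected (h ` UNIV)" using assms(1) by (rule connected_continuous_image) (rule connected_UNIV)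
  ultimately have "0 \<in> h ` UNIV" using assms(3) by (meson connectedD_interval rangeI less_imp_le)
  then show False using assms(2) by force
qed

lemma contact_image:
  assumes "contact_diffeomorphism \<Phi>" "contact_form p v = 0"
  shows "contact_form (\<Phi> p) (frechet_derivative \<Phi> (at p) v) = 0"
  using assms unfolding contact_diffeomorphism_def horizontal_iff[symmetric] by blast

text \<open>A horizontal vector is determined by its first two entries, so planar length 0 would
  make the image vanish, and with it \<open>v\<close>.\<close>

lemma hnorm_contact_image:
  assumes "contact_diffeomorphism \<Phi>" "contact_form p v = 0" "v \<noteq> 0"
  shows "hnorm (frechet_derivative \<Phi> (at p) v) > 0"
proof -
  have diff: "diffeomorphism \<Phi>" using assms(1) by (simp add: contact_diffeomorphism_def)
  let ?w = "frechet_derivative \<Phi> (at p) v"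
  obtain a b c where w: "?w = (a, b, c)" by (metis prod.exhaust)
  have lin: "linear (frechet_derivative (inv \<Phi>) (at (\<Phi> p)))"
    using diff smooth_on_has_derivative has_derivative_linear unfolding diffeomorphism_def by blast
  have "a \<noteq> 0 \<or> b \<noteq> 0"
  proof (rule ccontr)
    assume "\<not> (a \<noteq> 0 \<or> b \<noteq> 0)"
    then have "?w = 0"
      using contact_image[OF assms(1,2)] w by (simp add: contact_form_def zero_prod_def)
    then have "v = 0"
      using diffeomorphism_inverse_derivative[OF diff, of p v] linear_0[OF lin] by simp
    then show False using assms(3) by simp
  qed
  then show ?thesis using sum_power2_gt_zero_iff[of a b] by (simp add: w hnorm_def)
qed

text \<open>The contact form of \<open>v\<close> is the determinant of X, Y and \<open>v\<close>.
  The derivative of \<Phi> multiplies this determinant by the nonzero Jacobian, and since the images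
  of X and Y are horizontal, the new determinant contains the contact form of the image as a
  factor.\<close>

lemma contact_form_image_nonzero:
  assumes "contact_diffeomorphism \<Phi>" "contact_form p v \<noteq> 0"
  shows "contact_form (\<Phi> p) (frechet_derivative \<Phi> (at p) v) \<noteq> 0"
proof -
  have diff: "diffeomorphism \<Phi>" using assms(1) by (simp add: contact_diffeomorphism_def)
  let ?D = "frechet_derivative \<Phi> (at p)"
  have h: "contact_form p (X_field p) = 0" "contact_form p (Y_field p) = 0"
    by (auto simp: contact_form_def X_field_def Y_field_def split: prod.splits)
  have "det3 (X_field p) (Y_field p) v = contact_form p v"
    by (subst det3_horizontal[OF h]) (simp add: X_field_def Y_field_def split: prod.splits)
  then have "det3 (?D (X_field p)) (?D (Y_field p)) (?D v) = jac \<Phi> p * contact_form p v"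
    by (simp add: det3_linear_image[OF diffeomorphism_linear[OF diff], of p "X_field p"] jac_def)
  also have "\<dots> \<noteq> 0" using jac_nonzero[OF diff] assms(2) by simp
  finally show ?thesis
    unfolding det3_horizontal[OF contact_image[OF assms(1) h(1)] contact_image[OF assms(1) h(2)]] by simp
qed

section \<open>The perimeter of the image of the surface \<open>x = y z\<close>\<close>

definition saddle :: "heis set" where
  "saddle = {p. fst p \<le> fst (snd p) * snd (snd p)}"

definition saddle_point :: "real \<times> real \<Rightarrow> heis" where
  "saddle_point q = (fst q * snd q, q)"

text \<open>The image of the surface under \<open>\<Phi>\<close> is ruled by horizontal curves with velocity \<open>ruling \<Phi>\<close>;
  \<open>crossing \<Phi>\<close> evaluates the contact form on the derivative transversal to the ruling.
  For a horizontal field the flux density is the planar determinant with the ruling times the crossing.\<close>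

definition ruling :: "(heis \<Rightarrow> heis) \<Rightarrow> real \<times> real \<Rightarrow> heis" where
  "ruling \<Phi> q = frechet_derivative \<Phi> (at (saddle_point q)) (snd q, 1, 0)"

definition crossing :: "(heis \<Rightarrow> heis) \<Rightarrow> real \<times> real \<Rightarrow> real" where
  "crossing \<Phi> q = contact_form (\<Phi> (saddle_point q)) (frechet_derivative \<Phi> (at (saddle_point q)) (fst q, 0, 1))"

text \<open>By Cauchy-Schwarz in the plane this is the largest flux density that a horizontal field
  of norm at most 1 can have through the image surface.\<close>

definition area_density :: "(heis \<Rightarrow> heis) \<Rightarrow> real \<times> real \<Rightarrow> real" where
  "area_density \<Phi> q = crossing \<Phi> q * hnorm (ruling \<Phi> q)"

lemma continuous_saddle_point [continuous_intros]:
  "continuous_on S f \<Longrightarrow> continuous_on S (\<lambda>x. saddle_point (f x))"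
  unfolding saddle_point_def by (intro continuous_intros)

lemma continuous_hnorm [continuous_intros]:
  "continuous_on S f \<Longrightarrow> continuous_on S (\<lambda>x. hnorm (f x))"
  unfolding hnorm_def case_prod_unfold by (intro continuous_intros)

lemma frechet_derivative_continuous:
  assumes "smooth_on UNIV (\<Phi> :: heis \<Rightarrow> heis)" "continuous_on S f" "continuous_on S v"
  shows "continuous_on S (\<lambda>x. frechet_derivative \<Phi> (at (f x)) (v x))"
proof -
  have "frechet_derivative \<Phi> (at (f x)) (v x) = fst (v x) *\<^sub>R frechet_derivative \<Phi> (at (f x)) (1, 0, 0) +
     fst (snd (v x)) *\<^sub>R frechet_derivative \<Phi> (at (f x)) (0, 1, 0) + snd (snd (v x)) *\<^sub>R frechet_derivative \<Phi> (at (f x)) (0, 0, 1)" for x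
    using linear_expand_heis[OF has_derivative_linear[OF smooth_on_has_derivative[OF assms(1), of "f x"]],
      of "fst (v x)" "fst (snd (v x))" "snd (snd (v x))"] by simp
  moreover have "continuous_on S (\<lambda>x. frechet_derivative \<Phi> (at (f x)) w)" for w
    by (rule continuous_on_compose2[OF smooth_on_continuous_on[OF smooth_on_frechet_derivative[OF assms(1)]] assms(2)]) simp
  ultimately show ?thesis
    using assms(2,3) by (simp only:) (intro continuous_intros)
qed

lemma continuous_area_density:
  assumes "smooth_on UNIV \<Phi>"
  shows "continuous_on UNIV (crossing \<Phi>)" "continuous_on UNIV (ruling \<Phi>)" "continuous_on UNIV (area_density \<Phi>)"
proof -
  have c: "continuous_on UNIV (\<lambda>q. \<Phi> (saddle_point q))"
    by (rule continuous_on_compose2[OF smooth_on_continuous_on[OF assms]]) (auto intro!: continuous_intros)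
  have r: "continuous_on UNIV (\<lambda>q. frechet_derivative \<Phi> (at (saddle_point q)) (snd q, 1, 0))"
    "continuous_on UNIV (\<lambda>q. frechet_derivative \<Phi> (at (saddle_point q)) (fst q, 0, 1))"
    by (rule frechet_derivative_continuous[OF assms]; intro continuous_intros)+
  show 1: "continuous_on UNIV (crossing \<Phi>)" "continuous_on UNIV (ruling \<Phi>)"
    unfolding crossing_def[abs_def] ruling_def[abs_def] contact_form_def
    by (intro continuous_intros c r; simp) (rule r)
  show "continuous_on UNIV (area_density \<Phi>)"
    unfolding area_density_def[abs_def] by (intro continuous_intros 1)
qed

lemma not_in_closure_Collect: "p \<notin> closure {p. P p} \<Longrightarrow> \<not> P p"
  using closure_subset[of "{p. P p}"] by auto

lemma horizontal_ruling: "contact_form (saddle_point q) (snd q, 1, 0) = 0"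
  by (simp add: contact_form_def saddle_point_def)

lemma contact_form_crossing: "contact_form (saddle_point q) (fst q, 0, 1) = 1 + (fst q)\<^sup>2 / 2"
  by (simp add: contact_form_def saddle_point_def power2_eq_square)

locale compact_contact =
  fixes \<Phi> :: "heis \<Rightarrow> heis"
  assumes contact: "contact_diffeomorphism \<Phi>"
    and compact_support: "compact (closure {p. \<Phi> p \<noteq> p})"
begin

lemma diff: "diffeomorphism \<Phi>"
  using contact by (simp add: contact_diffeomorphism_def)

lemma smooth: "smooth_on UNIV \<Phi>"
  using diff by (simp add: diffeomorphism_def)

lemma inj: "inj \<Phi>"
  using diff by (simp add: diffeomorphism_def bij_is_inj)

lemma derivative_off_support:
  assumes "p \<notin> closure {p. \<Phi> p \<noteq> p}"
  shows "frechet_derivative \<Phi> (at p) = (\<lambda>v. v)" "\<Phi> p = p"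
proof -
  have "((\<lambda>p. p) has_derivative (\<lambda>v. v)) (at p)" by simp
  then have "(\<Phi> has_derivative (\<lambda>v. v)) (at p)"
  proof (rule has_derivative_transform_within_open)
    show "open (- closure {p. \<Phi> p \<noteq> p})" by (simp add: open_Compl)
    show "p' = \<Phi> p'" if "p' \<in> - closure {p. \<Phi> p \<noteq> p}" for p'
      using not_in_closure_Collect[of p' "\<lambda>p. \<Phi> p \<noteq> p"] that by auto
  qed (use assms in simp)
  then show "frechet_derivative \<Phi> (at p) = (\<lambda>v. v)" by (rule frechet_derivative_eqI)
  show "\<Phi> p = p" using not_in_closure_Collect[OF assms] by simp
qed

text \<open>The surface is unbounded, so at some point of it \<Phi> agrees with the identity to
  first order. The signs of \<open>jac\<close> and \<open>crossing\<close> are read off there; being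
  continuous and nowhere 0, these functions keep them everywhere.\<close>

lemma exists_off_support: "\<exists>q. saddle_point q \<notin> closure {p. \<Phi> p \<noteq> p}"
proof -
  obtain R where R: "\<And>p. p \<in> closure {p. \<Phi> p \<noteq> p} \<Longrightarrow> norm p \<le> R"
    using compact_imp_bounded[OF compact_support, unfolded bounded_iff] by blast
  have "norm (saddle_point (\<bar>R\<bar> + 1, 0)) = \<bar>R\<bar> + 1"
    by (simp add: saddle_point_def norm_Pair)
  then have "saddle_point (\<bar>R\<bar> + 1, 0) \<notin> closure {p. \<Phi> p \<noteq> p}"
    using R[of "saddle_point (\<bar>R\<bar> + 1, 0)"] by linarith
  then show ?thesis by blast
qed

lemma jac_pos: "jac \<Phi> p > 0"
proof -
  obtain q where q: "saddle_point q \<notin> closure {p. \<Phi> p \<noteq> p}" using exists_off_support by blast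
  have "jac \<Phi> (saddle_point q) > 0" by (simp add: jac_def derivative_off_support(1)[OF q] det3_def)
  moreover have "continuous_on UNIV (jac \<Phi>)"
  proof -
    have "Ck_on 0 UNIV (jac \<Phi>)"
      unfolding jac_def[abs_def]
      by (intro Ck_on_det3 smooth_on_imp_Ck_on[OF smooth_on_frechet_derivative[OF smooth]] open_UNIV)
    then show ?thesis by simp
  qed
  ultimately show ?thesis using continuous_nonzero_positive[of "jac \<Phi>" "saddle_point q" p] jac_nonzero[OF diff] by blast
qed

lemma crossing_pos: "crossing \<Phi> q > 0"
proof -
  obtain q0 where q0: "saddle_point q0 \<notin> closure {p. \<Phi> p \<noteq> p}" using exists_off_support by blast
  have "crossing \<Phi> q0 = 1 + (fst q0)\<^sup>2 / 2"
    by (simp add: crossing_def derivative_off_support[OF q0] contact_form_crossing)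
  then have "crossing \<Phi> q0 > 0" using zero_le_power2[of "fst q0"] by linarith
  moreover have "crossing \<Phi> q \<noteq> 0" for q
    unfolding crossing_def
    by (rule contact_form_image_nonzero[OF contact]) (use contact_form_crossing[of q] zero_le_power2[of "fst q"] in linarith)
  ultimately show ?thesis
    using continuous_nonzero_positive[OF continuous_area_density(1)[OF smooth], of q0 q] by blast
qed

lemma ruling_pos: "hnorm (ruling \<Phi> q) > 0"
  unfolding ruling_def by (rule hnorm_contact_image[OF contact horizontal_ruling]) (simp add: zero_prod_def)

lemma ruling_horizontal: "contact_form (\<Phi> (saddle_point q)) (ruling \<Phi> q) = 0"
  unfolding ruling_def by (rule contact_image[OF contact horizontal_ruling])

lemma area_density_pos: "area_density \<Phi> q > 0"
  using crossing_pos ruling_pos by (simp add: area_density_def)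

text \<open>Of the two tangent vectors in \<open>diffeo_graph_flux\<close>, the image of (z, 1, 0)
  is the ruling and is horizontal, like \<open>V\<close>. Hence \<open>det3_horizontal\<close>
  reduces the determinant to a planar one times \<open>crossing\<close>.\<close>

lemma flux:
  assumes V: "smooth_on UNIV V" "\<And>p. V p \<in> horizontal p" "compact (closure {p. V p \<noteq> 0})"
  shows "(LINT p:\<Phi> ` saddle|lebesgue. divergence V p) =
    (LINT q|lborel. (fst (V (\<Phi> (saddle_point q))) * fst (snd (ruling \<Phi> q)) -
      fst (snd (V (\<Phi> (saddle_point q)))) * fst (ruling \<Phi> q)) * crossing \<Phi> q)"
proof -
  define g where "g q = fst q * snd q" for q :: "real \<times> real"
  have dg: "(g has_derivative (\<lambda>v. fst q * snd v + fst v * snd q)) (at q)" for q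
    unfolding g_def by (auto intro!: derivative_eq_intros)
  have g1: "Ck_on 1 UNIV g" unfolding g_def[abs_def] by (intro Ck_intros open_UNIV)
  have S: "saddle = {p. fst p \<le> g (snd p)}" by (simp add: saddle_def g_def)
  have V0: "V p = 0" if "p \<notin> closure {p. V p \<noteq> 0}" for p
    using not_in_closure_Collect[OF that] by simp
  have closed: "closed (\<Phi> ` saddle)"
    unfolding saddle_def
    by (intro closed_diffeomorphism_image[OF diff] closed_Collect_le continuous_intros)
  have "(LINT p:\<Phi> ` saddle|lebesgue. divergence V p) = (LINT p|lborel. indicator (\<Phi> ` saddle) p * divergence V p)"
    by (rule set_lebesgue_integral_divergence[OF V(1) closed])
  also have "\<dots> = (LINT q|lborel. det3 (V (\<Phi> (g q, q)))
      (frechet_derivative \<Phi> (at (g q, q)) (frechet_derivative g (at q) (1, 0), 1, 0))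
      (frechet_derivative \<Phi> (at (g q, q)) (frechet_derivative g (at q) (0, 1), 0, 1)))"
    unfolding S
    by (rule diffeo_graph_flux[OF diff jac_pos g1 smooth_on_imp_Ck_on[OF V(1)] V(3)])
      (rule V0)
  also have "\<dots> = (LINT q|lborel. (fst (V (\<Phi> (saddle_point q))) * fst (snd (ruling \<Phi> q)) -
      fst (snd (V (\<Phi> (saddle_point q)))) * fst (ruling \<Phi> q)) * crossing \<Phi> q)"
  proof (rule Bochner_Integration.integral_cong[OF refl])
    fix q
    have gq: "(g q, q) = saddle_point q" by (simp add: g_def saddle_point_def)
    show "det3 (V (\<Phi> (g q, q)))
      (frechet_derivative \<Phi> (at (g q, q)) (frechet_derivative g (at q) (1, 0), 1, 0))
      (frechet_derivative \<Phi> (at (g q, q)) (frechet_derivative g (at q) (0, 1), 0, 1)) =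
      (fst (V (\<Phi> (saddle_point q))) * fst (snd (ruling \<Phi> q)) -
      fst (snd (V (\<Phi> (saddle_point q)))) * fst (ruling \<Phi> q)) * crossing \<Phi> q"
      unfolding gq frechet_derivative_eqI[OF dg] fst_conv snd_conv mult_zero_right mult_zero_left add_0_left add_0_right mult_1 mult_1_right
        ruling_def[symmetric] crossing_def
      by (rule det3_horizontal) (use V(2) horizontal_iff ruling_horizontal in blast)+
  qed
  finally show ?thesis .
qed

text \<open>By injectivity the image of a moved point is itself moved, so both lie in the support
  and hence in \<Omega>.\<close>

lemma mem_open_iff:
  assumes "closure {p. \<Phi> p \<noteq> p} \<subseteq> \<Omega>"
  shows "\<Phi> p \<in> \<Omega> \<longleftrightarrow> p \<in> \<Omega>"
proof (cases "\<Phi> p = p")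
  case False
  then have "\<Phi> (\<Phi> p) \<noteq> \<Phi> p" using inj by (auto dest: injD)
  with False have "p \<in> \<Omega>" "\<Phi> p \<in> \<Omega>"
    using assms not_in_closure_Collect[of _ "\<lambda>p. \<Phi> p \<noteq> p"] by blast+
  then show ?thesis by simp
qed simp

text \<open>The optimal field on the image surface is the unit horizontal field orthogonal to the
  ruling. To have it on the whole space, the ruling direction is extended to a nowhere vanishing
  horizontal field \<open>w\<close>, pushed forward by \<Phi>, turned by a right angle and
  normalised; \<rho> then cuts it off inside \<Omega>.\<close>

lemma test_field_exists:
  assumes \<Omega>: "open \<Omega>" and \<rho>: "smooth_on UNIV \<rho>" "\<And>p. 0 \<le> \<rho> p" "\<And>p. \<rho> p \<le> 1" "closure {p. \<rho> p \<noteq> 0} \<subset>\<subset> \<Omega>"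
  obtains V where "V \<in> test_fields \<Omega>"
    "(LINT p:\<Phi> ` saddle|lebesgue. divergence V p) = (LINT q|lborel. \<rho> (\<Phi> (saddle_point q)) * area_density \<Phi> q)"
proof -
  \<comment> \<open>The third entry is forced by horizontality and vanishes on the surface x = y z,
    where \<open>w\<close> is the velocity of the lines.\<close>
  define w :: "heis \<Rightarrow> heis" where "w p = (snd (snd p), 1, (fst p - fst (snd p) * snd (snd p)) / 2)" for p
  define m where "m p = frechet_derivative \<Phi> (at p) (w p)" for p
  define \<Psi> where "\<Psi> = inv \<Phi>"
  have bij: "bij \<Phi>" and \<Psi>s: "smooth_on UNIV \<Psi>" using diff by (auto simp: diffeomorphism_def \<Psi>_def)
  have \<Psi>\<Phi>: "\<Psi> (\<Phi> p) = p" for p using bij by (simp add: \<Psi>_def bij_is_inj)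
  have "contact_form p (w p) = 0" "w p \<noteq> 0" for p
    by (simp_all add: w_def contact_form_def zero_prod_def field_simps)
  then have mpos: "hnorm (m p) > 0" for p unfolding m_def by (intro hnorm_contact_image[OF contact])
  have ws: "m = (\<lambda>p. snd (snd p) *\<^sub>R frechet_derivative \<Phi> (at p) (1, 0, 0) + 1 *\<^sub>R frechet_derivative \<Phi> (at p) (0, 1, 0) +
     ((fst p - fst (snd p) * snd (snd p)) * (1/2)) *\<^sub>R frechet_derivative \<Phi> (at p) (0, 0, 1))"
    unfolding m_def[abs_def] w_def linear_expand_heis[OF diffeomorphism_linear[OF diff], of _ "snd (snd _)"] by simp
  have ms: "smooth_on UNIV m"
    unfolding ws by (intro smooth_intros smooth_on_frechet_derivative[OF smooth] open_UNIV)
  have hs: "smooth_on UNIV (\<lambda>p. hnorm (m p))"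
  proof -
    have "smooth_on UNIV (\<lambda>p. sqrt ((fst (m p))\<^sup>2 + (fst (snd (m p)))\<^sup>2))"
      by (intro smooth_intros ms open_UNIV) (use mpos in \<open>simp only: hnorm_def case_prod_unfold real_sqrt_gt_0_iff\<close>)
    then show ?thesis by (simp add: hnorm_def case_prod_unfold)
  qed
  define a where "a p = fst (snd (m p)) / hnorm (m p)" for p
  define b where "b p = - fst (m p) / hnorm (m p)" for p
  have abs: "smooth_on UNIV a" "smooth_on UNIV b"
    unfolding a_def[abs_def] b_def[abs_def] by (intro smooth_intros hs ms open_UNIV; use mpos in \<open>simp add: less_imp_neq[symmetric]\<close>)+
  have ab1: "(a p)\<^sup>2 + (b p)\<^sup>2 = 1" for p
  proof -
    have h: "(fst (snd (m p)))\<^sup>2 + (fst (m p))\<^sup>2 = (hnorm (m p))\<^sup>2"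
      by (simp add: hnorm_def case_prod_unfold)
    have "(a p)\<^sup>2 + (b p)\<^sup>2 = ((fst (snd (m p)))\<^sup>2 + (fst (m p))\<^sup>2) / (hnorm (m p))\<^sup>2"
      by (simp add: a_def b_def power_divide add_divide_distrib)
    then show ?thesis unfolding h using mpos[of p] by simp
  qed
  define V where "V p = \<rho> p *\<^sub>R (a (\<Psi> p) *\<^sub>R X_field p + b (\<Psi> p) *\<^sub>R Y_field p)" for p
  have XY: "smooth_on UNIV X_field" "smooth_on UNIV Y_field"
  proof -
    have eq: "X_field = (\<lambda>p. (1, 0, - fst (snd p) * (1/2)))" "Y_field = (\<lambda>p. (0, 1, fst p * (1/2)))"
      by (auto simp: X_field_def Y_field_def)
    show "smooth_on UNIV X_field" "smooth_on UNIV Y_field"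
      unfolding eq by (intro smooth_intros open_UNIV)+
  qed
  have Vs: "smooth_on UNIV V"
    unfolding V_def[abs_def]
    by (intro smooth_intros \<rho> XY smooth_on_compose[of UNIV UNIV \<Psi>, OF _ _ _ abs(1) \<Psi>s] smooth_on_compose[of UNIV UNIV \<Psi>, OF _ _ _ abs(2) \<Psi>s] open_UNIV) auto
  have Vh: "V p \<in> horizontal p" for p
    unfolding V_def horizontal_def by (intro span_scale span_add) (auto intro: span_base)
  have Vc: "fst (V p) = \<rho> p * a (\<Psi> p)" "fst (snd (V p)) = \<rho> p * b (\<Psi> p)" for p
    by (simp_all add: V_def X_field_def Y_field_def case_prod_unfold)
  have sub: "closure {p. V p \<noteq> 0} \<subseteq> closure {p. \<rho> p \<noteq> 0}"
    by (intro closure_mono) (auto simp: V_def)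
  have \<rho>c: "compact (closure {p. \<rho> p \<noteq> 0})" "closure {p. \<rho> p \<noteq> 0} \<subseteq> \<Omega>"
    using \<rho>(4) by (auto simp: compactly_in_def)
  have Vk: "compact (closure {p. V p \<noteq> 0})"
    using compact_Int_closed[OF \<rho>c(1) closed_closure, of "{p. V p \<noteq> 0}"] sub by (simp only: Int_absorb1)
  have "hnorm (V p) \<le> 1" for p
  proof -
    have "hnorm (V p) = sqrt ((\<rho> p)\<^sup>2 * ((a (\<Psi> p))\<^sup>2 + (b (\<Psi> p))\<^sup>2))"
      by (simp add: hnorm_def case_prod_unfold Vc power_mult_distrib distrib_left)
    then show ?thesis using ab1 \<rho>(2,3)[of p] by simp
  qed
  then have "V \<in> test_fields \<Omega>"
    using Vs Vh Vk sub \<rho>c(2) unfolding test_fields_def compactly_in_def closure_closure by blast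
  moreover have "(LINT p:\<Phi> ` saddle|lebesgue. divergence V p) = (LINT q|lborel. \<rho> (\<Phi> (saddle_point q)) * area_density \<Phi> q)"
    unfolding flux[OF Vs Vh Vk]
  proof (rule Bochner_Integration.integral_cong[OF refl])
    fix q
    have mr: "m (saddle_point q) = ruling \<Phi> q" by (simp add: m_def w_def saddle_point_def ruling_def)
    define h where "h = hnorm (ruling \<Phi> q)"
    have h: "h > 0" "(fst (ruling \<Phi> q))\<^sup>2 + (fst (snd (ruling \<Phi> q)))\<^sup>2 = h\<^sup>2"
      using ruling_pos by (simp_all add: h_def hnorm_def case_prod_unfold)
    have "fst (V (\<Phi> (saddle_point q))) * fst (snd (ruling \<Phi> q)) - fst (snd (V (\<Phi> (saddle_point q)))) * fst (ruling \<Phi> q) =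
      \<rho> (\<Phi> (saddle_point q)) * (((fst (ruling \<Phi> q))\<^sup>2 + (fst (snd (ruling \<Phi> q)))\<^sup>2) / h)"
      by (simp add: Vc \<Psi>\<Phi> a_def b_def mr h_def[symmetric] power2_eq_square add_divide_distrib distrib_left)
    also have "\<dots> = \<rho> (\<Phi> (saddle_point q)) * h"
      unfolding h(2) using h(1) by (simp add: power2_eq_square)
    finally show "(fst (V (\<Phi> (saddle_point q))) * fst (snd (ruling \<Phi> q)) -
        fst (snd (V (\<Phi> (saddle_point q)))) * fst (ruling \<Phi> q)) * crossing \<Phi> q =
      \<rho> (\<Phi> (saddle_point q)) * area_density \<Phi> q" by (simp add: area_density_def h_def)
  qed
  ultimately show ?thesis by (rule that)
qed

text \<open>Cauchy-Schwarz bounds the flux of every test field by the integral of the density; the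
  fields of \<open>test_field_exists\<close> with increasing cutoffs attain it in the limit. On an
  unbounded \<Omega> the density need not be integrable a priori, and there monotone convergence
  yields integrability from finite perimeter. The domain of integration can be expressed through the
  unperturbed surface because \<Phi> maps \<Omega> to itself.\<close>

lemma perimeter_eq_integral:
  assumes \<Omega>: "open \<Omega>" "closure {p. \<Phi> p \<noteq> p} \<subseteq> \<Omega>"
  defines "dens \<equiv> \<lambda>q. indicator {q. saddle_point q \<in> \<Omega>} q * area_density \<Phi> q"
  shows "integrable lborel dens \<Longrightarrow> perimeter (\<Phi> ` saddle) \<Omega> = ereal (LINT q|lborel. dens q)"
    and "perimeter (\<Phi> ` saddle) \<Omega> < \<infinity> \<Longrightarrow> integrable lborel dens"
proof -
  have upper: "(LINT p:\<Phi> ` saddle|lebesgue. divergence V p) \<le> (LINT q|lborel. dens q)"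
    if "integrable lborel dens" "V \<in> test_fields \<Omega>" for V
  proof -
    have V: "smooth_on UNIV V" "\<And>p. V p \<in> horizontal p" "compact (closure {p. V p \<noteq> 0})" "closure {p. V p \<noteq> 0} \<subseteq> \<Omega>"
      "\<And>p. hnorm (V p) \<le> 1"
      using that(2) by (auto simp: test_fields_def compactly_in_def)
    have bound: "\<bar>(fst (V (\<Phi> (saddle_point q))) * fst (snd (ruling \<Phi> q)) -
      fst (snd (V (\<Phi> (saddle_point q)))) * fst (ruling \<Phi> q)) * crossing \<Phi> q\<bar> \<le> dens q" for q
    proof (cases "saddle_point q \<in> \<Omega>")
      case True
      obtain v1 v2 v3 where v: "V (\<Phi> (saddle_point q)) = (v1, v2, v3)" by (metis prod.exhaust)
      obtain r1 r2 r3 where r: "ruling \<Phi> q = (r1, r2, r3)" by (metis prod.exhaust)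
      have "\<bar>v1 * r2 - v2 * r1\<bar> = \<bar>(v1, v2) \<bullet> (r2, - r1)\<bar>" by (simp add: inner_prod_def)
      also have "\<dots> \<le> norm (v1, v2) * norm (r2, - r1)" by (rule Cauchy_Schwarz_ineq2)
      also have "\<dots> = hnorm (V (\<Phi> (saddle_point q))) * hnorm (ruling \<Phi> q)"
        by (simp add: v r hnorm_def norm_Pair add.commute)
      also have "\<dots> \<le> hnorm (ruling \<Phi> q)"
        using V(5)[of "\<Phi> (saddle_point q)"] ruling_pos[of q] by simp
      finally show ?thesis
        using True crossing_pos[of q] by (simp add: v r dens_def area_density_def abs_mult mult.commute)
    next
      case False
      then have "\<Phi> (saddle_point q) \<notin> \<Omega>" using mem_open_iff[OF \<Omega>(2)] by blast
      then have "V (\<Phi> (saddle_point q)) = 0" using V(4) not_in_closure_Collect[of _ "\<lambda>p. V p \<noteq> 0"] by blast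
      then show ?thesis using False by (simp add: dens_def)
    qed
    then show ?thesis
      unfolding flux[OF V(1-3)]
      by (intro integral_mono_AE' that(1) AE_I2) (auto intro: order_trans[OF abs_ge_self] order_trans[OF abs_ge_zero])
  qed
  obtain \<rho> :: "nat \<Rightarrow> heis \<Rightarrow> real" where \<rho>: "\<And>n. smooth_on UNIV (\<rho> n)" "\<And>n x. 0 \<le> \<rho> n x" "\<And>n x. \<rho> n x \<le> 1"
    "\<And>n. closure {x. \<rho> n x \<noteq> 0} \<subset>\<subset> \<Omega>" "\<And>x. x \<in> \<Omega> \<Longrightarrow> (\<lambda>n. \<rho> n x) \<longlonglongrightarrow> 1"
    "\<And>x. incseq (\<lambda>n. \<rho> n x)"
    by (rule smooth_cutoff_sequence[OF \<Omega>(1)]) blast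
  define f where "f n q = \<rho> n (\<Phi> (saddle_point q)) * area_density \<Phi> q" for n q
  have fper: "ereal (LINT q|lborel. f n q) \<le> perimeter (\<Phi> ` saddle) \<Omega>" for n
  proof -
    obtain V where V: "V \<in> test_fields \<Omega>" "(LINT p:\<Phi> ` saddle|lebesgue. divergence V p) = (LINT q|lborel. f n q)"
      unfolding f_def using test_field_exists[OF \<Omega>(1) \<rho>(1-4)] by blast
    show ?thesis unfolding perimeter_def V(2)[symmetric] by (rule SUP_upper[OF V(1)])
  qed
  have \<rho>0: "\<rho> n x = 0" if "x \<notin> \<Omega>" for n x
    using \<rho>(4)[of n] that not_in_closure_Collect[of x "\<lambda>x. \<rho> n x \<noteq> 0"]
    unfolding compactly_in_def closure_closure by blast
  have flim: "(\<lambda>n. f n q) \<longlonglongrightarrow> dens q" for q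
  proof (cases "saddle_point q \<in> \<Omega>")
    case True
    then have "\<Phi> (saddle_point q) \<in> \<Omega>" using mem_open_iff[OF \<Omega>(2)] by blast
    then have "(\<lambda>n. f n q) \<longlonglongrightarrow> 1 * area_density \<Phi> q" unfolding f_def by (intro tendsto_intros \<rho>(5))
    then show ?thesis using True by (simp add: dens_def)
  next
    case False
    then have "\<Phi> (saddle_point q) \<notin> \<Omega>" using mem_open_iff[OF \<Omega>(2)] by blast
    then show ?thesis using False by (simp add: dens_def f_def \<rho>0)
  qed
  have fmono: "incseq (\<lambda>n. f n q)" for q
    using \<rho>(6) area_density_pos[of q] unfolding f_def by (auto simp: incseq_def intro!: mult_right_mono)
  have fint: "integrable lborel (f n)" for n
  proof (rule continuous_compact_support_integrable)
    have "continuous_on UNIV (\<lambda>q. \<rho> n (\<Phi> (saddle_point q)))"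
      by (intro continuous_on_compose2[OF smooth_on_continuous_on[OF \<rho>(1)]]
        continuous_on_compose2[OF smooth_on_continuous_on[OF smooth]] continuous_intros) auto
    then show "continuous_on UNIV (f n)"
      unfolding f_def[abs_def] by (intro continuous_intros continuous_area_density[OF smooth])
    let ?K = "inv \<Phi> ` closure {x. \<rho> n x \<noteq> 0}"
    have "compact (closure {x. \<rho> n x \<noteq> 0})" using \<rho>(4)[of n] by (simp add: compactly_in_def)
    note K = diffeomorphism_preimage_compact[OF diff this]
    show "compact (snd ` ?K)" by (intro compact_continuous_image continuous_intros K)
    show "f n q = 0" if "q \<notin> snd ` ?K" for q
    proof -
      have "saddle_point q \<notin> ?K"
      proof
        assume "saddle_point q \<in> ?K"
        then have "snd (saddle_point q) \<in> snd ` ?K" by (rule imageI)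
        then show False using that unfolding saddle_point_def snd_conv by contradiction
      qed
      then have "\<Phi> (saddle_point q) \<notin> closure {x. \<rho> n x \<noteq> 0}" using K(2) by blast
      then have "\<rho> n (\<Phi> (saddle_point q)) = 0" using not_in_closure_Collect[of _ "\<lambda>x. \<rho> n x \<noteq> 0"] by blast
      then show ?thesis by (simp add: f_def)
    qed
  qed
  have [measurable]: "dens \<in> borel_measurable lborel"
    by (rule borel_measurable_LIMSEQ_real[OF flim]) (use fint in auto)
  show "perimeter (\<Phi> ` saddle) \<Omega> = ereal (LINT q|lborel. dens q)" if int: "integrable lborel dens"
  proof (rule antisym)
    show "perimeter (\<Phi> ` saddle) \<Omega> \<le> ereal (LINT q|lborel. dens q)"
      unfolding perimeter_def by (rule SUP_least) (use upper[OF int] in simp)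
    have "(\<lambda>n. LINT q|lborel. f n q) \<longlonglongrightarrow> (LINT q|lborel. dens q)"
    proof (rule integral_dominated_convergence[OF _ _ int])
      show "AE q in lborel. norm (f n q) \<le> dens q" for n
      proof (rule AE_I2)
        fix q
        have "0 \<le> f n q" using \<rho>(2) area_density_pos[of q] by (simp add: f_def)
        moreover have "f n q \<le> dens q" using incseq_le[OF fmono flim] .
        ultimately show "norm (f n q) \<le> dens q" by simp
      qed
    qed (use fint flim in auto)
    then have "(\<lambda>n. ereal (LINT q|lborel. f n q)) \<longlonglongrightarrow> ereal (LINT q|lborel. dens q)" by simp
    then show "ereal (LINT q|lborel. dens q) \<le> perimeter (\<Phi> ` saddle) \<Omega>"
      by (rule LIMSEQ_le_const2) (use fper in blast)
  qed
  show "integrable lborel dens" if fin: "perimeter (\<Phi> ` saddle) \<Omega> < \<infinity>"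
  proof -
    have mono: "incseq (\<lambda>n. LINT q|lborel. f n q)"
      using fmono fint by (auto simp: incseq_def intro!: integral_mono)
    obtain C where C: "\<And>n. (LINT q|lborel. f n q) \<le> C"
      using fin fper by (cases "perimeter (\<Phi> ` saddle) \<Omega>") force+
    obtain L where L: "(\<lambda>n. LINT q|lborel. f n q) \<longlonglongrightarrow> L"
      using incseq_convergent[OF mono, of C] C by blast
    show ?thesis
      by (rule integrable_monotone_convergence[OF fint _ _ L])
        (use fmono flim in \<open>auto simp: mono_def incseq_def\<close>)
  qed
qed

end

section \<open>The intrinsic graph\<close>

definition twisted :: "real \<times> real \<Rightarrow> real" where
  "twisted = (\<lambda>(\<eta>, \<tau>). \<eta> * \<tau> / (1 + \<eta>\<^sup>2 / 2))"

lemma one_plus_half_square_pos: "0 < 1 + (x::real)\<^sup>2 / 2"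
  using zero_le_power2[of x] by linarith

lemma continuous_twisted: "continuous_on UNIV twisted"
  unfolding twisted_def case_prod_unfold
  by (intro continuous_intros ballI less_imp_neq[OF one_plus_half_square_pos, symmetric]) simp

lemma intrinsic_subgraph_twisted: "intrinsic_subgraph twisted = saddle"
proof -
  have "x \<le> twisted (y, z + x * y / 2) \<longleftrightarrow> x \<le> y * z" for x y z :: real
  proof -
    have "x \<le> twisted (y, z + x * y / 2) \<longleftrightarrow> x * (1 + y\<^sup>2 / 2) \<le> y * (z + x * y / 2)"
      using one_plus_half_square_pos[of y] by (simp add: twisted_def pos_le_divide_eq)
    also have "\<dots> \<longleftrightarrow> x \<le> y * z" by (simp add: algebra_simps power2_eq_square)
    finally show ?thesis .
  qed
  then show ?thesis
    by (auto simp: intrinsic_subgraph_eq saddle_def)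
qed

text \<open>Here \<open>c\<close> is the z-coordinate of the point of the graph over (\<eta>0,
  \<tau>0), that is, the slope of the ruling through it. Following this ruling produces exactly the
  linear term c \<eta>, so the intrinsic gradient is \<open>c\<close>, and the remainder is explicit
  and of order 1/s.\<close>

lemma twisted_blow_up:
  fixes s \<eta>0 \<tau>0 \<eta> \<tau> :: real
  assumes "s > 0"
  defines "c \<equiv> \<tau>0 / (1 + \<eta>0\<^sup>2 / 2)" and "x \<equiv> \<eta>0 + \<eta> / s"
  shows "s * (- twisted (\<eta>0, \<tau>0) + twisted (\<eta>0 + \<eta> / s, \<tau>0 + twisted (\<eta>0, \<tau>0) * \<eta> / s + \<tau> / s\<^sup>2)) - c * \<eta>
    = x / (1 + x\<^sup>2 / 2) * (\<tau> - c * \<eta>\<^sup>2 / 2) / s"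
proof -
  define h where "h = \<eta> / s"
  define k where "k = \<tau> / s\<^sup>2"
  define J where "J = 1 + x\<^sup>2 / 2"
  have J: "J > 0" unfolding J_def by (rule one_plus_half_square_pos)
  have f0: "twisted (\<eta>0, \<tau>0) = c * \<eta>0" by (simp add: twisted_def c_def)
  have "\<tau>0 = c * (1 + \<eta>0\<^sup>2 / 2)"
    using one_plus_half_square_pos[of \<eta>0] by (simp add: c_def)
  then have "\<tau>0 + c * \<eta>0 * h + k = c * J + (k - c * h\<^sup>2 / 2)"
    by (simp add: J_def x_def h_def[symmetric] power2_eq_square algebra_simps)
  moreover have "\<tau>0 + twisted (\<eta>0, \<tau>0) * \<eta> / s + \<tau> / s\<^sup>2 = \<tau>0 + c * \<eta>0 * h + k"
    by (simp add: f0 h_def k_def)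
  ultimately have "twisted (\<eta>0 + \<eta> / s, \<tau>0 + twisted (\<eta>0, \<tau>0) * \<eta> / s + \<tau> / s\<^sup>2) = x * (c * J + (k - c * h\<^sup>2 / 2)) / J"
    by (simp add: twisted_def x_def[symmetric] J_def)
  also have "\<dots> = c * x + x / J * (k - c * h\<^sup>2 / 2)"
    using J by (simp add: field_simps)
  finally have "s * (- twisted (\<eta>0, \<tau>0) + twisted (\<eta>0 + \<eta> / s, \<tau>0 + twisted (\<eta>0, \<tau>0) * \<eta> / s + \<tau> / s\<^sup>2)) - c * \<eta> =
    s * (- (c * \<eta>0) + (c * x + x / J * (k - c * h\<^sup>2 / 2))) - c * \<eta>" unfolding f0 by simp
  also have "\<dots> = s * (x / J * (k - c * h\<^sup>2 / 2))"
    using assms(1) by (simp add: x_def algebra_simps)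
  also have "s * (x / J * (k - c * h\<^sup>2 / 2)) = x / J * (s * (k - c * h\<^sup>2 / 2))" by simp
  also have "s * (k - c * h\<^sup>2 / 2) = (\<tau> - c * \<eta>\<^sup>2 / 2) / s"
    using assms(1) by (simp add: k_def h_def field_simps power2_eq_square)
  finally show ?thesis by (simp add: J_def)
qed

lemma twisted_C1W: "twisted \<in> C1W"
proof -
  define \<psi> where "\<psi> = (\<lambda>(\<eta>0::real, \<tau>0::real). \<tau>0 / (1 + \<eta>0\<^sup>2 / 2))"
  have "uniform_limit (K \<times> L)
          (\<lambda>s ((\<eta>\<^sub>0, \<tau>\<^sub>0), (\<eta>, \<tau>)).
              s * (- twisted (\<eta>\<^sub>0, \<tau>\<^sub>0) + twisted (\<eta>\<^sub>0 + \<eta> / s, \<tau>\<^sub>0 + twisted (\<eta>\<^sub>0, \<tau>\<^sub>0) * \<eta> / s + \<tau> / s\<^sup>2)))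
          (\<lambda>((\<eta>\<^sub>0, \<tau>\<^sub>0), (\<eta>, \<tau>)). \<psi> (\<eta>\<^sub>0, \<tau>\<^sub>0) * \<eta>)
          (at_top :: real filter)"
    if KL: "compact K" "compact L" for K L :: "(real \<times> real) set"
  proof (rule uniform_limitI)
    fix e :: real
    assume "e > 0"
    obtain k where k: "\<And>q. q \<in> K \<Longrightarrow> norm q \<le> k"
      using compact_imp_bounded[OF KL(1), unfolded bounded_iff] by blast
    obtain l where l: "\<And>q. q \<in> L \<Longrightarrow> norm q \<le> l"
      using compact_imp_bounded[OF KL(2), unfolded bounded_iff] by blast
    \<comment> \<open>A bound for \<open>\<tau> - c * \<eta>\<^sup>2 / 2\<close> on the compact
      sets. The other factor x / (1 + x^2 / 2) of the remainder has modulus at most 1 for all x, so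
      s > M / e suffices.\<close>
    define M where "M = \<bar>l\<bar> + \<bar>k\<bar> * \<bar>l\<bar>\<^sup>2"
    have "\<forall>\<^sub>F s in at_top. s > max 0 (M / e)" by (rule eventually_gt_at_top)
    then show "\<forall>\<^sub>F s in at_top. \<forall>x\<in>K \<times> L. dist
      ((\<lambda>((\<eta>\<^sub>0, \<tau>\<^sub>0), (\<eta>, \<tau>)). s * (- twisted (\<eta>\<^sub>0, \<tau>\<^sub>0) + twisted (\<eta>\<^sub>0 + \<eta> / s, \<tau>\<^sub>0 + twisted (\<eta>\<^sub>0, \<tau>\<^sub>0) * \<eta> / s + \<tau> / s\<^sup>2))) x)
      ((\<lambda>((\<eta>\<^sub>0, \<tau>\<^sub>0), (\<eta>, \<tau>)). \<psi> (\<eta>\<^sub>0, \<tau>\<^sub>0) * \<eta>) x) < e"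
    proof (rule eventually_mono, intro ballI)
      fix s :: real and p
      assume s: "s > max 0 (M / e)" and p: "p \<in> K \<times> L"
      obtain \<eta>0 \<tau>0 \<eta> \<tau> where peq: "p = ((\<eta>0, \<tau>0), (\<eta>, \<tau>))" by (metis prod.exhaust)
      have "\<bar>\<tau>0\<bar> \<le> \<bar>k\<bar>" using k[of "(\<eta>0, \<tau>0)"] p norm_snd_le[of \<tau>0 \<eta>0] by (simp add: peq)
      have el: "\<bar>\<eta>\<bar> \<le> \<bar>l\<bar>" "\<bar>\<tau>\<bar> \<le> \<bar>l\<bar>"
        using l[of "(\<eta>, \<tau>)"] p norm_snd_le[of \<tau> \<eta>] norm_fst_le[of \<eta> \<tau>] by (simp_all add: peq)
      define c where "c = \<tau>0 / (1 + \<eta>0\<^sup>2 / 2)"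
      define x where "x = \<eta>0 + \<eta> / s"
      have "\<bar>c\<bar> \<le> \<bar>k\<bar>"
      proof -
        have "\<bar>c\<bar> = \<bar>\<tau>0\<bar> / (1 + \<eta>0\<^sup>2 / 2)" using one_plus_half_square_pos[of \<eta>0] by (simp add: c_def)
        also have "\<dots> \<le> \<bar>\<tau>0\<bar> / 1" using one_plus_half_square_pos[of \<eta>0] by (intro divide_left_mono) auto
        finally show ?thesis using \<open>\<bar>\<tau>0\<bar> \<le> \<bar>k\<bar>\<close> by simp
      qed
      have "\<bar>x\<bar> \<le> 1 + x\<^sup>2 / 2"
        using zero_le_power2[of "\<bar>x\<bar> - 1"] by (simp add: power2_diff)
      then have x1: "\<bar>x / (1 + x\<^sup>2 / 2)\<bar> \<le> 1"
        using one_plus_half_square_pos[of x] by (simp add: abs_divide)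
      have t: "\<bar>\<tau> - c * \<eta>\<^sup>2 / 2\<bar> \<le> \<bar>\<tau>\<bar> + \<bar>c\<bar> * \<eta>\<^sup>2 / 2"
        using abs_triangle_ineq4[of \<tau> "c * \<eta>\<^sup>2 / 2"] by (simp add: abs_mult)
      have "\<bar>c\<bar> * \<eta>\<^sup>2 \<le> \<bar>k\<bar> * \<bar>l\<bar>\<^sup>2"
        using \<open>\<bar>c\<bar> \<le> \<bar>k\<bar>\<close> el(1) by (intro mult_mono) (auto simp: abs_le_square_iff)
      then have M: "\<bar>\<tau> - c * \<eta>\<^sup>2 / 2\<bar> \<le> M"
        using t el(2) mult_nonneg_nonneg[of "\<bar>k\<bar>" "\<bar>l\<bar>\<^sup>2", OF abs_ge_zero zero_le_power2] unfolding M_def by linarith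
      have s0: "s > 0" using s by simp
      have "dist (s * (- twisted (\<eta>0, \<tau>0) + twisted (\<eta>0 + \<eta> / s, \<tau>0 + twisted (\<eta>0, \<tau>0) * \<eta> / s + \<tau> / s\<^sup>2))) (\<psi> (\<eta>0, \<tau>0) * \<eta>)
        = \<bar>x / (1 + x\<^sup>2 / 2) * (\<tau> - c * \<eta>\<^sup>2 / 2) / s\<bar>"
        unfolding dist_real_def \<psi>_def prod.case twisted_blow_up[OF s0] c_def x_def ..
      also have "\<dots> = \<bar>x / (1 + x\<^sup>2 / 2)\<bar> * \<bar>\<tau> - c * \<eta>\<^sup>2 / 2\<bar> / s"
        using s0 by (simp only: abs_mult abs_divide abs_of_pos)
      also have "\<dots> \<le> 1 * M / s"
        using s0 x1 M by (intro divide_right_mono mult_mono) auto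
      also have "\<dots> < e" using s s0 \<open>e > 0\<close> by (simp add: divide_less_eq mult.commute)
      finally show "dist
      ((\<lambda>((\<eta>\<^sub>0, \<tau>\<^sub>0), (\<eta>, \<tau>)). s * (- twisted (\<eta>\<^sub>0, \<tau>\<^sub>0) + twisted (\<eta>\<^sub>0 + \<eta> / s, \<tau>\<^sub>0 + twisted (\<eta>\<^sub>0, \<tau>\<^sub>0) * \<eta> / s + \<tau> / s\<^sup>2))) p)
      ((\<lambda>((\<eta>\<^sub>0, \<tau>\<^sub>0), (\<eta>, \<tau>)). \<psi> (\<eta>\<^sub>0, \<tau>\<^sub>0) * \<eta>) p) < e"
        by (simp only: peq prod.case)
    qed
  qed
  then show ?thesis unfolding C1W_def using continuous_twisted by blast
qed

section \<open>Contact images of the surface have larger area\<close>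

lemma smooth_on_line_derivative:
  fixes u :: "'a::euclidean_space \<Rightarrow> real"
  assumes "smooth_on UNIV u"
  shows "((\<lambda>r. u (q + r *\<^sub>R v)) has_real_derivative frechet_derivative u (at q) v) (at 0)"
  using Ck_on_1_line_derivative[OF open_UNIV smooth_on_imp_Ck_on[OF assms], of q 0 v]
  by (simp add: has_real_derivative_iff_has_vector_derivative)

lemma smooth_saddle_point: "smooth_on UNIV saddle_point"
  unfolding saddle_point_def[abs_def] by (intro smooth_intros open_UNIV)

lemma saddle_point_derivative:
  "(saddle_point has_derivative (\<lambda>v. (fst q * snd v + fst v * snd q, v))) (at q)"
  unfolding saddle_point_def[abs_def] by (auto intro!: derivative_eq_intros)

definition crossing_vec :: "(heis \<Rightarrow> heis) \<Rightarrow> real \<times> real \<Rightarrow> heis" where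
  "crossing_vec \<Phi> q = frechet_derivative \<Phi> (at (saddle_point q)) (fst q, 0, 1)"

text \<open>With \<open>e\<close> the direction of the ruling \<open>c = snd q\<close> of the unperturbed surface,
  \<open>along\<close> and \<open>across\<close> are the components of the planar projection of the perturbed surface
  in the direction of \<open>e\<close> and orthogonally to it, both scaled by \<open>sqrt (1 + c\<^sup>2)\<close>.\<close>

definition along :: "(heis \<Rightarrow> heis) \<Rightarrow> real \<times> real \<Rightarrow> real" where
  "along \<Phi> q = snd q * fst (\<Phi> (saddle_point q)) + fst (snd (\<Phi> (saddle_point q)))"

definition across :: "(heis \<Rightarrow> heis) \<Rightarrow> real \<times> real \<Rightarrow> real" where
  "across \<Phi> q = snd q * fst (snd (\<Phi> (saddle_point q))) - fst (\<Phi> (saddle_point q))"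

definition along_speed :: "(heis \<Rightarrow> heis) \<Rightarrow> real \<times> real \<Rightarrow> real" where
  "along_speed \<Phi> q = snd q * fst (ruling \<Phi> q) + fst (snd (ruling \<Phi> q))"

definition across_speed :: "(heis \<Rightarrow> heis) \<Rightarrow> real \<times> real \<Rightarrow> real" where
  "across_speed \<Phi> q = snd q * fst (snd (ruling \<Phi> q)) - fst (ruling \<Phi> q)"

text \<open>The derivative of \<open>across\<close> in the second parameter c; its first summand
  comes from the explicit factor c. Likewise \<open>along_speed\<close> and
  \<open>across_speed\<close> are the derivatives of \<open>along\<close> and \<open>across\<close>
  in the first parameter.\<close>

definition across_slope :: "(heis \<Rightarrow> heis) \<Rightarrow> real \<times> real \<Rightarrow> real" where
  "across_slope \<Phi> q = fst (snd (\<Phi> (saddle_point q))) + snd q * fst (snd (crossing_vec \<Phi> q)) - fst (crossing_vec \<Phi> q)"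

text \<open>The factor w that normalises (c, 1). Its square is also the rate at which the direction
  of (c, 1) turns with c, which is why higher powers of w appear below.\<close>

definition slope_weight :: "real \<times> real \<Rightarrow> real" where
  "slope_weight q = 1 / sqrt (1 + (snd q)\<^sup>2)"

text \<open>A lower bound for the area density which is a divergence, hence insensitive to compactly
  supported contact perturbations.\<close>

definition null_density :: "(heis \<Rightarrow> heis) \<Rightarrow> real \<times> real \<Rightarrow> real" where
  "null_density \<Phi> q = crossing \<Phi> q * along_speed \<Phi> q * slope_weight q
     - along_speed \<Phi> q * (across \<Phi> q)\<^sup>2 * slope_weight q ^ 5 / 2"

text \<open>Put s = \<open>along\<close> * w and n = \<open>across\<close> * w, the coordinates in
  the orthonormal frame (c, 1) w, (-1, c) w, which turns at the rate w^2. In this frame the Jacobian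
  J_t reads s_c n_t - n_c s_t + w^2 (s s_t + n n_t). Integrating J s_t by parts in t gives the
  potential J s + s^2 n_c / 2 - w^2 (s^3 / 3 + s n^2 / 2) defined here and its partner s^2 n_t / 2
  in \<open>crossing_potential\<close>. What is left over is w^2 s_t n^2 / 2, the term subtracted in
  \<open>null_density\<close>.\<close>

definition ruling_potential :: "(heis \<Rightarrow> heis) \<Rightarrow> real \<times> real \<Rightarrow> real" where
  "ruling_potential \<Phi> q = crossing \<Phi> q * along \<Phi> q * slope_weight q
     + (along \<Phi> q)\<^sup>2 * (across_slope \<Phi> q * slope_weight q ^ 3 - across \<Phi> q * snd q * slope_weight q ^ 5) * (1/2)
     - along \<Phi> q ^ 3 * slope_weight q ^ 5 * (1/3) - along \<Phi> q * (across \<Phi> q)\<^sup>2 * slope_weight q ^ 5 * (1/2)"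

definition crossing_potential :: "(heis \<Rightarrow> heis) \<Rightarrow> real \<times> real \<Rightarrow> real" where
  "crossing_potential \<Phi> q = (along \<Phi> q)\<^sup>2 * across_speed \<Phi> q * slope_weight q ^ 3 * (1/2)"

lemma one_plus_square_pos: "0 < 1 + (x::real)\<^sup>2"
  using zero_le_power2[of x] by linarith

lemma slope_weight_pos: "slope_weight q > 0"
  using one_plus_square_pos[of "snd q"] by (simp add: slope_weight_def)

lemma smooth_slope_weight: "smooth_on UNIV slope_weight"
  unfolding slope_weight_def[abs_def]
  by (intro smooth_intros open_UNIV) (auto simp: one_plus_square_pos less_imp_neq[OF one_plus_square_pos, symmetric])

lemma slope_weight_square: "slope_weight q ^ 2 * (1 + (snd q)\<^sup>2) = 1"
  using one_plus_square_pos[of "snd q"] by (simp add: slope_weight_def power_divide)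

lemma slope_weight_line_derivatives:
  "((\<lambda>r. slope_weight (q + r *\<^sub>R (0, 1))) has_real_derivative - snd q * slope_weight q ^ 3) (at 0)"
  "((\<lambda>r. slope_weight (q + r *\<^sub>R (1, 0))) has_real_derivative 0) (at 0)"
proof -
  have p: "0 < 1 + (snd q)\<^sup>2" by (rule one_plus_square_pos)
  have "((\<lambda>r. 1 / sqrt (1 + (snd q + r)\<^sup>2)) has_real_derivative - (snd q / sqrt (1 + (snd q)\<^sup>2)) / (sqrt (1 + (snd q)\<^sup>2) * sqrt (1 + (snd q)\<^sup>2))) (at 0)"
    using p by (auto intro!: derivative_eq_intros simp: less_imp_neq[OF p, symmetric] field_simps)
  then show "((\<lambda>r. slope_weight (q + r *\<^sub>R (0, 1))) has_real_derivative - snd q * slope_weight q ^ 3) (at 0)"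
    by (simp add: slope_weight_def power3_eq_cube ac_simps)
qed (simp add: slope_weight_def)

text \<open>The polynomial identity behind the divergence form; the variables stand for
  \<open>w\<close>, \<open>c\<close>, the crossing \<open>J\<close>, and the planar components \<open>a\<close>, \<open>b\<close> with their partial derivatives.\<close>

lemma null_density_identity:
  fixes w c J a b a1 b1 a2 b2 a12 b12 :: real
  assumes w: "w ^ 2 * (1 + c\<^sup>2) = 1"
  defines "S \<equiv> c * a + b" and "N \<equiv> c * b - a" and "St \<equiv> c * a1 + b1" and "Nt \<equiv> c * b1 - a1"
    and "Sc \<equiv> a + c * a2 + b2" and "Nc \<equiv> b + c * b2 - a2" and "Ntc \<equiv> b1 + c * b12 - a12"
    and "Jt \<equiv> a2 * b1 - a1 * b2"
  shows "Jt * S * w + J * St * w + S * St * (Nc * w ^ 3 - N * c * w ^ 5) + S\<^sup>2 * (Ntc * w ^ 3 - Nt * c * w ^ 5) / 2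
     - S\<^sup>2 * St * w ^ 5 - St * N\<^sup>2 * w ^ 5 / 2 - S * N * Nt * w ^ 5
     - (S * Sc * Nt * w ^ 3 + S\<^sup>2 * Ntc * w ^ 3 / 2 - 3 / 2 * S\<^sup>2 * Nt * c * w ^ 5)
    = J * St * w - St * N\<^sup>2 * w ^ 5 / 2"
proof -
  \<comment> \<open>The expression of the Jacobian \<open>Jt\<close> in the turning frame, with
    denominators cleared. The powers of \<open>w\<close> are then brought to the common power
    \<open>w ^ 5\<close> in order to factor it out.\<close>
  have id: "Jt * (1 + c\<^sup>2)\<^sup>2 + (1 + c\<^sup>2) * (St * Nc - Sc * Nt) + c * (S * Nt - St * N) - S * St - N * Nt = 0"
    unfolding S_def N_def St_def Nt_def Sc_def Nc_def Jt_def by (simp add: algebra_simps power2_eq_square)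
  have w1: "w = w ^ 5 * (1 + c\<^sup>2)\<^sup>2" and w3: "w ^ 3 = w ^ 5 * (1 + c\<^sup>2)"
  proof -
    have "w ^ 5 * (1 + c\<^sup>2)\<^sup>2 = w * (w ^ 2 * (1 + c\<^sup>2)) ^ 2"
      by (simp add: power_mult_distrib power2_eq_square power_numeral_reduce)
    then show "w = w ^ 5 * (1 + c\<^sup>2)\<^sup>2" using w by simp
    have "w ^ 5 * (1 + c\<^sup>2) = w ^ 3 * (w ^ 2 * (1 + c\<^sup>2))"
      by (simp add: power_numeral_reduce)
    then show "w ^ 3 = w ^ 5 * (1 + c\<^sup>2)" using w by simp
  qed
  have "Jt * S * w + J * St * w + S * St * (Nc * w ^ 3 - N * c * w ^ 5) + S\<^sup>2 * (Ntc * w ^ 3 - Nt * c * w ^ 5) / 2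
     - S\<^sup>2 * St * w ^ 5 - St * N\<^sup>2 * w ^ 5 / 2 - S * N * Nt * w ^ 5
     - (S * Sc * Nt * w ^ 3 + S\<^sup>2 * Ntc * w ^ 3 / 2 - 3 / 2 * S\<^sup>2 * Nt * c * w ^ 5)
     - (J * St * w - St * N\<^sup>2 * w ^ 5 / 2)
    = S * (Jt * w + (St * Nc - Sc * Nt) * w ^ 3 + (c * (S * Nt - St * N) - S * St - N * Nt) * w ^ 5)"
    by (simp add: field_simps power2_eq_square)
  also have "Jt * w + (St * Nc - Sc * Nt) * w ^ 3 + (c * (S * Nt - St * N) - S * St - N * Nt) * w ^ 5 =
     w ^ 5 * (Jt * (1 + c\<^sup>2)\<^sup>2 + (1 + c\<^sup>2) * (St * Nc - Sc * Nt) + c * (S * Nt - St * N) - S * St - N * Nt)"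
    by (subst (1) w1, subst w3) (simp add: algebra_simps)
  finally show ?thesis unfolding id by simp
qed

context compact_contact
begin

lemma smooth_image: "smooth_on UNIV (\<lambda>q. \<Phi> (saddle_point q))"
  by (rule smooth_on_compose[OF open_UNIV open_UNIV _ smooth smooth_saddle_point]) simp

lemma image_derivative:
  "((\<lambda>q. \<Phi> (saddle_point q)) has_derivative
    (\<lambda>v. frechet_derivative \<Phi> (at (saddle_point q)) (fst q * snd v + fst v * snd q, v))) (at q)"
  by (rule has_derivative_compose[OF saddle_point_derivative smooth_on_has_derivative[OF smooth]]) simp

lemma image_derivative_ruling: "frechet_derivative (\<lambda>q. \<Phi> (saddle_point q)) (at q) (1, 0) = ruling \<Phi> q"
  and image_derivative_crossing: "frechet_derivative (\<lambda>q. \<Phi> (saddle_point q)) (at q) (0, 1) = crossing_vec \<Phi> q"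
  by (simp_all add: frechet_derivative_eqI[OF image_derivative] ruling_def crossing_vec_def)

lemma smooth_ruling: "smooth_on UNIV (ruling \<Phi>)"
  and smooth_crossing_vec: "smooth_on UNIV (crossing_vec \<Phi>)"
proof -
  show "smooth_on UNIV (ruling \<Phi>)"
    using smooth_on_frechet_derivative[OF smooth_image, of "(1, 0)"] unfolding image_derivative_ruling .
  show "smooth_on UNIV (crossing_vec \<Phi>)"
    using smooth_on_frechet_derivative[OF smooth_image, of "(0, 1)"] unfolding image_derivative_crossing .
qed

lemma crossing_eq: "crossing \<Phi> q = snd (snd (crossing_vec \<Phi> q)) - (fst (\<Phi> (saddle_point q)) * fst (snd (crossing_vec \<Phi> q))
    - fst (snd (\<Phi> (saddle_point q))) * fst (crossing_vec \<Phi> q)) * (1/2)"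
  by (simp add: crossing_def crossing_vec_def contact_form_def)

lemma smooth_crossing: "smooth_on UNIV (crossing \<Phi>)"
proof -
  have "smooth_on UNIV (\<lambda>q. snd (snd (crossing_vec \<Phi> q)) - (fst (\<Phi> (saddle_point q)) * fst (snd (crossing_vec \<Phi> q))
    - fst (snd (\<Phi> (saddle_point q))) * fst (crossing_vec \<Phi> q)) * (1/2))"
    by (intro smooth_intros smooth_image smooth_crossing_vec open_UNIV)
  then show ?thesis unfolding crossing_eq[symmetric] .
qed

lemma smooth_potentials: "smooth_on UNIV (ruling_potential \<Phi>)" "smooth_on UNIV (crossing_potential \<Phi>)"
  unfolding ruling_potential_def[abs_def] crossing_potential_def[abs_def] along_def across_def across_speed_def across_slope_def
  by (intro smooth_intros smooth_image smooth_crossing_vec smooth_ruling smooth_crossing smooth_slope_weight open_UNIV)+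

lemma null_density_divergence:
  "frechet_derivative (ruling_potential \<Phi>) (at q) (1, 0) - frechet_derivative (crossing_potential \<Phi>) (at q) (0, 1)
    = null_density \<Phi> q"
proof -
  let ?\<sigma> = "\<lambda>q. \<Phi> (saddle_point q)"
  define m where "m = frechet_derivative (ruling \<Phi>) (at q) (0, 1)"
  have mixed: "frechet_derivative (crossing_vec \<Phi>) (at q) (1, 0) = m"
    using second_derivative_symmetric_vector[OF smooth_on_imp_Ck_on[OF smooth_image], of "(0, 1)" q "(1, 0)"]
    unfolding image_derivative_ruling image_derivative_crossing m_def .
  have comp: "smooth_on UNIV (\<lambda>q. fst (f q))" "smooth_on UNIV (\<lambda>q. fst (snd (f q)))" "smooth_on UNIV (\<lambda>q. snd (snd (f q)))"
    "frechet_derivative (\<lambda>q. fst (f q)) (at q) v = fst (frechet_derivative f (at q) v)"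
    "frechet_derivative (\<lambda>q. fst (snd (f q))) (at q) v = fst (snd (frechet_derivative f (at q) v))"
    "frechet_derivative (\<lambda>q. snd (snd (f q))) (at q) v = snd (snd (frechet_derivative f (at q) v))"
    if "smooth_on UNIV f" for f :: "real \<times> real \<Rightarrow> heis" and v
  proof -
    note d = smooth_on_has_derivative[OF that UNIV_I, of q]
    show "frechet_derivative (\<lambda>q. fst (f q)) (at q) v = fst (frechet_derivative f (at q) v)"
      by (simp add: frechet_derivative_eqI[OF has_derivative_fst[OF d]])
    show "frechet_derivative (\<lambda>q. fst (snd (f q))) (at q) v = fst (snd (frechet_derivative f (at q) v))"
      by (simp add: frechet_derivative_eqI[OF has_derivative_fst[OF has_derivative_snd[OF d]]])
    show "frechet_derivative (\<lambda>q. snd (snd (f q))) (at q) v = snd (snd (frechet_derivative f (at q) v))"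
      by (simp add: frechet_derivative_eqI[OF has_derivative_snd[OF has_derivative_snd[OF d]]])
  qed (intro smooth_intros that open_UNIV)+
  have line: "((\<lambda>r. fst (f (q + r *\<^sub>R v))) has_real_derivative fst (frechet_derivative f (at q) v)) (at 0)"
    "((\<lambda>r. fst (snd (f (q + r *\<^sub>R v)))) has_real_derivative fst (snd (frechet_derivative f (at q) v))) (at 0)"
    "((\<lambda>r. snd (snd (f (q + r *\<^sub>R v)))) has_real_derivative snd (snd (frechet_derivative f (at q) v))) (at 0)"
    if "smooth_on UNIV f" for f :: "real \<times> real \<Rightarrow> heis" and v
    using smooth_on_line_derivative[OF comp(1)[OF that], of q v]
      smooth_on_line_derivative[OF comp(2)[OF that], of q v]
      smooth_on_line_derivative[OF comp(3)[OF that], of q v]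
    unfolding comp(4-6)[OF that] by simp_all
  note \<sigma>t = line[OF smooth_image, of "(1, 0)", unfolded image_derivative_ruling]
  note \<sigma>c = line[OF smooth_image, of "(0, 1)", unfolded image_derivative_crossing]
  note rc = line[OF smooth_ruling, of "(0, 1)", folded m_def]
  note ct = line[OF smooth_crossing_vec, of "(1, 0)", unfolded mixed]
  have snd_c: "((\<lambda>r. snd (q + r *\<^sub>R (1, 0))) has_real_derivative 0) (at 0)"
     "((\<lambda>r. snd (q + r *\<^sub>R (0, 1))) has_real_derivative 1) (at 0)"
    by (auto intro!: derivative_eq_intros)
  let ?a = "fst (?\<sigma> q)" and ?b = "fst (snd (?\<sigma> q))" and ?at = "fst (ruling \<Phi> q)" and ?bt = "fst (snd (ruling \<Phi> q))"
    and ?ac = "fst (crossing_vec \<Phi> q)" and ?bc = "fst (snd (crossing_vec \<Phi> q))" and ?c = "snd q" and ?w = "slope_weight q"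
    and ?atc = "fst m" and ?btc = "fst (snd m)"
  \<comment> \<open>This is where contactness enters the divergence identity. Differentiating the
    horizontality of the ruling in c determines the third entry of the mixed derivative
    \<open>m\<close>; inserted into the derivative of \<open>crossing\<close> in t, it cancels all
    second derivatives and leaves a planar Jacobian.\<close>
  have J_t: "((\<lambda>r. crossing \<Phi> (q + r *\<^sub>R (1, 0))) has_real_derivative ?ac * ?bt - ?at * ?bc) (at 0)"
  proof -
    have hor: "snd (snd (ruling \<Phi> q)) = (fst (?\<sigma> q) * fst (snd (ruling \<Phi> q)) - fst (snd (?\<sigma> q)) * fst (ruling \<Phi> q)) * (1/2)" for q
      using ruling_horizontal[of q] by (simp add: contact_form_def)
    have "((\<lambda>r. snd (snd (ruling \<Phi> (q + r *\<^sub>R (0, 1))))) has_real_derivative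
       (?ac * ?bt + ?a * ?btc - (?bc * ?at + ?b * ?atc)) * (1/2)) (at 0)"
      unfolding hor by (rule derivative_eq_intros \<sigma>c rc refl)+ (simp add: zero_prod_def[symmetric] algebra_simps)
    then have m3: "snd (snd m) = (?ac * ?bt + ?a * ?btc - (?bc * ?at + ?b * ?atc)) * (1/2)"
      using rc(3) DERIV_unique by blast
    show ?thesis
      unfolding crossing_eq
      by (rule derivative_eq_intros \<sigma>t ct refl)+ (simp add: m3 zero_prod_def[symmetric] algebra_simps)
  qed
  have U: "((\<lambda>r. ruling_potential \<Phi> (q + r *\<^sub>R (1, 0))) has_real_derivative
     (?ac * ?bt - ?at * ?bc) * (?c * ?a + ?b) * ?w + crossing \<Phi> q * (?c * ?at + ?bt) * ?w
     + (?c * ?a + ?b) * (?c * ?at + ?bt) * ((?b + ?c * ?bc - ?ac) * ?w ^ 3 - (?c * ?b - ?a) * ?c * ?w ^ 5)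
     + (?c * ?a + ?b)\<^sup>2 * ((?bt + ?c * ?btc - ?atc) * ?w ^ 3 - (?c * ?bt - ?at) * ?c * ?w ^ 5) / 2
     - (?c * ?a + ?b)\<^sup>2 * (?c * ?at + ?bt) * ?w ^ 5 - (?c * ?at + ?bt) * (?c * ?b - ?a)\<^sup>2 * ?w ^ 5 / 2
     - (?c * ?a + ?b) * (?c * ?b - ?a) * (?c * ?bt - ?at) * ?w ^ 5) (at 0)"
    unfolding ruling_potential_def along_def across_def across_slope_def
    by (rule derivative_eq_intros \<sigma>t ct J_t snd_c slope_weight_line_derivatives refl)+ (simp add: zero_prod_def[symmetric] field_simps power2_eq_square)
  have W: "((\<lambda>r. crossing_potential \<Phi> (q + r *\<^sub>R (0, 1))) has_real_derivative
      (?c * ?a + ?b) * (?a + ?c * ?ac + ?bc) * (?c * ?bt - ?at) * ?w ^ 3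
      + (?c * ?a + ?b)\<^sup>2 * (?bt + ?c * ?btc - ?atc) * ?w ^ 3 / 2
      - 3 / 2 * (?c * ?a + ?b)\<^sup>2 * (?c * ?bt - ?at) * ?c * ?w ^ 5) (at 0)"
    unfolding crossing_potential_def along_def across_speed_def
    by (rule derivative_eq_intros \<sigma>c rc snd_c slope_weight_line_derivatives refl)+ (simp add: zero_prod_def[symmetric] field_simps power2_eq_square power_numeral_reduce)
  have "frechet_derivative (ruling_potential \<Phi>) (at q) (1, 0) - frechet_derivative (crossing_potential \<Phi>) (at q) (0, 1) =
    crossing \<Phi> q * (?c * ?at + ?bt) * ?w - (?c * ?at + ?bt) * (?c * ?b - ?a)\<^sup>2 * ?w ^ 5 / 2"
    unfolding DERIV_unique[OF smooth_on_line_derivative[OF smooth_potentials(1)] U]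
      DERIV_unique[OF smooth_on_line_derivative[OF smooth_potentials(2)] W]
    by (rule null_density_identity[OF slope_weight_square])
  then show ?thesis by (simp add: null_density_def along_speed_def across_def)
qed

lemma off_support_eq:
  assumes "saddle_point q \<notin> closure {p. \<Phi> p \<noteq> p}"
  shows "\<Phi> (saddle_point q) = id (saddle_point q)" "ruling \<Phi> q = ruling id q" "crossing_vec \<Phi> q = crossing_vec id q"
    "crossing \<Phi> q = crossing id q"
  using derivative_off_support[OF assms] by (simp_all add: ruling_def crossing_vec_def crossing_def id_def)

text \<open>Two losses are discarded: by Cauchy-Schwarz the planar speed of the ruling is at least
  its component along (c, 1), and the term quadratic in \<open>across\<close> is non-negative once
  the ruling advances along (c, 1).\<close>

lemma area_density_ge_null_density:
  assumes "along_speed \<Phi> q \<ge> 0"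
  shows "area_density \<Phi> q \<ge> null_density \<Phi> q"
proof -
  note w0 = slope_weight_pos[of q]
  obtain r1 r2 r3 where r: "ruling \<Phi> q = (r1, r2, r3)" by (metis prod.exhaust)
  have "along_speed \<Phi> q = (snd q, 1) \<bullet> (r1, r2)" by (simp add: along_speed_def r inner_prod_def)
  also have "\<dots> \<le> norm (snd q, 1 :: real) * norm (r1, r2)" by (rule norm_cauchy_schwarz)
  also have "\<dots> = sqrt (1 + (snd q)\<^sup>2) * hnorm (ruling \<Phi> q)"
    by (simp add: norm_Pair hnorm_def r add.commute)
  finally have "along_speed \<Phi> q * slope_weight q \<le> hnorm (ruling \<Phi> q)"
    using one_plus_square_pos[of "snd q"] by (simp add: slope_weight_def divide_le_eq mult.commute)
  then have "crossing \<Phi> q * (along_speed \<Phi> q * slope_weight q) \<le> crossing \<Phi> q * hnorm (ruling \<Phi> q)"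
    using crossing_pos[of q] by (intro mult_left_mono) auto
  moreover have "0 \<le> along_speed \<Phi> q * (across \<Phi> q)\<^sup>2 * slope_weight q ^ 5 / 2"
    using assms w0 by simp
  ultimately show ?thesis by (simp add: null_density_def area_density_def mult.assoc)
qed

end

section \<open>Comparison with the unperturbed surface\<close>

lemma compact_contact_id: "compact_contact id"
proof
  have "diffeomorphism id"
    by (simp add: diffeomorphism_def id_def inv_id[unfolded id_def] smooth_on_id bij_id[unfolded id_def])
  then show "contact_diffeomorphism id"
    by (simp add: contact_diffeomorphism_def)
qed simp

lemma id_values:
  "ruling id q = (snd q, 1, 0)" "crossing id q = 1 + (fst q)\<^sup>2 / 2" "across id q = 0"
proof -
  show "crossing id q = 1 + (fst q)\<^sup>2 / 2"
    unfolding crossing_def by (simp add: contact_form_crossing)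
qed (simp_all add: ruling_def across_def saddle_point_def)

lemma along_speed_id: "along_speed id q = 1 + (snd q)\<^sup>2"
  by (simp add: along_speed_def id_values power2_eq_square add.commute)

text \<open>For the unperturbed surface the ruling is parallel to (c, 1) and \<open>across\<close>
  vanishes, so neither inequality in \<open>area_density_ge_null_density\<close> loses anything.
  This equality makes the comparison sharp.\<close>

lemma area_density_id: "area_density id q = null_density id q"
proof -
  have "area_density id q = (1 + (fst q)\<^sup>2 / 2) * sqrt (1 + (snd q)\<^sup>2)"
    by (simp add: area_density_def id_values hnorm_def add.commute)
  also have "sqrt (1 + (snd q)\<^sup>2) = (1 + (snd q)\<^sup>2) / sqrt (1 + (snd q)\<^sup>2)"
    by (simp add: real_div_sqrt)
  also have "(1 + (fst q)\<^sup>2 / 2) * ((1 + (snd q)\<^sup>2) / sqrt (1 + (snd q)\<^sup>2)) = null_density id q"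
    by (simp add: null_density_def along_speed_id id_values slope_weight_def)
  finally show ?thesis .
qed

context compact_contact
begin

lemma compact_parameters: "compact (snd ` closure {p. \<Phi> p \<noteq> p})"
  by (intro compact_continuous_image continuous_intros compact_support)

lemma off_parameters:
  assumes "q \<notin> snd ` closure {p. \<Phi> p \<noteq> p}"
  shows "saddle_point q \<notin> closure {p. \<Phi> p \<noteq> p}"
proof
  assume "saddle_point q \<in> closure {p. \<Phi> p \<noteq> p}"
  then have "snd (saddle_point q) \<in> snd ` closure {p. \<Phi> p \<noteq> p}" by (rule imageI)
  then show False using assms unfolding saddle_point_def snd_conv by contradiction
qed

text \<open>The potentials themselves do not have compact support, but their differences from those
  of the identity do, so the divergence of the differences integrates to 0.\<close>

lemma integral_null_density:
  "(LINT q|lborel. null_density \<Phi> q - null_density id q) = 0" "integrable lborel (\<lambda>q. null_density \<Phi> q - null_density id q)"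
proof -
  interpret I: compact_contact id by (rule compact_contact_id)
  let ?K = "snd ` closure {p. \<Phi> p \<noteq> p}"
  define u where "u q = ruling_potential \<Phi> q - ruling_potential id q" for q
  define v where "v q = crossing_potential \<Phi> q - crossing_potential id q" for q
  have s: "smooth_on UNIV u" "smooth_on UNIV v"
    unfolding u_def[abs_def] v_def[abs_def] by (intro smooth_intros smooth_potentials I.smooth_potentials open_UNIV)+
  have uv0: "u q = 0" "v q = 0" if "q \<notin> ?K" for q
    using off_support_eq[OF off_parameters[OF that]]
    by (simp_all add: u_def v_def ruling_potential_def crossing_potential_def along_def across_def across_slope_def across_speed_def)
  have du: "frechet_derivative u (at q) w = frechet_derivative (ruling_potential \<Phi>) (at q) w - frechet_derivative (ruling_potential id) (at q) w" for q w
    unfolding u_def[abs_def] frechet_derivative_eqI[OF has_derivative_diff[OF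
      smooth_on_has_derivative[OF smooth_potentials(1) UNIV_I] smooth_on_has_derivative[OF I.smooth_potentials(1) UNIV_I]]] ..
  have dv: "frechet_derivative v (at q) w = frechet_derivative (crossing_potential \<Phi>) (at q) w - frechet_derivative (crossing_potential id) (at q) w" for q w
    unfolding v_def[abs_def] frechet_derivative_eqI[OF has_derivative_diff[OF
      smooth_on_has_derivative[OF smooth_potentials(2) UNIV_I] smooth_on_has_derivative[OF I.smooth_potentials(2) UNIV_I]]] ..
  have eq: "null_density \<Phi> q - null_density id q = frechet_derivative u (at q) (1, 0) - frechet_derivative v (at q) (0, 1)" for q
    unfolding du dv null_density_divergence[symmetric] I.null_density_divergence[symmetric] by simp
  have int0: "(LINT q|lborel. frechet_derivative f (at q) w) = 0" "integrable lborel (\<lambda>q. frechet_derivative f (at q) w)"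
    if "smooth_on UNIV f" "\<And>q. q \<notin> ?K \<Longrightarrow> f q = 0" for f :: "real \<times> real \<Rightarrow> real" and w
  proof -
    have c: "continuous_on UNIV (\<lambda>q. frechet_derivative f (at q) w)"
      by (rule smooth_on_continuous_on[OF smooth_on_frechet_derivative[OF that(1)]])
    show "(LINT q|lborel. frechet_derivative f (at q) w) = 0"
      by (rule integral_directional_derivative_eq_0[OF smooth_on_continuous_on[OF that(1)] c
        smooth_on_line_derivative[OF that(1)] compact_parameters]) (rule that(2))
    show "integrable lborel (\<lambda>q. frechet_derivative f (at q) w)"
      by (rule continuous_compact_support_integrable[OF c compact_parameters])
        (use frechet_derivative_zero_off_compact[OF compact_parameters, of f] that(2) in simp)
  qed
  have i: "(LINT q|lborel. frechet_derivative u (at q) (1, 0)) = 0" "integrable lborel (\<lambda>q. frechet_derivative u (at q) (1, 0))"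
    by (rule int0, rule s, rule uv0, assumption)+
  have j: "(LINT q|lborel. frechet_derivative v (at q) (0, 1)) = 0" "integrable lborel (\<lambda>q. frechet_derivative v (at q) (0, 1))"
    by (rule int0, rule s, rule uv0, assumption)+
  show "(LINT q|lborel. null_density \<Phi> q - null_density id q) = 0" "integrable lborel (\<lambda>q. null_density \<Phi> q - null_density id q)"
    unfolding eq using i j by simp_all
qed

lemma area_density_difference:
  "integrable lborel (\<lambda>q. area_density \<Phi> q - area_density id q)"
  "q \<notin> snd ` closure {p. \<Phi> p \<noteq> p} \<Longrightarrow> area_density \<Phi> q = area_density id q"
proof -
  show 0: "area_density \<Phi> q = area_density id q" if "q \<notin> snd ` closure {p. \<Phi> p \<noteq> p}" for q
    using off_support_eq[OF off_parameters[OF that]] by (simp add: area_density_def)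
  interpret I: compact_contact id by (rule compact_contact_id)
  show "integrable lborel (\<lambda>q. area_density \<Phi> q - area_density id q)"
    by (rule continuous_compact_support_integrable[OF _ compact_parameters])
     (auto intro!: continuous_intros continuous_area_density smooth I.smooth simp: 0)
qed

text \<open>The calibration step: the null density bounds the area density from below, equals it for
  the identity, and has the same total as for the identity in the sense of
  \<open>integral_null_density\<close>.\<close>

lemma area_increase:
  assumes "\<And>q. along_speed \<Phi> q \<ge> 0"
  shows "(LINT q|lborel. area_density \<Phi> q - area_density id q) \<ge> 0"
proof -
  have "(LINT q|lborel. null_density \<Phi> q - null_density id q) \<le> (LINT q|lborel. area_density \<Phi> q - area_density id q)"
    by (intro integral_mono integral_null_density area_density_difference)
      (simp add: area_density_id area_density_ge_null_density[OF assms])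
  then show ?thesis by (simp add: integral_null_density)
qed

end

section \<open>The area along a contact variation\<close>

lemma image_area_twisted: "image_area \<Phi> twisted \<Omega> = perimeter (\<Phi> ` saddle) \<Omega>"
  by (simp add: image_area_def intrinsic_subgraph_twisted)

lemma norm_saddle_point_ge: "norm q \<le> norm (saddle_point q)"
  unfolding saddle_point_def by (rule norm_snd_le)

lemma open_saddle_parameters: "open \<Omega> \<Longrightarrow> open {q. saddle_point q \<in> \<Omega>}"
  using open_vimage[of \<Omega> saddle_point] continuous_saddle_point[OF continuous_on_id] by (simp add: vimage_def)

lemma image_area_bounded_finite:
  assumes "open \<Omega>" "bounded \<Omega>"
  shows "image_area id twisted \<Omega> < \<infinity>"
proof -
  interpret I: compact_contact id by (rule compact_contact_id)
  obtain R where R: "\<And>p. p \<in> \<Omega> \<Longrightarrow> norm p \<le> R"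
    using assms(2) unfolding bounded_iff by blast
  have c: "continuous_on UNIV (area_density id)" by (rule continuous_area_density[OF I.smooth])
  have [measurable]: "{q. saddle_point q \<in> \<Omega>} \<in> sets borel" "area_density id \<in> borel_measurable borel"
    using open_saddle_parameters[OF assms(1)] borel_measurable_continuous_onI[OF c] by auto
  have "integrable lborel (\<lambda>q. indicator (cball 0 R) q *\<^sub>R area_density id q)"
    by (rule borel_integrable_compact) (auto intro: continuous_on_subset[OF c])
  then have "integrable lborel (\<lambda>q. indicator {q. saddle_point q \<in> \<Omega>} q * area_density id q)"
  proof (rule Bochner_Integration.integrable_bound)
    show "AE q in lborel. norm (indicator {q. saddle_point q \<in> \<Omega>} q * area_density id q) \<le>
      norm (indicator (cball 0 R) q *\<^sub>R area_density id q)"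
    proof (rule AE_I2)
      fix q
      have "saddle_point q \<in> \<Omega> \<Longrightarrow> q \<in> cball 0 R"
        using R[of "saddle_point q"] norm_saddle_point_ge[of q] by simp
      then show "norm (indicator {q. saddle_point q \<in> \<Omega>} q * area_density id q) \<le>
        norm (indicator (cball 0 R) q *\<^sub>R area_density id q)" by (auto simp: indicator_def)
    qed
  qed simp
  from I.perimeter_eq_integral(1)[OF assms(1) _ this] show ?thesis
    by (simp add: image_area_twisted)
qed

lemma lborel_integral_cbox:
  fixes f :: "'a::euclidean_space \<Rightarrow> real"
  assumes "continuous_on UNIV f" "\<And>x. x \<notin> cbox a b \<Longrightarrow> f x = 0"
  shows "(LINT x|lborel. f x) = integral (cbox a b) f"
proof -
  have i: "set_integrable lborel (cbox a b) f"
    unfolding set_integrable_def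
    by (rule borel_integrable_compact) (auto intro: continuous_on_subset[OF assms(1)])
  have eq: "(\<lambda>x. indicator (cbox a b) x *\<^sub>R f x) = f"
  proof
    show "indicator (cbox a b) x *\<^sub>R f x = f x" for x
      using assms(2)[of x] by (cases "x \<in> cbox a b") simp_all
  qed
  show ?thesis
    using set_borel_integral_eq_integral(2)[OF i] unfolding set_lebesgue_integral_def eq .
qed

lemma contact_variation_compact_contact:
  assumes "contact_variation \<Omega> I \<Phi>" "\<epsilon> \<in> I"
  shows "compact_contact (\<Phi> \<epsilon>)" "closure {p. \<Phi> \<epsilon> p \<noteq> p} \<subseteq> \<Omega>"
  using assms by (auto simp: contact_variation_def compact_contact_def compactly_in_def)

text \<open>The common bound on the moved points gives one parameter box for all \<epsilon>. It
  allows both differentiation under the integral and a choice of small \<epsilon> that is uniform in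
  the parameters.\<close>

lemma contact_variation_support:
  assumes "contact_variation \<Omega> I \<Phi>"
  obtains a b :: "real \<times> real" where "\<And>\<epsilon> q. \<epsilon> \<in> I \<Longrightarrow> q \<notin> cbox a b \<Longrightarrow> saddle_point q \<notin> closure {p. \<Phi> \<epsilon> p \<noteq> p}"
proof -
  have "bounded (\<Union>\<epsilon>\<in>I. {p. \<Phi> \<epsilon> p \<noteq> p})" using assms by (simp add: contact_variation_def)
  then obtain R where R: "\<And>p. p \<in> (\<Union>\<epsilon>\<in>I. {p. \<Phi> \<epsilon> p \<noteq> p}) \<Longrightarrow> norm p \<le> R"
    unfolding bounded_iff by blast
  show ?thesis
  proof (rule that[of "(- R, - R)" "(R, R)"])
    fix \<epsilon> and q :: "real \<times> real"
    assume "\<epsilon> \<in> I" and q: "q \<notin> cbox (- R, - R) (R, R)"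
    have "{p. \<Phi> \<epsilon> p \<noteq> p} \<subseteq> cball 0 R"
    proof
      fix p assume "p \<in> {p. \<Phi> \<epsilon> p \<noteq> p}"
      then have "p \<in> (\<Union>\<epsilon>\<in>I. {p. \<Phi> \<epsilon> p \<noteq> p})" using \<open>\<epsilon> \<in> I\<close> by blast
      from R[OF this] show "p \<in> cball 0 R" by simp
    qed
    then have "closure {p. \<Phi> \<epsilon> p \<noteq> p} \<subseteq> cball 0 R"
      by (rule closure_minimal) simp
    moreover have "norm q > R"
    proof (rule ccontr)
      assume "\<not> norm q > R"
      then have "\<bar>fst q\<bar> \<le> R" "\<bar>snd q\<bar> \<le> R"
        using norm_fst_le[of "fst q" "snd q"] norm_snd_le[of "snd q" "fst q"] by simp_all
      then show False using q by (cases q) (auto simp: cbox_Pair_eq)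
    qed
    then have "saddle_point q \<notin> cball 0 R" using norm_saddle_point_ge[of q] by simp
    ultimately show "saddle_point q \<notin> closure {p. \<Phi> \<epsilon> p \<noteq> p}" by blast
  qed
qed

lemma contact_variation_area:
  assumes \<Omega>: "open \<Omega>" "image_area id twisted \<Omega> < \<infinity>" and var: "contact_variation \<Omega> I \<Phi>"
    and supp: "\<And>\<epsilon> q. \<epsilon> \<in> I \<Longrightarrow> q \<notin> cbox a b \<Longrightarrow> saddle_point q \<notin> closure {p. \<Phi> \<epsilon> p \<noteq> p}"
  obtains C where "\<And>\<epsilon>. \<epsilon> \<in> I \<Longrightarrow> image_area (\<Phi> \<epsilon>) twisted \<Omega> = ereal (C + integral (cbox a b) (area_density (\<Phi> \<epsilon>)))"
    "\<And>\<epsilon>. \<epsilon> \<in> I \<Longrightarrow> (LINT q|lborel. area_density (\<Phi> \<epsilon>) q - area_density id q) =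
      integral (cbox a b) (area_density (\<Phi> \<epsilon>)) - integral (cbox a b) (area_density id)"
proof -
  interpret I: compact_contact id by (rule compact_contact_id)
  let ?D = "\<lambda>\<Phi> q. indicator {q. saddle_point q \<in> \<Omega>} q * area_density \<Phi> q"
  have int0: "integrable lborel (?D id)"
    by (rule I.perimeter_eq_integral(2)[OF \<Omega>(1)]) (use \<Omega>(2) in \<open>simp_all add: image_area_twisted\<close>)
  \<comment> \<open>The box may reach outside \<Omega>, so \<open>C\<close> is a difference of two
    integrals and not necessarily an area. It does not depend on \<epsilon>, because \<Phi> changes
    the density only at parameters in the box whose surface point lies in \<Omega>.\<close>
  define C where "C = (LINT q|lborel. ?D id q) - integral (cbox a b) (area_density id)"
  have diff: "(LINT q|lborel. area_density (\<Phi> \<epsilon>) q - area_density id q) =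
      integral (cbox a b) (area_density (\<Phi> \<epsilon>)) - integral (cbox a b) (area_density id)" if "\<epsilon> \<in> I" for \<epsilon>
  proof -
    interpret P: compact_contact "\<Phi> \<epsilon>" using contact_variation_compact_contact[OF var that] by simp
    have c: "continuous_on UNIV (area_density (\<Phi> \<epsilon>))" "continuous_on UNIV (area_density id)"
      by (intro continuous_area_density P.smooth I.smooth)+
    have "area_density (\<Phi> \<epsilon>) q - area_density id q = 0" if "q \<notin> cbox a b" for q
      using P.off_support_eq[OF supp[OF \<open>\<epsilon> \<in> I\<close> that]] by (simp add: area_density_def)
    then have "(LINT q|lborel. area_density (\<Phi> \<epsilon>) q - area_density id q) =
      integral (cbox a b) (\<lambda>q. area_density (\<Phi> \<epsilon>) q - area_density id q)"
      by (intro lborel_integral_cbox continuous_intros c)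
    also have "\<dots> = integral (cbox a b) (area_density (\<Phi> \<epsilon>)) - integral (cbox a b) (area_density id)"
      by (intro Henstock_Kurzweil_Integration.integral_diff integrable_continuous continuous_on_subset[OF c(1)] continuous_on_subset[OF c(2)]) auto
    finally show ?thesis .
  qed
  have "image_area (\<Phi> \<epsilon>) twisted \<Omega> = ereal (C + integral (cbox a b) (area_density (\<Phi> \<epsilon>)))" if "\<epsilon> \<in> I" for \<epsilon>
  proof -
    interpret P: compact_contact "\<Phi> \<epsilon>" using contact_variation_compact_contact[OF var that] by simp
    have sub: "closure {p. \<Phi> \<epsilon> p \<noteq> p} \<subseteq> \<Omega>" by (rule contact_variation_compact_contact[OF var that])
    have eq: "?D (\<Phi> \<epsilon>) = (\<lambda>q. ?D id q + (area_density (\<Phi> \<epsilon>) q - area_density id q))"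
    proof
      fix q
      show "?D (\<Phi> \<epsilon>) q = ?D id q + (area_density (\<Phi> \<epsilon>) q - area_density id q)"
      proof (cases "saddle_point q \<in> \<Omega>")
        case False
        then have "saddle_point q \<notin> closure {p. \<Phi> \<epsilon> p \<noteq> p}" using sub by blast
        note P.off_support_eq[OF this]
        then have "area_density (\<Phi> \<epsilon>) q = area_density id q" by (simp add: area_density_def)
        then show ?thesis using False by simp
      qed simp
    qed
    have "integrable lborel (?D (\<Phi> \<epsilon>))"
      unfolding eq by (intro Bochner_Integration.integrable_add int0 P.area_density_difference)
    from P.perimeter_eq_integral(1)[OF \<Omega>(1) sub this]
    have "image_area (\<Phi> \<epsilon>) twisted \<Omega> = ereal (LINT q|lborel. ?D (\<Phi> \<epsilon>) q)" by (simp add: image_area_twisted)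
    also have "(LINT q|lborel. ?D (\<Phi> \<epsilon>) q) = (LINT q|lborel. ?D id q) + (LINT q|lborel. area_density (\<Phi> \<epsilon>) q - area_density id q)"
      unfolding eq by (intro Bochner_Integration.integral_add int0 P.area_density_difference)
    finally show ?thesis by (simp add: diff[OF that] C_def)
  qed
  then show ?thesis using diff that by blast
qed

lemma smooth_family_integral_derivative:
  fixes G :: "real \<times> 'a::euclidean_space \<Rightarrow> real"
  assumes "open I" "is_interval I" and G: "smooth_on (I \<times> UNIV) G" and "\<epsilon> \<in> I"
  shows "((\<lambda>\<epsilon>. integral (cbox a b) (\<lambda>q. G (\<epsilon>, q))) has_real_derivative
    integral (cbox a b) (\<lambda>q. frechet_derivative G (at (\<epsilon>, q)) (1, 0))) (at \<epsilon>)"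
proof -
  have op: "open (I \<times> (UNIV :: 'a set))" using assms(1) by (simp add: open_Times)
  have "((\<lambda>\<epsilon>. integral (cbox a b) (\<lambda>q. G (\<epsilon>, q))) has_real_derivative
    integral (cbox a b) (\<lambda>q. frechet_derivative G (at (\<epsilon>, q)) (1, 0))) (at \<epsilon> within I)"
  proof (rule leibniz_rule_field_derivative[where f="\<lambda>\<epsilon> q. G (\<epsilon>, q)" and fx="\<lambda>\<epsilon> q. frechet_derivative G (at (\<epsilon>, q)) (1, 0)"])
    show "((\<lambda>\<epsilon>. G (\<epsilon>, q)) has_real_derivative frechet_derivative G (at (\<epsilon>, q)) (1, 0)) (at \<epsilon> within I)"
      if "\<epsilon> \<in> I" for \<epsilon> q
      using Ck_on_1_line_derivative[OF op smooth_on_imp_Ck_on[OF G], of "(0, q)" \<epsilon> "(1, 0)"] that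
      by (auto simp: has_real_derivative_iff_has_vector_derivative intro: has_vector_derivative_at_within)
    show "(\<lambda>q. G (\<epsilon>, q)) integrable_on cbox a b" if "\<epsilon> \<in> I" for \<epsilon>
      by (rule integrable_continuous, rule continuous_on_compose2[OF smooth_on_continuous_on[OF G]])
        (use that in \<open>auto intro!: continuous_intros\<close>)
    show "continuous_on (I \<times> cbox a b) (\<lambda>(\<epsilon>, q). frechet_derivative G (at (\<epsilon>, q)) (1, 0))"
      using continuous_on_subset[OF smooth_on_continuous_on[OF smooth_on_frechet_derivative[OF G]], of "I \<times> cbox a b" "(1, 0)"]
      by (simp add: case_prod_unfold Sigma_mono)
  qed (use assms is_interval_convex in auto)
  then show ?thesis using at_within_open[OF assms(4,1)] by simp
qed

text \<open>The derivative of each \<Phi> \<epsilon> is a partial derivative of the joint map, in a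
  direction (0, v), and hence smooth in \<epsilon> as well. The square root in the density causes no
  loss of smoothness because the ruling never degenerates.\<close>

lemma contact_variation_family:
  assumes var: "contact_variation \<Omega> I \<Phi>"
  shows "smooth_on (I \<times> UNIV) (\<lambda>x. area_density (\<Phi> (fst x)) (snd x))"
    and "continuous_on (I \<times> UNIV) (\<lambda>x. along_speed (\<Phi> (fst x)) (snd x))"
proof -
  define \<Psi> where "\<Psi> = (\<lambda>(\<epsilon>, p). \<Phi> \<epsilon> p)"
  have "open I" and \<Psi>s: "smooth_on (I \<times> UNIV) \<Psi>" using var by (auto simp: contact_variation_def \<Psi>_def)
  have ops: "open (I \<times> (UNIV :: (real \<times> real) set))" "open (I \<times> (UNIV :: heis set))"
    using \<open>open I\<close> by (simp_all add: open_Times)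
  define F where "F v x = frechet_derivative \<Psi> (at (fst x, saddle_point (snd x))) (0, v)" for v and x :: "real \<times> real \<times> real"
  define P where "P x = \<Psi> (fst x, saddle_point (snd x))" for x :: "real \<times> real \<times> real"
  have msp: "smooth_on (I \<times> UNIV) (\<lambda>x::real \<times> real \<times> real. (fst x, saddle_point (snd x)))"
    unfolding saddle_point_def by (intro smooth_intros ops)
  have Fs: "smooth_on (I \<times> UNIV) (F v)" for v
    unfolding F_def[abs_def]
    by (rule smooth_on_compose[OF ops _ smooth_on_frechet_derivative[OF \<Psi>s] msp]) auto
  have Ps: "smooth_on (I \<times> UNIV) P"
    unfolding P_def[abs_def] by (rule smooth_on_compose[OF ops _ \<Psi>s msp]) auto
  define ru where "ru x = snd (snd x) *\<^sub>R F (1, 0, 0) x + F (0, 1, 0) x" for x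
  define cr where "cr x = fst (snd x) *\<^sub>R F (1, 0, 0) x + F (0, 0, 1) x" for x
  have rs: "smooth_on (I \<times> UNIV) ru" "smooth_on (I \<times> UNIV) cr"
    unfolding ru_def[abs_def] cr_def[abs_def] by (intro smooth_intros Fs ops)+
  have der: "frechet_derivative (\<Phi> (fst x)) (at (saddle_point (snd x))) v = F v x" if "x \<in> I \<times> UNIV" for x v
  proof -
    have "((\<lambda>p. \<Psi> (fst x, p)) has_derivative (\<lambda>v. frechet_derivative \<Psi> (at (fst x, saddle_point (snd x))) (0, v))) (at (saddle_point (snd x)))"
      by (rule has_derivative_compose[OF _ smooth_on_has_derivative[OF \<Psi>s]])
        (use that in \<open>auto intro!: derivative_eq_intros\<close>)
    from frechet_derivative_eqI[OF this] show ?thesis by (simp add: F_def \<Psi>_def)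
  qed
  have ruling: "ruling (\<Phi> (fst x)) (snd x) = ru x" and crossing: "crossing (\<Phi> (fst x)) (snd x) = contact_form (P x) (cr x)"
    and pos: "hnorm (ru x) > 0" if x: "x \<in> I \<times> UNIV" for x
  proof -
    interpret C: compact_contact "\<Phi> (fst x)"
      by (rule contact_variation_compact_contact[OF var]) (use x in auto)
    note lin = linear_expand_heis[OF diffeomorphism_linear[OF C.diff]]
    show r: "ruling (\<Phi> (fst x)) (snd x) = ru x"
      unfolding ruling_def lin[of _ "snd (snd x)"] ru_def der[OF x, symmetric] by simp
    show "crossing (\<Phi> (fst x)) (snd x) = contact_form (P x) (cr x)"
      unfolding crossing_def lin[of _ "fst (snd x)"] cr_def der[OF x, symmetric] P_def \<Psi>_def by simp
    show "hnorm (ru x) > 0" using C.ruling_pos[of "snd x"] by (simp add: r)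
  qed
  have "smooth_on (I \<times> UNIV) (\<lambda>x. (snd (snd (cr x)) - (fst (P x) * fst (snd (cr x)) - fst (snd (P x)) * fst (cr x)) * (1/2)) *
     sqrt ((fst (ru x))\<^sup>2 + (fst (snd (ru x)))\<^sup>2))"
    by (intro smooth_intros rs Ps ops) (use pos in \<open>simp only: hnorm_def case_prod_unfold real_sqrt_gt_0_iff\<close>)
  then show "smooth_on (I \<times> UNIV) (\<lambda>x. area_density (\<Phi> (fst x)) (snd x))"
    by (rule smooth_on_cong[OF ops(1), rotated])
      (simp add: area_density_def ruling crossing contact_form_def hnorm_def case_prod_unfold)
  have "continuous_on (I \<times> UNIV) (\<lambda>x. snd (snd x) * fst (ru x) + fst (snd (ru x)))"
    by (intro continuous_intros smooth_on_continuous_on[OF rs(1)])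
  then show "continuous_on (I \<times> UNIV) (\<lambda>x. along_speed (\<Phi> (fst x)) (snd x))"
    by (simp add: along_speed_def ruling cong: continuous_on_cong)
qed

text \<open>At \<epsilon> = 0 the speed is 1 + c^2 > 0. The tube lemma over the compact box gives
  one neighbourhood of 0 that works for all parameters in the box, and outside the box nothing
  moves.\<close>

lemma contact_variation_along_speed:
  assumes var: "contact_variation \<Omega> I \<Phi>"
    and supp: "\<And>\<epsilon> q. \<epsilon> \<in> I \<Longrightarrow> q \<notin> cbox a b \<Longrightarrow> saddle_point q \<notin> closure {p. \<Phi> \<epsilon> p \<noteq> p}"
  shows "\<forall>\<^sub>F \<epsilon> in nhds 0. \<epsilon> \<in> I \<and> (\<forall>q. along_speed (\<Phi> \<epsilon>) q \<ge> 0)"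
proof -
  have I: "open I" "0 \<in> I" "\<Phi> 0 = id" using var by (auto simp: contact_variation_def)
  have op: "open (I \<times> (UNIV :: (real \<times> real) set))" using I(1) by (simp add: open_Times)
  define W where "W = (I \<times> UNIV) \<inter> (\<lambda>x. along_speed (\<Phi> (fst x)) (snd x)) -` {0<..}"
  have "open W"
    unfolding W_def using contact_variation_family(2)[OF var] op by (rule continuous_open_preimage) simp
  moreover have "{0} \<times> cbox a b \<subseteq> W"
    using I by (auto simp: W_def along_speed_id one_plus_square_pos)
  ultimately obtain X where X: "0 \<in> X" "open X" "X \<times> cbox a b \<subseteq> W"
    using Elementary_Topology.tube_lemma[OF compact_cbox, of W 0 a b] by blast
  have "along_speed (\<Phi> \<epsilon>) q \<ge> 0" if "\<epsilon> \<in> X \<inter> I" for \<epsilon> q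
  proof (cases "q \<in> cbox a b")
    case True
    then have "(\<epsilon>, q) \<in> W" using X(3) that by blast
    then show ?thesis by (simp add: W_def)
  next
    case False
    interpret C: compact_contact "\<Phi> \<epsilon>"
      by (rule contact_variation_compact_contact[OF var]) (use that in auto)
    have "along_speed (\<Phi> \<epsilon>) q = along_speed id q"
      using C.off_support_eq(2)[OF supp[of \<epsilon>, OF _ False]] that by (simp add: along_speed_def)
    then show ?thesis using one_plus_square_pos[of "snd q"] by (simp add: along_speed_id)
  qed
  moreover have "\<forall>\<^sub>F \<epsilon> in nhds 0. \<epsilon> \<in> X \<inter> I"
    using X I by (intro eventually_nhds_in_open) auto
  ultimately show ?thesis by (auto elim!: eventually_mono)
qed

text \<open>If \<open>D\<close> were negative, \<open>A'\<close> would be negative just to the right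
  of \<open>a\<close>, and by the mean value theorem \<open>A\<close> would drop below its
  minimum.\<close>

lemma second_derivative_nonneg_at_local_min:
  fixes A A' :: "real \<Rightarrow> real"
  assumes d: "\<forall>\<^sub>F x in nhds a. (A has_real_derivative A' x) (at x)" and D: "(A' has_real_derivative D) (at a)"
    and min: "\<forall>\<^sub>F x in nhds a. A a \<le> A x"
  shows "A' a = 0" "D \<ge> 0"
proof -
  obtain e where e: "e > 0" "\<And>x. \<bar>x - a\<bar> < e \<Longrightarrow> (A has_real_derivative A' x) (at x) \<and> A a \<le> A x"
    using eventually_conj[OF d min] unfolding eventually_nhds_metric dist_real_def by blast
  have "(A has_real_derivative A' a) (at a)" using e by simp
  from DERIV_local_min[OF this e(1)] show A'0: "A' a = 0"
    using e(2) by (simp add: abs_minus_commute)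
  show "D \<ge> 0"
  proof (rule ccontr)
    assume "\<not> D \<ge> 0"
    then obtain r where r: "r > 0" "\<And>h. 0 < h \<Longrightarrow> h < r \<Longrightarrow> A' (a + h) < A' a"
      using DERIV_neg_dec_right[OF D] by force
    define h where "h = min e r / 2"
    have h: "0 < h" "h < e" "h < r" using e(1) r(1) by (auto simp: h_def min_def)
    obtain z where z: "a < z" "z < a + h" "A (a + h) - A a = (a + h - a) * A' z"
      using MVT2[of a "a + h" A A'] h e(2) by auto
    have "A' z < 0" using r(2)[of "z - a"] z h A'0 by simp
    then have "h * A' z < 0" by (rule mult_pos_neg[OF h(1)])
    then have "A (a + h) < A a" using z(3) by simp
    then show False using e(2)[of "a + h"] h by simp
  qed
qed

theorem twisted_contact_stable:
  assumes \<Omega>: "open \<Omega>" "image_area id twisted \<Omega> < \<infinity>" and var: "contact_variation \<Omega> I \<Phi>"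
  shows "\<exists>A D. (\<forall>\<epsilon>\<in>I. image_area (\<Phi> \<epsilon>) twisted \<Omega> = ereal (A \<epsilon>)) \<and>
           (A has_real_derivative 0) (at 0) \<and>
           (\<forall>\<^sub>F \<epsilon> in nhds 0. A differentiable (at \<epsilon>)) \<and>
           (deriv A has_real_derivative D) (at 0) \<and> D \<ge> 0"
proof -
  have I: "open I" "is_interval I" "0 \<in> I" "\<Phi> 0 = id" using var by (auto simp: contact_variation_def)
  obtain a b where supp: "\<And>\<epsilon> q. \<epsilon> \<in> I \<Longrightarrow> q \<notin> cbox a b \<Longrightarrow> saddle_point q \<notin> closure {p. \<Phi> \<epsilon> p \<noteq> p}"
    using contact_variation_support[OF var] by blast
  obtain C where C: "\<And>\<epsilon>. \<epsilon> \<in> I \<Longrightarrow> image_area (\<Phi> \<epsilon>) twisted \<Omega> = ereal (C + integral (cbox a b) (area_density (\<Phi> \<epsilon>)))"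
    "\<And>\<epsilon>. \<epsilon> \<in> I \<Longrightarrow> (LINT q|lborel. area_density (\<Phi> \<epsilon>) q - area_density id q) =
      integral (cbox a b) (area_density (\<Phi> \<epsilon>)) - integral (cbox a b) (area_density id)"
    using contact_variation_area[OF \<Omega> var supp] by blast
  define G where "G x = area_density (\<Phi> (fst x)) (snd x)" for x
  have Gs: "smooth_on (I \<times> UNIV) G" unfolding G_def[abs_def] by (rule contact_variation_family[OF var])
  define G' where "G' x = frechet_derivative G (at x) (1, 0)" for x
  have G's: "smooth_on (I \<times> UNIV) G'" unfolding G'_def[abs_def] by (rule smooth_on_frechet_derivative[OF Gs])
  define A where "A \<epsilon> = C + integral (cbox a b) (\<lambda>q. G (\<epsilon>, q))" for \<epsilon>
  define A' where "A' \<epsilon> = integral (cbox a b) (\<lambda>q. G' (\<epsilon>, q))" for \<epsilon>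
  define D where "D = integral (cbox a b) (\<lambda>q. frechet_derivative G' (at (0, q)) (1, 0))"
  have A': "(A has_real_derivative A' \<epsilon>) (at \<epsilon>)" if "\<epsilon> \<in> I" for \<epsilon>
    unfolding A_def[abs_def] A'_def G'_def
    using DERIV_add[OF DERIV_const smooth_family_integral_derivative[OF I(1,2) Gs that], of C] by simp
  have D: "(A' has_real_derivative D) (at 0)"
    unfolding A'_def[abs_def] D_def by (rule smooth_family_integral_derivative[OF I(1,2) G's I(3)])
  have evI: "\<forall>\<^sub>F \<epsilon> in nhds 0. \<epsilon> \<in> I" using I by (intro eventually_nhds_in_open)
  have evA': "\<forall>\<^sub>F \<epsilon> in nhds 0. (A has_real_derivative A' \<epsilon>) (at \<epsilon>)"
    using evI by (rule eventually_mono) (rule A')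
  have min: "\<forall>\<^sub>F \<epsilon> in nhds 0. A 0 \<le> A \<epsilon>"
    using contact_variation_along_speed[OF var supp]
  proof (rule eventually_mono)
    fix \<epsilon> assume \<epsilon>: "\<epsilon> \<in> I \<and> (\<forall>q. along_speed (\<Phi> \<epsilon>) q \<ge> 0)"
    then interpret P: compact_contact "\<Phi> \<epsilon>" using contact_variation_compact_contact[OF var] by blast
    have "A \<epsilon> - A 0 = (LINT q|lborel. area_density (\<Phi> \<epsilon>) q - area_density id q)"
      using C(2)[of \<epsilon>] \<epsilon> by (simp add: A_def G_def I(4))
    also have "\<dots> \<ge> 0" by (intro P.area_increase conjunct2[OF \<epsilon>, THEN spec])
    finally show "A 0 \<le> A \<epsilon>" by simp
  qed
  note test = second_derivative_nonneg_at_local_min[OF evA' D min]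
  have "(deriv A has_real_derivative D) (at 0)"
    by (rule has_field_derivative_transform_within_open[OF D I(1,3)]) (simp add: DERIV_imp_deriv[OF A'])
  moreover have "\<forall>\<^sub>F \<epsilon> in nhds 0. A differentiable (at \<epsilon>)"
    using evA' by (rule eventually_mono) (auto simp: real_differentiable_def)
  moreover have "(A has_real_derivative 0) (at 0)" using A'[OF I(3)] test(1) by simp
  moreover have "\<forall>\<epsilon>\<in>I. image_area (\<Phi> \<epsilon>) twisted \<Omega> = ereal (A \<epsilon>)"
    using C(1) by (simp add: A_def G_def)
  ultimately show ?thesis using test(2) by blast
qed

section \<open>A competitor of smaller perimeter\<close>

text \<open>A cutoff of class C^1 is enough for a competitor, and composed with polynomials it stays
  piecewise polynomial, so that its integrals can be evaluated exactly.\<close>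

definition pos_square :: "real \<Rightarrow> real" where
  "pos_square x = (max 0 x)\<^sup>2"

lemma pos_square_has_derivative: "(pos_square has_real_derivative 2 * max 0 x) (at x)"
proof (rule linorder_cases[of x 0])
  assume "x < 0"
  have "((\<lambda>x. 0) has_real_derivative 0) (at x)" by simp
  then have "(pos_square has_real_derivative 0) (at x)"
    by (rule has_field_derivative_transform_within_open[of _ _ _ "{..<0}"])
      (use \<open>x < 0\<close> in \<open>auto simp: pos_square_def\<close>)
  then show ?thesis using \<open>x < 0\<close> by simp
next
  assume "x > 0"
  have "((\<lambda>x. x\<^sup>2) has_real_derivative 2 * x) (at x)" by (auto intro!: derivative_eq_intros)
  then have "(pos_square has_real_derivative 2 * x) (at x)"
    by (rule has_field_derivative_transform_within_open[of _ _ _ "{0<..}"])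
      (use \<open>x > 0\<close> in \<open>auto simp: pos_square_def\<close>)
  then show ?thesis using \<open>x > 0\<close> by simp
next
  assume [simp]: "x = 0"
  have "((\<lambda>h. pos_square h / h) \<longlongrightarrow> 0) (at 0)"
  proof (rule Lim_null_comparison)
    show "\<forall>\<^sub>F h in at 0. norm (pos_square h / h) \<le> \<bar>h\<bar>"
      by (rule always_eventually) (auto simp: pos_square_def max_def power2_eq_square)
    show "((\<lambda>h::real. \<bar>h\<bar>) \<longlongrightarrow> 0) (at 0)" using tendsto_rabs[OF tendsto_ident_at[of 0 UNIV]] by simp
  qed
  then show ?thesis by (simp add: DERIV_def pos_square_def)
qed

lemma Ck_on_pos_square:
  assumes "open S" "Ck_on 1 S f"
  shows "Ck_on 1 S (\<lambda>x. pos_square (f x))"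
proof -
  have "Ck_on (Suc 0) UNIV pos_square"
    by (rule Ck_on_SucI[OF open_UNIV pos_square_has_derivative[unfolded has_field_derivative_def]])
      (auto intro!: continuous_intros)
  then have "Ck_on 1 UNIV pos_square" by simp
  from Ck_on_compose[OF assms(1) open_UNIV _ this assms(2)] show ?thesis by simp
qed

lemma continuous_pos_square [continuous_intros]:
  "continuous_on S f \<Longrightarrow> continuous_on S (\<lambda>x. pos_square (f x))"
  unfolding pos_square_def by (intro continuous_intros)

text \<open>\<open>P\<close> and \<open>- Q\<close> below are the components of the horizontal normal of the graph \<open>x = g (y, z)\<close>.\<close>

lemma perimeter_graph_le:
  fixes g :: "real \<times> real \<Rightarrow> real"
  assumes g: "Ck_on 1 UNIV g"
  defines "P \<equiv> \<lambda>q. 1 + fst q * frechet_derivative g (at q) (0, 1) / 2"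
    and "Q \<equiv> \<lambda>q. frechet_derivative g (at q) (1, 0) + g q * frechet_derivative g (at q) (0, 1) / 2"
  assumes int: "integrable lborel (\<lambda>q. indicator {q. (g q, q) \<in> \<Omega>} q * sqrt ((P q)\<^sup>2 + (Q q)\<^sup>2))"
  shows "perimeter {p. fst p \<le> g (snd p)} \<Omega> \<le>
    ereal (LINT q|lborel. indicator {q. (g q, q) \<in> \<Omega>} q * sqrt ((P q)\<^sup>2 + (Q q)\<^sup>2))"
  unfolding perimeter_def
proof (rule SUP_least)
  fix V assume "V \<in> test_fields \<Omega>"
  then have V: "smooth_on UNIV V" "\<And>p. V p \<in> horizontal p" "compact (closure {p. V p \<noteq> 0})" "closure {p. V p \<noteq> 0} \<subseteq> \<Omega>"
    "\<And>p. hnorm (V p) \<le> 1"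
    by (auto simp: test_fields_def compactly_in_def)
  interpret I: compact_contact id by (rule compact_contact_id)
  let ?E = "{p. fst p \<le> g (snd p)}"
  have gc: "continuous_on UNIV g" using Ck_on_mono[OF g, of 0] by simp
  have closed: "closed ?E"
    by (intro closed_Collect_le continuous_intros continuous_on_compose2[OF gc]) auto
  have "(LINT p:?E|lebesgue. divergence V p) = (LINT p|lborel. indicator ?E p * divergence V p)"
    by (rule set_lebesgue_integral_divergence[OF V(1) closed])
  also have "\<dots> = (LINT p|lborel. indicator (id ` ?E) p * divergence V p)" by simp
  also have "\<dots> = (LINT q|lborel. det3 (V (id (g q, q)))
      (frechet_derivative id (at (g q, q)) (frechet_derivative g (at q) (1, 0), 1, 0))
      (frechet_derivative id (at (g q, q)) (frechet_derivative g (at q) (0, 1), 0, 1)))"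
    by (rule diffeo_graph_flux[OF I.diff I.jac_pos g smooth_on_imp_Ck_on[OF V(1)] V(3)])
      (use not_in_closure_Collect in fastforce)
  also have "\<dots> = (LINT q|lborel. fst (V (g q, q)) * P q - fst (snd (V (g q, q))) * Q q)"
  proof (rule Bochner_Integration.integral_cong[OF refl])
    fix q
    obtain v1 v2 v3 where v: "V (g q, q) = (v1, v2, v3)" by (metis prod.exhaust)
    have v3: "v3 = (g q * v2 - fst q * v1) / 2"
      using V(2)[of "(g q, q)"] by (simp add: horizontal_iff contact_form_def v)
    show "det3 (V (id (g q, q)))
      (frechet_derivative id (at (g q, q)) (frechet_derivative g (at q) (1, 0), 1, 0))
      (frechet_derivative id (at (g q, q)) (frechet_derivative g (at q) (0, 1), 0, 1)) =
      fst (V (g q, q)) * P q - fst (snd (V (g q, q))) * Q q"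
      unfolding det3_def id_apply v v3 fst_conv snd_conv P_def Q_def frechet_derivative_id by (simp add: field_simps)
  qed
  also have "\<dots> \<le> (LINT q|lborel. indicator {q. (g q, q) \<in> \<Omega>} q * sqrt ((P q)\<^sup>2 + (Q q)\<^sup>2))"
  proof (rule integral_mono_AE'[OF int]; rule AE_I2)
    fix q
    show "0 \<le> indicator {q. (g q, q) \<in> \<Omega>} q * sqrt ((P q)\<^sup>2 + (Q q)\<^sup>2)" by simp
    show "fst (V (g q, q)) * P q - fst (snd (V (g q, q))) * Q q \<le> indicator {q. (g q, q) \<in> \<Omega>} q * sqrt ((P q)\<^sup>2 + (Q q)\<^sup>2)"
    proof (cases "(g q, q) \<in> \<Omega>")
      case True
      obtain v1 v2 v3 where v: "V (g q, q) = (v1, v2, v3)" by (metis prod.exhaust)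
      have "v1 * P q - v2 * Q q = (v1, v2) \<bullet> (P q, - Q q)" by (simp add: inner_prod_def)
      also have "\<dots> \<le> norm (v1, v2) * norm (P q, - Q q)" by (rule norm_cauchy_schwarz)
      also have "\<dots> = hnorm (V (g q, q)) * sqrt ((P q)\<^sup>2 + (Q q)\<^sup>2)" by (simp add: v hnorm_def norm_Pair)
      also have "\<dots> \<le> 1 * sqrt ((P q)\<^sup>2 + (Q q)\<^sup>2)" by (intro mult_right_mono V(5)) simp
      finally show ?thesis using True by (simp add: v)
    next
      case False
      then have "V (g q, q) = 0" using V(4) not_in_closure_Collect[of "(g q, q)" "\<lambda>p. V p \<noteq> 0"] by blast
      then show ?thesis by simp
    qed
  qed
  finally show "ereal (LINT p:?E|lebesgue. divergence V p) \<le>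
    ereal (LINT q|lborel. indicator {q. (g q, q) \<in> \<Omega>} q * sqrt ((P q)\<^sup>2 + (Q q)\<^sup>2))" by simp
qed

section \<open>Expansion of the competitor's area and its second-order gain\<close>

lemma sqrt_sum_squares_le:
  assumes "P > 0"
  shows "sqrt (P\<^sup>2 + Q\<^sup>2) \<le> P * sqrt (1 + z\<^sup>2) + z / sqrt (1 + z\<^sup>2) * (Q - z * P) + (Q - z * P)\<^sup>2 / (2 * P)"
proof -
  define r where "r = sqrt (1 + z\<^sup>2)"
  have r: "r \<ge> 1" "r\<^sup>2 = 1 + z\<^sup>2" by (simp_all add: r_def)
  define X where "X = Q - z * P"
  have t: "P * r > 0" using assms r by simp
  have "0 \<le> (sqrt (P\<^sup>2 + Q\<^sup>2) - P * r)\<^sup>2" by simp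
  then have "2 * (P * r) * sqrt (P\<^sup>2 + Q\<^sup>2) \<le> P\<^sup>2 + Q\<^sup>2 + (P * r)\<^sup>2"
    by (simp add: power2_diff mult.assoc mult.left_commute mult.commute)
  then have "sqrt (P\<^sup>2 + Q\<^sup>2) \<le> (P\<^sup>2 + Q\<^sup>2 + (P * r)\<^sup>2) / (2 * (P * r))"
    using t by (simp add: pos_le_divide_eq mult.commute)
  also have "P\<^sup>2 + Q\<^sup>2 + (P * r)\<^sup>2 = 2 * (P * r)\<^sup>2 + 2 * z * P * X + X\<^sup>2"
    unfolding power_mult_distrib r(2) X_def by (simp add: power2_eq_square algebra_simps)
  also have "(2 * (P * r)\<^sup>2 + 2 * z * P * X + X\<^sup>2) / (2 * (P * r)) = P * r + z / r * X + X\<^sup>2 / (2 * P) / r"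
    using assms r by (simp add: field_simps power2_eq_square)
  also have "X\<^sup>2 / (2 * P) / r \<le> X\<^sup>2 / (2 * P) / 1"
    using assms r by (intro divide_left_mono) auto
  finally show ?thesis by (simp add: r_def X_def)
qed

text \<open>A compactly supported substitute for exp (- y^2 / 4), the profile on which
  \<open>defect_y\<close> below vanishes. The companion \<open>bump_z\<close> confines z to
  \<bar>z\<bar> \<le> 1/2, where the cube of \<open>slope_weight\<close> is at least 7/10.\<close>

definition bump_y :: "real \<Rightarrow> real" where "bump_y y = pos_square (1 - y\<^sup>2 / 9)"
definition bump_y' :: "real \<Rightarrow> real" where "bump_y' y = - 4 * y / 9 * max 0 (1 - y\<^sup>2 / 9)"
definition bump_z :: "real \<Rightarrow> real" where "bump_z z = pos_square (1 - 4 * z\<^sup>2)"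
definition bump_z' :: "real \<Rightarrow> real" where "bump_z' z = - 16 * z * max 0 (1 - 4 * z\<^sup>2)"

lemma bump_derivatives:
  "(bump_y has_real_derivative bump_y' y) (at y)" "(bump_z has_real_derivative bump_z' z) (at z)"
proof -
  have "((\<lambda>y. 1 - y\<^sup>2 / 9) has_real_derivative - 2 * y / 9) (at y)"
    by (auto intro!: derivative_eq_intros)
  from DERIV_chain2[OF pos_square_has_derivative this] show "(bump_y has_real_derivative bump_y' y) (at y)"
    by (simp add: bump_y_def[abs_def] bump_y'_def ac_simps)
  have "((\<lambda>z. 1 - 4 * z\<^sup>2) has_real_derivative - 8 * z) (at z)"
    by (auto intro!: derivative_eq_intros)
  from DERIV_chain2[OF pos_square_has_derivative this] show "(bump_z has_real_derivative bump_z' z) (at z)"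
    by (simp add: bump_z_def[abs_def] bump_z'_def ac_simps)
qed

lemma continuous_bumps [continuous_intros]:
  "continuous_on S f \<Longrightarrow> continuous_on S (\<lambda>x. bump_y (f x))" "continuous_on S f \<Longrightarrow> continuous_on S (\<lambda>x. bump_y' (f x))"
  "continuous_on S f \<Longrightarrow> continuous_on S (\<lambda>x. bump_z (f x))" "continuous_on S f \<Longrightarrow> continuous_on S (\<lambda>x. bump_z' (f x))"
  unfolding bump_y_def bump_y'_def bump_z_def bump_z'_def by (intro continuous_intros; simp)+

lemma bump_y_support: "\<bar>y\<bar> \<ge> 3 \<Longrightarrow> bump_y y = 0" "\<bar>y\<bar> \<ge> 3 \<Longrightarrow> bump_y' y = 0"
proof -
  assume "\<bar>y\<bar> \<ge> 3"
  then have "\<bar>y\<bar>\<^sup>2 \<ge> 3\<^sup>2" by (intro power_mono) auto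
  then have "max 0 (1 - y\<^sup>2 / 9) = 0" by simp
  then show "bump_y y = 0" "bump_y' y = 0" by (simp_all add: bump_y_def bump_y'_def pos_square_def)
qed

lemma bump_z_support: "\<bar>z\<bar> \<ge> 1/2 \<Longrightarrow> bump_z z = 0" "\<bar>z\<bar> \<ge> 1/2 \<Longrightarrow> bump_z' z = 0"
proof -
  assume "\<bar>z\<bar> \<ge> 1/2"
  then have "\<bar>z\<bar>\<^sup>2 \<ge> (1/2)\<^sup>2" by (intro power_mono) auto
  then have "max 0 (1 - 4 * z\<^sup>2) = 0" by (simp add: power2_eq_square)
  then show "bump_z z = 0" "bump_z' z = 0" by (simp_all add: bump_z_def bump_z'_def pos_square_def)
qed

lemma bump_bounds: "0 \<le> bump_y y" "bump_y y \<le> 1" "0 \<le> bump_z z" "bump_z z \<le> 1" "\<bar>bump_z' z\<bar> \<le> 4"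
proof -
  have m: "0 \<le> max 0 (1 - y\<^sup>2 / 9)" "max 0 (1 - y\<^sup>2 / 9) \<le> 1" "0 \<le> max 0 (1 - 4 * z\<^sup>2)" "max 0 (1 - 4 * z\<^sup>2) \<le> 1"
    by auto
  show "0 \<le> bump_y y" "0 \<le> bump_z z" by (simp_all add: bump_y_def bump_z_def pos_square_def)
  show "bump_y y \<le> 1" "bump_z z \<le> 1"
    using m by (simp_all add: bump_y_def bump_z_def pos_square_def power_le_one)
  show "\<bar>bump_z' z\<bar> \<le> 4"
  proof (cases "\<bar>z\<bar> \<ge> 1/2")
    case False
    have "4 * z\<^sup>2 \<le> 1"
    proof -
      have "\<bar>z\<bar>\<^sup>2 \<le> (1/2)\<^sup>2" using False by (intro power_mono) auto
      then show ?thesis by (simp add: power2_eq_square)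
    qed
    \<comment> \<open>With u = 2 \<bar>z\<bar>, the derivative has modulus 8 u (1 - u) (1 + u), and
      4 u (1 - u) \<le> 1 because (2 u - 1)^2 \<ge> 0. Together with 1 + u \<le> 2 this gives the
      bound 4.\<close>
    have a: "4 * (2 * \<bar>z\<bar>) * (1 - (2 * \<bar>z\<bar>)) \<le> 1"
      using zero_le_power2[of "4 * \<bar>z\<bar> - 1"] by (simp add: power2_eq_square algebra_simps)
    have m: "max 0 (1 - 4 * z\<^sup>2) = (1 - 2 * \<bar>z\<bar>) * (1 + 2 * \<bar>z\<bar>)"
      using \<open>4 * z\<^sup>2 \<le> 1\<close> by (simp add: algebra_simps power2_eq_square)
    have "\<bar>bump_z' z\<bar> = 16 * \<bar>z\<bar> * ((1 - 2 * \<bar>z\<bar>) * (1 + 2 * \<bar>z\<bar>))"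
      unfolding bump_z'_def m abs_mult using False by simp
    also have "\<dots> = 2 * (4 * (2 * \<bar>z\<bar>) * (1 - (2 * \<bar>z\<bar>))) * (1 + 2 * \<bar>z\<bar>)" by simp
    also have "\<dots> \<le> 2 * 1 * 2"
      using a False by (intro mult_mono) auto
    finally show ?thesis by simp
  qed (simp add: bump_z_support)
qed

definition variation :: "real \<times> real \<Rightarrow> real" where
  "variation q = bump_y (fst q) * bump_z (snd q)"

text \<open>The height 1/20 is small enough to keep \<open>competitor_P\<close> above 7/10, so that
  the graph has no characteristic points, and to keep the error terms below the second-order
  gain.\<close>

definition competitor :: "real \<times> real \<Rightarrow> real" where
  "competitor q = fst q * snd q + variation q / 20"

lemma Ck_on_competitor: "Ck_on 1 UNIV competitor"
  unfolding competitor_def[abs_def] variation_def bump_y_def bump_z_def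
  by (intro Ck_intros Ck_on_pos_square open_UNIV) auto

lemma variation_line_derivatives:
  "((\<lambda>r. variation (q + r *\<^sub>R (1, 0))) has_real_derivative bump_y' (fst q) * bump_z (snd q)) (at 0)"
  "((\<lambda>r. variation (q + r *\<^sub>R (0, 1))) has_real_derivative bump_y (fst q) * bump_z' (snd q)) (at 0)"
proof -
  have y: "((\<lambda>r. bump_y (fst q + r)) has_real_derivative bump_y' (fst q)) (at 0)"
    using DERIV_shift[of bump_y "bump_y' (fst q)" 0 "fst q"] bump_derivatives(1) by (simp add: add.commute)
  have z: "((\<lambda>r. bump_z (snd q + r)) has_real_derivative bump_z' (snd q)) (at 0)"
    using DERIV_shift[of bump_z "bump_z' (snd q)" 0 "snd q"] bump_derivatives(2) by (simp add: add.commute)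
  show "((\<lambda>r. variation (q + r *\<^sub>R (1, 0))) has_real_derivative bump_y' (fst q) * bump_z (snd q)) (at 0)"
    "((\<lambda>r. variation (q + r *\<^sub>R (0, 1))) has_real_derivative bump_y (fst q) * bump_z' (snd q)) (at 0)"
    unfolding variation_def by (auto intro!: derivative_eq_intros y z)
qed

lemma competitor_derivatives:
  "frechet_derivative competitor (at q) (1, 0) = snd q + bump_y' (fst q) * bump_z (snd q) / 20"
  "frechet_derivative competitor (at q) (0, 1) = fst q + bump_y (fst q) * bump_z' (snd q) / 20"
proof -
  have l: "((\<lambda>r. competitor (q + r *\<^sub>R v)) has_real_derivative frechet_derivative competitor (at q) v) (at 0)" for v
    using Ck_on_1_line_derivative[OF open_UNIV Ck_on_competitor, of q 0 v]
    by (simp add: has_real_derivative_iff_has_vector_derivative)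
  have fs: "((\<lambda>r. fst (q + r *\<^sub>R v)) has_real_derivative fst v) (at 0)"
    "((\<lambda>r. snd (q + r *\<^sub>R v)) has_real_derivative snd v) (at 0)" for v
    by (auto intro!: derivative_eq_intros)
  have "((\<lambda>r. competitor (q + r *\<^sub>R (1, 0))) has_real_derivative snd q + bump_y' (fst q) * bump_z (snd q) / 20) (at 0)"
    "((\<lambda>r. competitor (q + r *\<^sub>R (0, 1))) has_real_derivative fst q + bump_y (fst q) * bump_z' (snd q) / 20) (at 0)"
    unfolding competitor_def
    by ((rule derivative_eq_intros fs variation_line_derivatives refl)+, simp add: zero_prod_def[symmetric])+
  then show "frechet_derivative competitor (at q) (1, 0) = snd q + bump_y' (fst q) * bump_z (snd q) / 20"
    "frechet_derivative competitor (at q) (0, 1) = fst q + bump_y (fst q) * bump_z' (snd q) / 20"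
    using l DERIV_unique by blast+
qed

definition competitor_P :: "real \<times> real \<Rightarrow> real" where
  "competitor_P q = 1 + fst q * frechet_derivative competitor (at q) (0, 1) / 2"

definition competitor_Q :: "real \<times> real \<Rightarrow> real" where
  "competitor_Q q = frechet_derivative competitor (at q) (1, 0) + competitor q * frechet_derivative competitor (at q) (0, 1) / 2"

lemma competitor_P_eq: "competitor_P q = 1 + (fst q)\<^sup>2 / 2 + fst q * bump_y (fst q) * bump_z' (snd q) / 40"
  by (simp add: competitor_P_def competitor_derivatives power2_eq_square algebra_simps)

text \<open>On x = y z one has Q = z P, so this difference measures how far the ruling slope is
  disturbed. Its first-order part contains no derivative in z: the terms with \<open>bump_z'\<close>
  cancel and return only at second order. This is why a narrow bump in z is affordable.\<close>

lemma competitor_defect: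
  "competitor_Q q - snd q * competitor_P q =
    (bump_y' (fst q) * bump_z (snd q) + fst q * variation q / 2) / 20 + variation q * bump_y (fst q) * bump_z' (snd q) / 800"
  by (simp add: competitor_P_def competitor_Q_def competitor_derivatives competitor_def power2_eq_square field_simps)

lemma competitor_P_ge: "competitor_P q \<ge> 7/10"
proof -
  have "\<bar>fst q * bump_y (fst q)\<bar> \<le> 3 * 1"
  proof (cases "\<bar>fst q\<bar> \<ge> 3")
    case False
    then show ?thesis using bump_bounds(1,2)[of "fst q"] unfolding abs_mult by (intro mult_mono) auto
  qed (simp add: bump_y_support)
  then have "\<bar>fst q * bump_y (fst q) * bump_z' (snd q)\<bar> \<le> 3 * 4"
    unfolding abs_mult[of _ "bump_z' (snd q)"] using bump_bounds(5)[of "snd q"] by (intro mult_mono) auto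
  then have "- 12 \<le> fst q * bump_y (fst q) * bump_z' (snd q)" by linarith
  then show ?thesis using zero_le_power2[of "fst q"] unfolding competitor_P_eq by linarith
qed

text \<open>The operator f' + y f / 2 applied to \<open>bump_y\<close>; its kernel is spanned by exp
  (- y^2 / 4).\<close>

definition defect_y :: "real \<Rightarrow> real" where
  "defect_y y = bump_y' y + y * bump_y y / 2"

lemma slope_weight_cube_ge:
  assumes "\<bar>snd q\<bar> \<le> 1/2"
  shows "slope_weight q ^ 3 \<ge> 7/10"
proof -
  have "(snd q)\<^sup>2 \<le> (1/2)\<^sup>2" using power_mono[OF assms, of 2] by simp
  then have z: "1 + (snd q)\<^sup>2 \<le> 5/4" by (simp add: power2_eq_square)
  note w = slope_weight_pos[of q]
  have "1 = slope_weight q ^ 2 * (1 + (snd q)\<^sup>2)" using slope_weight_square by simp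
  also have "\<dots> \<le> slope_weight q ^ 2 * (5/4)" using z by (intro mult_left_mono) auto
  finally have w2: "slope_weight q ^ 2 \<ge> 4/5" by simp
  have "slope_weight q \<ge> 7/8"
  proof (rule ccontr)
    assume "\<not> ?thesis"
    then have "slope_weight q ^ 2 \<le> (7/8) ^ 2" using w by (intro power_mono) auto
    then show False using w2 by (simp add: power2_eq_square)
  qed
  have "7/10 = 4/5 * (7/8 :: real)" by simp
  also have "\<dots> \<le> slope_weight q ^ 2 * slope_weight q" using w2 \<open>slope_weight q \<ge> 7/8\<close> by (intro mult_mono) auto
  finally show ?thesis by (simp add: power2_eq_square power3_eq_cube)
qed

text \<open>In the expansion of the area of the competitor, the terms of first order are the divergence of
  these potentials; the divergence also absorbs a part of the second order and leaves a negative term.\<close>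

definition comp_potential_z :: "real \<times> real \<Rightarrow> real" where
  "comp_potential_z q = fst q * variation q / slope_weight q / 40 + snd q * slope_weight q * (variation q)\<^sup>2 / 1600"

definition comp_potential_z' :: "real \<times> real \<Rightarrow> real" where
  "comp_potential_z' q = fst q * (bump_y (fst q) * bump_z' (snd q) / slope_weight q + variation q * snd q * slope_weight q) / 40
    + (slope_weight q ^ 3 * (variation q)\<^sup>2 + 2 * snd q * slope_weight q * variation q * bump_y (fst q) * bump_z' (snd q)) / 1600"

definition comp_potential_y :: "real \<times> real \<Rightarrow> real" where
  "comp_potential_y q = snd q * slope_weight q * variation q / 20"

definition comp_potential_y' :: "real \<times> real \<Rightarrow> real" where
  "comp_potential_y' q = snd q * slope_weight q * bump_y' (fst q) * bump_z (snd q) / 20"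

lemma inverse_slope_weight: "1 / slope_weight q = sqrt (1 + (snd q)\<^sup>2)"
  by (simp add: slope_weight_def)

lemma comp_potential_line_derivatives:
  "((\<lambda>r. comp_potential_z (q + r *\<^sub>R (0, 1))) has_real_derivative comp_potential_z' q) (at 0)"
  "((\<lambda>r. comp_potential_y (q + r *\<^sub>R (1, 0))) has_real_derivative comp_potential_y' q) (at 0)"
proof -
  note w = slope_weight_pos[of q] slope_weight_square[of q]
  have s: "((\<lambda>r. snd (q + r *\<^sub>R (0, 1))) has_real_derivative 1) (at 0)" by (auto intro!: derivative_eq_intros)
  have w1: "slope_weight q = slope_weight q ^ 3 * (1 + (snd q)\<^sup>2)"
    using w(2) by (simp add: power3_eq_cube power2_eq_square mult.assoc)
  have d1: "((\<lambda>r. 1 / slope_weight (q + r *\<^sub>R (0, 1))) has_real_derivative snd q * slope_weight q) (at 0)"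
  proof -
    have "((\<lambda>r. 1 / slope_weight (q + r *\<^sub>R (0, 1))) has_real_derivative
      (0 * slope_weight (q + 0 *\<^sub>R (0, 1)) - 1 * (- snd q * slope_weight q ^ 3)) /
      (slope_weight (q + 0 *\<^sub>R (0, 1)) * slope_weight (q + 0 *\<^sub>R (0, 1)))) (at 0)"
      by (rule DERIV_divide[OF DERIV_const slope_weight_line_derivatives(1)]) (use w(1) in \<open>simp add: zero_prod_def[symmetric]\<close>)
    then show ?thesis by (rule DERIV_cong) (use w(1) in \<open>simp add: power3_eq_cube zero_prod_def[symmetric]\<close>)
  qed
  \<comment> \<open>The derivative of z w in z is w^3. Through the term z w \<phi> \<phi>_z of the
    expansion, this produces the negative multiple of \<phi>^2.\<close>
  have d2: "((\<lambda>r. snd (q + r *\<^sub>R (0, 1)) * slope_weight (q + r *\<^sub>R (0, 1))) has_real_derivative slope_weight q ^ 3) (at 0)"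
  proof -
    have "((\<lambda>r. snd (q + r *\<^sub>R (0, 1)) * slope_weight (q + r *\<^sub>R (0, 1))) has_real_derivative
       slope_weight q - (snd q)\<^sup>2 * slope_weight q ^ 3) (at 0)"
      by (rule derivative_eq_intros s slope_weight_line_derivatives refl)+ (simp add: zero_prod_def[symmetric] power2_eq_square)
    moreover have "slope_weight q - (snd q)\<^sup>2 * slope_weight q ^ 3 = slope_weight q ^ 3"
      by (subst (1) w1) (simp add: algebra_simps)
    ultimately show ?thesis by simp
  qed
  have "((\<lambda>r. fst q * (variation (q + r *\<^sub>R (0, 1)) * (1 / slope_weight (q + r *\<^sub>R (0, 1)))) / 40 +
     (snd (q + r *\<^sub>R (0, 1)) * slope_weight (q + r *\<^sub>R (0, 1))) * (variation (q + r *\<^sub>R (0, 1)))\<^sup>2 / 1600) has_real_derivative comp_potential_z' q) (at 0)"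
    by (rule DERIV_cong[OF DERIV_add[OF DERIV_cdivide[OF DERIV_cmult[OF DERIV_mult[OF variation_line_derivatives(2) d1]]]
        DERIV_cdivide[OF DERIV_mult[OF d2 DERIV_power[OF variation_line_derivatives(2)]]]]])
      (simp add: comp_potential_z'_def zero_prod_def[symmetric] field_simps power2_eq_square)
  then show "((\<lambda>r. comp_potential_z (q + r *\<^sub>R (0, 1))) has_real_derivative comp_potential_z' q) (at 0)"
    by (simp add: comp_potential_z_def)
  have "((\<lambda>r. snd q * slope_weight q * variation (q + r *\<^sub>R (1, 0)) / 20) has_real_derivative comp_potential_y' q) (at 0)"
    by (rule DERIV_cong[OF DERIV_cdivide[OF DERIV_cmult[OF variation_line_derivatives(1)]]])
      (simp add: comp_potential_y'_def)
  then show "((\<lambda>r. comp_potential_y (q + r *\<^sub>R (1, 0))) has_real_derivative comp_potential_y' q) (at 0)"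
    by (simp add: comp_potential_y_def slope_weight_def)
qed

text \<open>\<open>sqrt_sum_squares_le\<close> expands the area around Q = z P. The terms linear in
  the height, together with z w \<phi> \<phi>_z, form the divergence of the potentials minus w^3
  \<phi>^2 / 1600. The quadratic remainder costs a multiple of the squared defect and a small
  multiple of \<phi>^2; the numbers 4/25 and 3/2 are round bounds for the result.\<close>

lemma competitor_area_bound:
  "sqrt ((competitor_P q)\<^sup>2 + (competitor_Q q)\<^sup>2) - area_density id q \<le>
    comp_potential_z' q + comp_potential_y' q
    - (1/400) * ((4/25 * (bump_y (fst q))\<^sup>2 - 3/2 * (defect_y (fst q))\<^sup>2) * (bump_z (snd q))\<^sup>2)"
proof -
  define w where "w = slope_weight q"
  define \<phi> where "\<phi> = variation q"
  define a where "a = defect_y (fst q) * bump_z (snd q)"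
  define dz where "dz = bump_y (fst q) * bump_z' (snd q)"
  define b where "b = \<phi> * dz / 2"
  define P where "P = competitor_P q"
  define Q where "Q = competitor_Q q"
  have w: "w > 0" "1 / w = sqrt (1 + (snd q)\<^sup>2)" "w = 1 / sqrt (1 + (snd q)\<^sup>2)"
    unfolding w_def by (rule slope_weight_pos, rule inverse_slope_weight, rule slope_weight_def)
  have P: "P \<ge> 7/10" "P = 1 + (fst q)\<^sup>2 / 2 + fst q * dz / 40"
    using competitor_P_ge by (simp_all add: P_def competitor_P_eq dz_def)
  have X: "Q - snd q * P = a / 20 + b / 400"
    unfolding P_def Q_def competitor_defect a_def b_def dz_def \<phi>_def defect_y_def variation_def
    by (simp add: field_simps)
  have A: "area_density id q = (1 + (fst q)\<^sup>2 / 2) / w"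
    by (simp add: area_density_def id_values hnorm_def w_def slope_weight_def add.commute)
  have "(a / 20 + b / 400)\<^sup>2 / (2 * P) \<le> (a / 20 + b / 400)\<^sup>2 / (2 * (7/10))"
    using P(1) by (intro divide_left_mono) auto
  also have "(a / 20 + b / 400)\<^sup>2 \<le> 2 * (a / 20)\<^sup>2 + 2 * (b / 400)\<^sup>2"
    using zero_le_power2[of "a / 20 - b / 400"] by (simp add: power2_sum power2_diff)
  finally have R: "(a / 20 + b / 400)\<^sup>2 / (2 * P) \<le> (2 * (a / 20)\<^sup>2 + 2 * (b / 400)\<^sup>2) / (2 * (7/10))"
    by (simp add: divide_right_mono)
  have b2: "b\<^sup>2 \<le> (2 * \<phi>)\<^sup>2"
  proof -
    have "\<bar>dz\<bar> \<le> 1 * 4" unfolding dz_def abs_mult using bump_bounds by (intro mult_mono) auto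
    then have "\<bar>b\<bar> \<le> 2 * \<bar>\<phi>\<bar>" using mult_left_mono[of "\<bar>dz\<bar>" 4 "\<bar>\<phi>\<bar>"] by (simp add: b_def abs_mult)
    then show ?thesis by (metis abs_mult abs_numeral abs_le_square_iff)
  qed
  have w3: "w ^ 3 * \<phi>\<^sup>2 \<ge> 7/10 * \<phi>\<^sup>2"
  proof (cases "\<bar>snd q\<bar> \<le> 1/2")
    case True
    then show ?thesis using slope_weight_cube_ge by (intro mult_right_mono) (auto simp: w_def)
  next
    case False
    then show ?thesis by (simp add: \<phi>_def variation_def bump_z_support)
  qed
  have "sqrt (P\<^sup>2 + Q\<^sup>2) - area_density id q \<le> P / w + snd q * w * (a / 20 + b / 400) + (a / 20 + b / 400)\<^sup>2 / (2 * P) - (1 + (fst q)\<^sup>2 / 2) / w"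
    using sqrt_sum_squares_le[of P Q "snd q"] P(1) unfolding X A w(3) by simp
  also have "\<dots> = fst q * dz / 40 / w + snd q * w * (a / 20 + b / 400) + (a / 20 + b / 400)\<^sup>2 / (2 * P)"
    unfolding P(2) by (simp add: add_divide_distrib)
  also have "\<dots> = comp_potential_z' q + comp_potential_y' q - w ^ 3 * \<phi>\<^sup>2 / 1600 + (a / 20 + b / 400)\<^sup>2 / (2 * P)"
    using w(1) by (simp add: comp_potential_z'_def comp_potential_y'_def w_def[symmetric] \<phi>_def[symmetric] dz_def a_def b_def defect_y_def)
      (simp add: \<phi>_def variation_def field_simps)
  also have "\<dots> \<le> comp_potential_z' q + comp_potential_y' q - (1/400) * (4/25 * \<phi>\<^sup>2 - 3/2 * a\<^sup>2)"
  \<comment> \<open>The coefficient of a^2 is 1/280 \<le> 3/800. For \<phi>^2, the gain 7/16000 from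
    \<open>w3\<close> minus the loss 1/28000 from \<open>b2\<close> is still at least
    1/2500.\<close>
  proof -
    define T where "T = (a / 20 + b / 400)\<^sup>2 / (2 * P)"
    have "T \<le> a\<^sup>2 / 280 + b\<^sup>2 / 112000"
      using R unfolding T_def[symmetric] by (simp add: power_divide)
    moreover have "b\<^sup>2 \<le> 4 * \<phi>\<^sup>2" using b2 by (simp add: power_mult_distrib)
    ultimately have "T - w ^ 3 * \<phi>\<^sup>2 / 1600 \<le> - (1/400) * (4/25 * \<phi>\<^sup>2 - 3/2 * a\<^sup>2)"
      using w3 zero_le_power2[of a] zero_le_power2[of \<phi>] unfolding right_diff_distrib by linarith
    then show ?thesis unfolding T_def[symmetric] by linarith
  qed
  also have "4/25 * \<phi>\<^sup>2 - 3/2 * a\<^sup>2 = (4/25 * (bump_y (fst q))\<^sup>2 - 3/2 * (defect_y (fst q))\<^sup>2) * (bump_z (snd q))\<^sup>2"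
    by (simp add: \<phi>_def variation_def a_def power_mult_distrib algebra_simps)
  finally show ?thesis unfolding P_def Q_def .
qed

text \<open>The loss is smaller than the gain because (1 - y^2 / 9)^2 is nearly annihilated by f' +
  y f / 2: on the support the defect is y (1 - y^2) (1 - y^2 / 9) / 18. Both squares are polynomials
  there, so the integral is evaluated exactly.\<close>

lemma bump_balance: "(LINT y|lborel. 4/25 * (bump_y y)\<^sup>2 - 3/2 * (defect_y y)\<^sup>2) > 0"
proof -
  define f where "f y = 4/25 * (1 - y\<^sup>2 / 9) ^ 4 - 1/216 * ((1 - y\<^sup>2 / 9)\<^sup>2 * y\<^sup>2 * (1 - y\<^sup>2)\<^sup>2)" for y :: real
  \<comment> \<open>The term-by-term antiderivative of the expanded polynomial \<open>f\<close>; the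
    factor 1/216 is 3/2 times (1/18)^2.\<close>
  define F where "F y = 4/25 * (y - 4 * y ^ 3 / 27 + 6 * y ^ 5 / 405 - 4 * y ^ 7 / 5103 + y ^ 9 / 59049)
    - 1/216 * (y ^ 3 / 3 - 4 * y ^ 5 / 9 + 118 * y ^ 7 / 567 - 20 * y ^ 9 / 729 + y ^ 11 / 891)" for y :: real
  have "4/25 * (bump_y y)\<^sup>2 - 3/2 * (defect_y y)\<^sup>2 = indicator {-3..3} y *\<^sub>R f y" for y
  proof (cases "\<bar>y\<bar> \<le> 3")
    case True
    then have "\<bar>y\<bar>\<^sup>2 \<le> 3\<^sup>2" by (intro power_mono) auto
    then have m: "max 0 (1 - y\<^sup>2 / 9) = 1 - y\<^sup>2 / 9" by simp
    have d: "defect_y y = (1 - y\<^sup>2 / 9) * y * (1 - y\<^sup>2) / 18"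
      unfolding defect_y_def bump_y_def bump_y'_def pos_square_def m by (simp add: field_simps power2_eq_square)
    have b: "bump_y y = (1 - y\<^sup>2 / 9)\<^sup>2" by (simp add: bump_y_def pos_square_def m)
    have "y \<in> {-3..3}" using True by auto
    then show ?thesis unfolding d b f_def by (simp add: power_mult_distrib power_divide)
  next
    case False
    then have "y \<notin> {-3..3}" by auto
    then show ?thesis using False by (simp add: bump_y_support defect_y_def)
  qed
  then have "(LINT y|lborel. 4/25 * (bump_y y)\<^sup>2 - 3/2 * (defect_y y)\<^sup>2) = (LINT y|lborel. indicator {-3..3} y *\<^sub>R f y)"
    by simp
  also have "\<dots> = F 3 - F (- 3)"
  proof (rule integral_FTC_atLeastAtMost)
    fix y :: real
    have "(F has_real_derivative f y) (at y)"
    proof -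
      have "(F has_real_derivative 4/25 * (1 - 4/9 * y\<^sup>2 + 6/81 * y ^ 4 - 4/729 * y ^ 6 + 1/6561 * y ^ 8)
        - 1/216 * (y\<^sup>2 - 20/9 * y ^ 4 + 118/81 * y ^ 6 - 20/81 * y ^ 8 + 1/81 * y ^ 10)) (at y)"
        unfolding F_def[abs_def] by (auto intro!: derivative_eq_intros simp: field_simps)
      moreover have "4/25 * (1 - 4/9 * y\<^sup>2 + 6/81 * y ^ 4 - 4/729 * y ^ 6 + 1/6561 * y ^ 8)
        - 1/216 * (y\<^sup>2 - 20/9 * y ^ 4 + 118/81 * y ^ 6 - 20/81 * y ^ 8 + 1/81 * y ^ 10) = f y"
        unfolding f_def by (simp add: eval_nat_numeral field_simps)
      ultimately show ?thesis by simp
    qed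
    then show "(F has_vector_derivative f y) (at y within {-3..3})"
      by (simp add: has_real_derivative_iff_has_vector_derivative has_vector_derivative_at_within)
    show "continuous_on {-3..3} f" unfolding f_def[abs_def] by (intro continuous_intros) auto
  qed simp
  also have "\<dots> > 0" by (simp add: F_def)
  finally show ?thesis .
qed

lemma competitor_off_support:
  assumes "q \<notin> {-3..3} \<times> {-1/2..1/2}"
  shows "bump_y (fst q) = 0 \<and> bump_y' (fst q) = 0 \<or> bump_z (snd q) = 0 \<and> bump_z' (snd q) = 0"
proof -
  have "\<bar>fst q\<bar> \<ge> 3 \<or> \<bar>snd q\<bar> \<ge> 1/2" using assms by (cases q) auto
  then show ?thesis using bump_y_support bump_z_support by blast
qed

lemma continuous_slope_weight: "continuous_on S slope_weight"
  using continuous_on_subset[OF smooth_on_continuous_on[OF smooth_slope_weight] subset_UNIV] .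

lemma continuous_competitor_terms:
  "continuous_on UNIV competitor_P" "continuous_on UNIV competitor_Q"
  "continuous_on UNIV comp_potential_z" "continuous_on UNIV comp_potential_z'"
  "continuous_on UNIV comp_potential_y" "continuous_on UNIV comp_potential_y'"
proof -
  have v: "continuous_on UNIV variation" unfolding variation_def[abs_def] by (intro continuous_intros)
  then have "continuous_on UNIV competitor" unfolding competitor_def[abs_def] by (intro continuous_intros) auto
  then show "continuous_on UNIV competitor_P" "continuous_on UNIV competitor_Q"
    unfolding competitor_P_def[abs_def] competitor_Q_def[abs_def] competitor_derivatives
    by (intro continuous_intros; simp)+
  show "continuous_on UNIV comp_potential_z" "continuous_on UNIV comp_potential_z'"
    "continuous_on UNIV comp_potential_y" "continuous_on UNIV comp_potential_y'"
    unfolding comp_potential_z_def[abs_def] comp_potential_z'_def[abs_def] comp_potential_y_def[abs_def] comp_potential_y'_def[abs_def]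
    by (intro continuous_intros v continuous_slope_weight; simp add: less_imp_neq[OF slope_weight_pos, symmetric])+
qed

lemma compact_competitor_support: "compact ({-3..3} \<times> {-1/2..1/2} :: (real \<times> real) set)"
  by (intro compact_Times) auto

lemma bump_z_square_integral_pos: "(LINT z|lborel. (bump_z z)\<^sup>2) > 0"
proof -
  have i: "integrable lborel (\<lambda>z. (bump_z z)\<^sup>2)"
  proof (rule continuous_compact_support_integrable)
    show "(bump_z z)\<^sup>2 = 0" if "z \<notin> {-1/2..1/2}" for z
      using that bump_z_support(1)[of z] by (auto simp: abs_if)
  qed (auto intro!: continuous_intros)
  have "(LINT z|lborel. indicator {-1/4..1/4::real} z * (81/256 :: real)) \<le> (LINT z|lborel. (bump_z z)\<^sup>2)"
  proof (rule integral_mono[OF _ i])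
    show "indicator {-1/4..1/4} z * (81/256) \<le> (bump_z z)\<^sup>2" for z :: real
    proof (cases "z \<in> {-1/4..1/4}")
      case True
      then have "\<bar>z\<bar> \<le> 1/4" by auto
      then have "\<bar>z\<bar>\<^sup>2 \<le> (1/4)\<^sup>2" by (intro power_mono) auto
      then have z: "3/4 \<le> 1 - 4 * z\<^sup>2" by (simp add: power2_eq_square)
      then have "(3/4)\<^sup>2 \<le> bump_z z" unfolding bump_z_def pos_square_def by (intro power_mono) auto
      then have "((3/4)\<^sup>2)\<^sup>2 \<le> (bump_z z)\<^sup>2" by (intro power_mono) auto
      then show ?thesis using True by (simp add: power2_eq_square)
    qed simp
    show "integrable lborel (\<lambda>z. indicator {-1/4..1/4::real} z * (81/256 :: real))"
      by (intro integrable_mult_left integrable_real_indicator emeasure_bounded_finite) auto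
  qed
  moreover have "(LINT z|lborel. indicator {-1/4..1/4::real} z * (81/256 :: real)) = 81/512" by simp
  ultimately show ?thesis by simp
qed

text \<open>After integrating \<open>competitor_area_bound\<close> the two divergences vanish, and
  the remaining term factors by Fubini into the positive integral of \<open>bump_balance\<close> and
  that of the square of \<open>bump_z\<close>.\<close>

lemma competitor_gain:
  "(LINT q|lborel. sqrt ((competitor_P q)\<^sup>2 + (competitor_Q q)\<^sup>2) - area_density id q) < 0"
  "integrable lborel (\<lambda>q. sqrt ((competitor_P q)\<^sup>2 + (competitor_Q q)\<^sup>2) - area_density id q)"
  "q \<notin> {-3..3} \<times> {-1/2..1/2} \<Longrightarrow> sqrt ((competitor_P q)\<^sup>2 + (competitor_Q q)\<^sup>2) - area_density id q = 0"
proof -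
  let ?K = "{-3..3} \<times> {-1/2..1/2} :: (real \<times> real) set"
  let ?d = "\<lambda>q. sqrt ((competitor_P q)\<^sup>2 + (competitor_Q q)\<^sup>2) - area_density id q"
  let ?B = "\<lambda>y. 4/25 * (bump_y y)\<^sup>2 - 3/2 * (defect_y y)\<^sup>2"
  interpret I: compact_contact id by (rule compact_contact_id)
  show off: "?d q = 0" if "q \<notin> ?K" for q
  proof -
    have 0: "bump_y (fst q) * bump_z' (snd q) = 0" "bump_y' (fst q) * bump_z (snd q) = 0" "variation q = 0"
      using competitor_off_support[OF that] by (auto simp: variation_def)
    have P: "competitor_P q = 1 + (fst q)\<^sup>2 / 2" using 0(1) by (simp add: competitor_P_eq mult.assoc)
    have "competitor_Q q = snd q * competitor_P q"
      using competitor_defect[of q] 0 by simp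
    then have "(competitor_P q)\<^sup>2 + (competitor_Q q)\<^sup>2 = (competitor_P q)\<^sup>2 * (1 + (snd q)\<^sup>2)"
      by (simp add: power_mult_distrib algebra_simps)
    then have "sqrt ((competitor_P q)\<^sup>2 + (competitor_Q q)\<^sup>2) = competitor_P q * sqrt (1 + (snd q)\<^sup>2)"
      using competitor_P_ge[of q] by (simp add: real_sqrt_mult)
    then show ?thesis by (simp add: P area_density_def id_values hnorm_def add.commute)
  qed
  have c: "continuous_on UNIV ?d"
    by (intro continuous_intros continuous_competitor_terms continuous_area_density I.smooth)
  show int: "integrable lborel ?d"
    by (rule continuous_compact_support_integrable[OF c compact_competitor_support off])
  have pot0: "comp_potential_z q = 0" "comp_potential_y q = 0" "comp_potential_z' q = 0" "comp_potential_y' q = 0"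
    "?B (fst q) * (bump_z (snd q))\<^sup>2 = 0" if "q \<notin> ?K" for q
    using competitor_off_support[OF that]
    by (auto simp: comp_potential_z_def comp_potential_y_def comp_potential_z'_def comp_potential_y'_def variation_def defect_y_def)
  have z: "(LINT q|lborel. comp_potential_z' q) = 0" "integrable lborel comp_potential_z'"
    by (rule integral_directional_derivative_eq_0[OF continuous_competitor_terms(3,4) comp_potential_line_derivatives(1) compact_competitor_support])
      (rule pot0, assumption, rule continuous_compact_support_integrable[OF continuous_competitor_terms(4) compact_competitor_support], rule pot0)
  have y: "(LINT q|lborel. comp_potential_y' q) = 0" "integrable lborel comp_potential_y'"
    by (rule integral_directional_derivative_eq_0[OF continuous_competitor_terms(5,6) comp_potential_line_derivatives(2) compact_competitor_support])
      (rule pot0, assumption, rule continuous_compact_support_integrable[OF continuous_competitor_terms(6) compact_competitor_support], rule pot0)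
  have b: "integrable lborel (\<lambda>q. ?B (fst q) * (bump_z (snd q))\<^sup>2)"
  proof (rule continuous_compact_support_integrable[OF _ compact_competitor_support])
    show "continuous_on UNIV (\<lambda>q::real \<times> real. ?B (fst q) * (bump_z (snd q))\<^sup>2)"
      unfolding defect_y_def by (intro continuous_intros) simp
  qed (rule pot0)
  have "(LINT q|lborel. ?B (fst q) * (bump_z (snd q))\<^sup>2) = (LINT y|lborel. LINT z|lborel. ?B y * (bump_z z)\<^sup>2)"
    using lborel_pair.integral_fst'[of "\<lambda>q. ?B (fst q) * (bump_z (snd q))\<^sup>2", unfolded lborel_prod, OF b] unfolding fst_conv snd_conv ..
  also have "\<dots> = (LINT y|lborel. ?B y) * (LINT z|lborel. (bump_z z)\<^sup>2)"
    by (simp only: integral_mult_right_zero integral_mult_left_zero)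
  also have "\<dots> > 0" by (intro mult_pos_pos bump_balance bump_z_square_integral_pos)
  finally have pos: "(LINT q|lborel. ?B (fst q) * (bump_z (snd q))\<^sup>2) > 0" .
  have "(LINT q|lborel. ?d q) \<le> (LINT q|lborel. comp_potential_z' q + comp_potential_y' q - (1/400) * (?B (fst q) * (bump_z (snd q))\<^sup>2))"
    by (intro integral_mono int Bochner_Integration.integrable_diff Bochner_Integration.integrable_add z y
      integrable_mult_right b competitor_area_bound)
  also have "\<dots> = 0 + 0 - (1/400) * (LINT q|lborel. ?B (fst q) * (bump_z (snd q))\<^sup>2)"
    by (subst Bochner_Integration.integral_diff[OF Bochner_Integration.integrable_add[OF z(2) y(2)] integrable_mult_right[OF b]],
      subst Bochner_Integration.integral_add[OF z(2) y(2)], subst integral_mult_right_zero) (simp add: z y)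
  also have "\<dots> < 0" using pos by simp
  finally show "(LINT q|lborel. ?d q) < 0" .
qed

theorem twisted_not_minimizing: "\<not> area_minimizing_graph twisted"
proof
  assume "area_minimizing_graph twisted"
  then have min: "open \<Omega> \<Longrightarrow> bounded \<Omega> \<Longrightarrow> F \<in> sets lebesgue \<Longrightarrow> (saddle - F) \<union> (F - saddle) \<subset>\<subset> \<Omega> \<Longrightarrow>
      perimeter saddle \<Omega> \<le> perimeter F \<Omega>" for \<Omega> F
    unfolding area_minimizing_graph_def minimal_perimeter_def intrinsic_subgraph_twisted by blast
  interpret I: compact_contact id by (rule compact_contact_id)
  \<comment> \<open>The x-range is wide enough that over the rectangle \<open>D\<close> below, where
    \<bar>y z\<bar> \<le> 4, both graphs stay inside. Hence the two surfaces meet \<Omega> over the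
    same parameters and their areas can be compared pointwise.\<close>
  define \<Omega> :: "heis set" where "\<Omega> = {-10<..<10} \<times> {-4<..<4} \<times> {-1<..<1}"
  define F where "F = {p. fst p \<le> competitor (snd p)}"
  have \<Omega>: "open \<Omega>" "bounded \<Omega>" unfolding \<Omega>_def by (intro open_Times bounded_Times; simp)+
  have cc: "continuous_on UNIV competitor" using Ck_on_mono[OF Ck_on_competitor, of 0] by simp
  have "closed F"
    unfolding F_def by (intro closed_Collect_le continuous_intros continuous_on_compose2[OF cc]) auto
  then have Fm: "F \<in> sets lebesgue" by (simp add: borel_closed sets_completionI_sets)
  have v01: "0 \<le> variation q" "variation q \<le> 1" for q
    using bump_bounds(1,2)[of "fst q"] bump_bounds(3,4)[of "snd q"] by (auto simp: variation_def intro: mult_le_one)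
  \<comment> \<open>Where the sets differ, \<bar>y\<bar> \<le> 3 and \<bar>z\<bar> \<le> 1/2, so
    \<bar>x\<bar> \<le> 3/2 + 1/20 < 2.\<close>
  let ?K = "{-2..2} \<times> {-3..3} \<times> {-1/2..1/2} :: heis set"
  have K: "compact ?K" by (intro compact_Times) auto
  have "(saddle - F) \<union> (F - saddle) \<subseteq> ?K"
  proof
    fix p assume p: "p \<in> (saddle - F) \<union> (F - saddle)"
    obtain x y z where [simp]: "p = (x, y, z)" by (metis prod.exhaust)
    have x: "y * z < x" "x \<le> y * z + variation (y, z) / 20"
      using p v01(1)[of "(y, z)"] by (auto simp: saddle_def F_def competitor_def)
    then have "variation (y, z) \<noteq> 0" by auto
    then have yz: "(y, z) \<in> {-3..3} \<times> {-1/2..1/2}"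
      using competitor_off_support[of "(y, z)"] by (auto simp: variation_def)
    then have "\<bar>y\<bar> * \<bar>z\<bar> \<le> 3 * (1/2)" by (intro mult_mono) auto
    then have "\<bar>y * z\<bar> \<le> 3/2" by (simp add: abs_mult)
    then have "-2 \<le> x" "x \<le> 2" using x v01(2)[of "(y, z)"] unfolding abs_le_iff by linarith+
    then show "p \<in> ?K" using yz by simp
  qed
  then have "closure ((saddle - F) \<union> (F - saddle)) \<subseteq> ?K"
    by (rule closure_minimal) (rule compact_imp_closed[OF K])
  moreover have "compact (closure ((saddle - F) \<union> (F - saddle)))"
    using compact_Int_closed[OF K closed_closure, of "(saddle - F) \<union> (F - saddle)"] calculation by (simp only: Int_absorb1)
  moreover have "?K \<subseteq> \<Omega>" by (auto simp: \<Omega>_def)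
  ultimately have sub: "(saddle - F) \<union> (F - saddle) \<subset>\<subset> \<Omega>" unfolding compactly_in_def by blast
  define D :: "(real \<times> real) set" where "D = {-4<..<4} \<times> {-1<..<1}"
  have prod4: "\<bar>y * z\<bar> \<le> 4" if "(y, z) \<in> D" for y z
  proof -
    have "\<bar>y\<bar> * \<bar>z\<bar> \<le> 4 * 1" using that by (intro mult_mono) (auto simp: D_def)
    then show ?thesis by (simp add: abs_mult)
  qed
  have DE: "{q. saddle_point q \<in> \<Omega>} = D"
    using prod4 by (force simp: saddle_point_def \<Omega>_def D_def)
  have DF: "{q. (competitor q, q) \<in> \<Omega>} = D"
  proof (intro set_eqI iffI)
    fix q assume q: "q \<in> D"
    then have "\<bar>fst q * snd q\<bar> \<le> 4" using prod4[of "fst q" "snd q"] by simp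
    then have "- 10 < competitor q" "competitor q < 10" using v01[of q] unfolding competitor_def abs_le_iff by linarith+
    then show "q \<in> {q. (competitor q, q) \<in> \<Omega>}" using q by (simp add: \<Omega>_def D_def)
  qed (auto simp: \<Omega>_def D_def)
  let ?e = "\<lambda>q. indicator D q * area_density id q"
  let ?d = "\<lambda>q. sqrt ((competitor_P q)\<^sup>2 + (competitor_Q q)\<^sup>2) - area_density id q"
  have fin: "perimeter (id ` saddle) \<Omega> < \<infinity>"
    using image_area_bounded_finite[OF \<Omega>] by (simp add: image_area_twisted)
  have e: "integrable lborel ?e"
    using I.perimeter_eq_integral(2)[OF \<Omega>(1) _ fin] by (simp add: DE)
  have pE: "perimeter saddle \<Omega> = ereal (LINT q|lborel. ?e q)"
    using I.perimeter_eq_integral(1)[OF \<Omega>(1)] e by (simp add: DE)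
  have eq: "(\<lambda>q. indicator D q * sqrt ((competitor_P q)\<^sup>2 + (competitor_Q q)\<^sup>2)) = (\<lambda>q. ?e q + ?d q)"
  proof
    fix q
    show "indicator D q * sqrt ((competitor_P q)\<^sup>2 + (competitor_Q q)\<^sup>2) = ?e q + ?d q"
    proof (cases "q \<in> D")
      case False
      then have "q \<notin> {-3..3} \<times> {-1/2..1/2}" by (auto simp: D_def)
      then show ?thesis using False competitor_gain(3)[of q] by simp
    qed simp
  qed
  have "integrable lborel (\<lambda>q. indicator D q * sqrt ((competitor_P q)\<^sup>2 + (competitor_Q q)\<^sup>2))"
    unfolding eq by (intro Bochner_Integration.integrable_add e competitor_gain)
  then have "perimeter F \<Omega> \<le> ereal (LINT q|lborel. indicator D q * sqrt ((competitor_P q)\<^sup>2 + (competitor_Q q)\<^sup>2))"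
    using perimeter_graph_le[OF Ck_on_competitor, of \<Omega>] unfolding F_def DF competitor_P_def competitor_Q_def by simp
  also have "(LINT q|lborel. indicator D q * sqrt ((competitor_P q)\<^sup>2 + (competitor_Q q)\<^sup>2)) = (LINT q|lborel. ?e q) + (LINT q|lborel. ?d q)"
    unfolding eq by (intro Bochner_Integration.integral_add e competitor_gain)
  also have "ereal \<dots> < ereal (LINT q|lborel. ?e q)" using competitor_gain(1) by simp
  finally have "perimeter F \<Omega> < perimeter saddle \<Omega>" unfolding pE .
  then show False using min[OF \<Omega> Fm sub] by simp
qed

text \<open>Since area can be infinite on an unbounded \<Omega>, the variational clause asks for
  finite area there; the first clause ensures that it covers every bounded open set. The real
  function \<open>A\<close> represents the area, so its derivatives make sense.\<close>

theorem theorem1p1: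
  shows "\<exists>f\<in>C1W.
     (\<forall>\<Omega>. open \<Omega> \<and> bounded \<Omega> \<longrightarrow> image_area id f \<Omega> < \<infinity>) \<and>
     (\<forall>\<Omega> I \<Phi>. open \<Omega> \<and> image_area id f \<Omega> < \<infinity> \<and> contact_variation \<Omega> I \<Phi> \<longrightarrow>
        (\<exists>A D. (\<forall>\<epsilon>\<in>I. image_area (\<Phi> \<epsilon>) f \<Omega> = ereal (A \<epsilon>)) \<and>
           (A has_real_derivative 0) (at 0) \<and>
           (\<forall>\<^sub>F \<epsilon> in nhds 0. A differentiable (at \<epsilon>)) \<and>
           (deriv A has_real_derivative D) (at 0) \<and> D \<ge> 0)) \<and>
     \<not> area_minimizing_graph f"
  using twisted_C1W image_area_bounded_finite twisted_contact_stable twisted_not_minimizing by blast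

end
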